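(* Let $0<\alpha<Q$, $\sigma=\frac{Q+\alpha}{Q-\alpha}$, and let $u\in L^{\sigma+1}_{loc}(\mathbb{H}^n)$ be a nonnegative cylindrical solution of $$u(\xi)=\int_{\mathbb{H}^n}|\xi^{-1}\eta|^{-(Q-\alpha)}\,u(\eta)^{\frac{Q+\alpha}{Q-\alpha}}\,d\eta ,\qquad \xi\in\mathbb{H}^n .$$ Then there exists $s>0$ such that $$u(r,t)=\frac{s^{Q-\alpha}}{\rho^{Q-\alpha}}\,u\!\left(\frac{s^2r}{\rho^2},\frac{s^4t}{\rho^4}\right)\qquad\text{for all }(r,t)\ne(0,0),$$ where $\rho=(r^4+t^2)^{1/4}$; i.e. $u$ is CR inversion symmetric with respect to the sphere $\partial B(0,s)$.
   Context: $\mathbb{H}^n=\mathbb{C}^n\times\mathbb{R}$ is the Heisenberg group with group law $(z,t)(p,s)=(z+p,\,t+s+2\,\mathrm{Im}\langle z,p\rangle)$, $\langle z,p\rangle=\sum_{j=1}^n z_j\overline{p_j}$, so $(z,t)^{-1}=(-z,-t)$. $Q=2n+2$. The Heisenberg norm is $|(z,t)|=(|z|^4+t^2)^{1/4}$; $B(0,s)=\{(z,t):|(z,t)|<s\}$. $d\eta$ is Lebesgue measure. A function $u$ on $\mathbb{H}^n$ is cylindrical if $u(z,t)$ depends only on $r=|z|$ and $t$; one then writes $u(z,t)=u(r,t)$. *)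

theory Defs
  imports "HOL-Analysis.Analysis"
begin

text \<open>The Heisenberg group of complex dimension \<open>n = CARD('n)\<close>. The topology and
  Lebesgue measure are those of the product type; its norm and addition are not the Heisenberg
  ones.\<close>

type_synonym 'n heis = "(complex ^ 'n) \<times> real"

definition herm :: "complex ^ 'n::finite \<Rightarrow> complex ^ 'n \<Rightarrow> complex"
  where "herm z p = (\<Sum>j\<in>UNIV. z $ j * cnj (p $ j))"

definition heis_mult :: "'n::finite heis \<Rightarrow> 'n heis \<Rightarrow> 'n heis"
  where "heis_mult \<xi> \<eta> =
    (fst \<xi> + fst \<eta>, snd \<xi> + snd \<eta> + 2 * Im (herm (fst \<xi>) (fst \<eta>)))"

definition heis_inv :: "'n::finite heis \<Rightarrow> 'n heis"
  where "heis_inv \<xi> = (- fst \<xi>, - snd \<xi>)"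

definition heis_norm :: "'n::finite heis \<Rightarrow> real"
  where "heis_norm \<xi> = (norm (fst \<xi>) ^ 4 + snd \<xi> ^ 2) powr (1 / 4)"

lemma heis_mult_inv: "heis_mult (heis_inv \<xi>) \<xi> = 0" "heis_mult \<xi> (heis_inv \<xi>) = 0"
  by (simp_all add: heis_mult_def heis_inv_def herm_def zero_prod_def Im_sum algebra_simps)

definition Lp_loc :: "real \<Rightarrow> ('a::euclidean_space \<Rightarrow> real) set"
  where "Lp_loc p = {f \<in> borel_measurable lebesgue.
    \<forall>K. compact K \<longrightarrow> set_integrable lebesgue K (\<lambda>x. \<bar>f x\<bar> powr p)}"

text \<open>\<open>u\<close> is cylindrical and \<open>v r t\<close> is what is written \<open>u(r,t)\<close> by abuse of notation.
  Only the values of \<open>v\<close> at \<open>r \<ge> 0\<close> are determined by \<open>u\<close>.\<close>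

definition cylindrical_with :: "('n::finite heis \<Rightarrow> real) \<Rightarrow> (real \<Rightarrow> real \<Rightarrow> real) \<Rightarrow> bool"
  where "cylindrical_with u v \<longleftrightarrow> (\<forall>z t. u (z, t) = v (norm z) t)"

text \<open>The equation is required at every point, with a convergent integral. At \<open>\<eta> = \<xi>\<close> the
  kernel takes the value \<open>0\<close> since \<open>0 powr a = 0\<close>; this is a null set.\<close>

definition solves_integral_eq :: "real \<Rightarrow> real \<Rightarrow> ('n::finite heis \<Rightarrow> real) \<Rightarrow> bool"
  where "solves_integral_eq Q \<alpha> u \<longleftrightarrow> (\<forall>\<xi>. has_bochner_integral lebesgue
    (\<lambda>\<eta>. heis_norm (heis_mult (heis_inv \<xi>) \<eta>) powr (- (Q - \<alpha>))
          * u \<eta> powr ((Q + \<alpha>) / (Q - \<alpha>))) (u \<xi>))"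

end

theory Submission
  imports Defs
begin

text \<open>
  The proof is by moving spheres, all centred at the origin. Writing
  \<open>A = |z|^2 + |w|^2 + i (s - t)\<close>, one has \<open>|\<xi>\<inverse> \<eta>|^2 = |A - 2 \<langle>z, w\<rangle>|\<close> for \<open>\<xi> = (z, t)\<close> and
  \<open>\<eta> = (w, s)\<close>. The difference between the kernel and its Kelvin transform has no sign, but
  averaging over the circle action \<open>z \<mapsto> e^{i\<theta>} z\<close>, which does not change cylindrical functions,
  turns the kernel into a decreasing function of \<open>|A|\<close> for fixed \<open>|\<langle>z, w\<rangle>|\<close>, and the inversion
  in the sphere of radius \<open>l\<close> replaces \<open>|A|^2\<close> by
  \<open>|A|^2 + (|\<xi>|^4 - l^4) (|\<eta>|^4 - l^4) / l^4\<close>, which is larger when both points lie outside the sphere.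

  The spheres start and move on by the diagonal Hardy--Littlewood--Sobolev inequality, since the
  Kelvin transform of \<open>u\<close> has finite critical norm outside the sphere; lower semicontinuity of
  \<open>u\<close>, which is Fatou's lemma, replaces any regularity theory. If they never stop, then
  \<open>u \<le> 2^\<beta> u(\<delta>_2 \<cdot>)\<close> with \<open>\<beta> = (Q - \<alpha>) / 2\<close>, both being solutions. A solution lying strictly
  below another one is stable, and stability bounds its critical energy on a fixed ball by a
  universal constant. Applied to all rescalings of \<open>u\<close> this gives finite total energy, which is
  invariant under rescaling, so that the two ordered solutions agree and \<open>u\<close> vanishes.
\<close>


section \<open>The Heisenberg group\<close>

text \<open>The inversion of the theorem moves a point along its dilation orbit and keeps the sign
  of \<open>t\<close>. It is not covariant for the kernel itself: inverting both points multiplies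
  \<open>|A|\<close> and \<open>|<z, w>|\<close> by one and the same factor, but in general changes
  the argument of \<open>A\<close> relative to \<open><z, w>\<close>. So the circle average is
  needed not only to get a sign, but already for the Kelvin transform of a cylindrical solution to
  satisfy an equation of the same kind. Off the null set where the two \<open>t\<close>-coordinates
  agree, the average is finite and strictly monotone, which supplies the rigidity at the critical
  radius.

  As all spheres share one centre, the case of spheres that never stop cannot be settled by varying
  the centre. It only compares \<open>u\<close> with its dilates, whence the stability argument.

  Smallness is measured on the part of the ball where \<open>u\<close> exceeds its Kelvin transform.
  Seen from inside, lower semicontinuity in the radius points in the direction that is required for
  moving on. Integrals are extended nonnegative, so kernel differences appear as inequalities
  between sums.\<close>

definition hdist :: "'n::finite heis \<Rightarrow> 'n heis \<Rightarrow> real"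
  where "hdist \<xi> \<eta> = heis_norm (heis_mult (heis_inv \<xi>) \<eta>)"

definition dil :: "real \<Rightarrow> 'n::finite heis \<Rightarrow> 'n heis"
  where "dil s \<xi> = (s *\<^sub>R fst \<xi>, s\<^sup>2 * snd \<xi>)"

definition rot :: "real \<Rightarrow> 'n::finite heis \<Rightarrow> 'n heis"
  where "rot \<theta> \<xi> = (cis \<theta> *s fst \<xi>, snd \<xi>)"

definition gauge_point :: "'n::finite heis \<Rightarrow> 'n heis \<Rightarrow> complex"
  where "gauge_point \<xi> \<eta> = Complex ((norm (fst \<xi>))\<^sup>2 + (norm (fst \<eta>))\<^sup>2) (snd \<eta> - snd \<xi>)"

lemma norm_vec_power2: "(norm (z :: complex ^ 'n::finite))\<^sup>2 = (\<Sum>j\<in>UNIV. (norm (z $ j))\<^sup>2)"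
  by (simp add: norm_vec_def L2_set_def sum_nonneg)

lemma norm_herm_le: "norm (herm z w) \<le> norm z * norm w"
proof -
  have "norm (herm z w) \<le> (\<Sum>j\<in>UNIV. \<bar>norm (z $ j)\<bar> * \<bar>norm (w $ j)\<bar>)"
    unfolding herm_def by (intro order_trans[OF norm_sum] sum_mono) (simp add: norm_mult)
  also have "\<dots> \<le> norm z * norm w"
    unfolding norm_vec_def by (rule L2_set_mult_ineq)
  finally show ?thesis .
qed

lemma norm_add_power2_herm:
  "(norm (z + w :: complex ^ 'n::finite))\<^sup>2 = (norm z)\<^sup>2 + (norm w)\<^sup>2 + 2 * Re (herm z w)"
proof -
  have *: "(norm (a + b))\<^sup>2 = (norm a)\<^sup>2 + (norm b)\<^sup>2 + 2 * Re (a * cnj b)" for a b :: complex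
    unfolding cmod_power2 by (simp add: power2_eq_square algebra_simps)
  show ?thesis
    unfolding norm_vec_power2 herm_def
    by (simp add: * sum.distrib sum_distrib_left)
qed

lemma herm_simps [simp]:
  "herm (- z) w = - herm z w" "herm z (- w) = - herm z w"
  "herm (a *\<^sub>R z) w = a *\<^sub>R herm z w" "herm z (a *\<^sub>R w) = a *\<^sub>R herm z w"
  "herm (c *s z) w = c * herm z w" "herm z (c *s w) = cnj c * herm z w"
  "herm 0 w = 0" "herm z 0 = 0"
  by (auto simp: herm_def sum_negf scaleR_sum_right sum_distrib_left algebra_simps)

lemma cnj_herm: "cnj (herm z w) = herm w z"
  by (simp add: herm_def mult.commute)

lemma herm_add: "herm (x + y) w = herm x w + herm y w" "herm w (x + y) = herm w x + herm w y"
  by (auto simp: herm_def sum.distrib algebra_simps)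

lemma heis_norm_nonneg [simp]: "0 \<le> heis_norm \<xi>"
  by (simp add: heis_norm_def)

lemma heis_norm_power4: "heis_norm \<xi> ^ 4 = norm (fst \<xi>) ^ 4 + (snd \<xi>)\<^sup>2"
proof -
  have "0 \<le> norm (fst \<xi>) ^ 4 + (snd \<xi>)\<^sup>2" by simp
  then show ?thesis
    unfolding heis_norm_def by (cases "norm (fst \<xi>) ^ 4 + (snd \<xi>)\<^sup>2 = 0") 
      (simp_all add: powr_powr flip: powr_numeral)
qed

lemma heis_norm_power2: "(heis_norm \<xi>)\<^sup>2 = cmod (Complex ((norm (fst \<xi>))\<^sup>2) (snd \<xi>))"
proof -
  have "((heis_norm \<xi>)\<^sup>2)\<^sup>2 = (cmod (Complex ((norm (fst \<xi>))\<^sup>2) (snd \<xi>)))\<^sup>2"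
    using heis_norm_power4[of \<xi>] by (simp add: cmod_power2 flip: power_mult)
  then show ?thesis by (subst (asm) power2_eq_iff_nonneg) auto
qed

lemma heis_norm_eq_0_iff [simp]: "heis_norm \<xi> = 0 \<longleftrightarrow> \<xi> = 0"
proof -
  have "heis_norm \<xi> = 0 \<longleftrightarrow> heis_norm \<xi> ^ 4 = 0" by simp
  also have "\<dots> \<longleftrightarrow> \<xi> = 0"
    unfolding heis_norm_power4 by (auto simp: add_nonneg_eq_0_iff prod_eq_iff)
  finally show ?thesis .
qed

lemma heis_norm_0 [simp]: "heis_norm 0 = 0"
  by simp

lemma heis_norm_pos_iff [simp]: "0 < heis_norm \<xi> \<longleftrightarrow> \<xi> \<noteq> 0"
  using heis_norm_nonneg[of \<xi>] heis_norm_eq_0_iff[of \<xi>] by linarith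

lemma hdist_nonneg [simp]: "0 \<le> hdist \<xi> \<eta>"
  by (simp add: hdist_def)

lemma hdist_power2: "(hdist \<xi> \<eta>)\<^sup>2 = cmod (gauge_point \<xi> \<eta> - 2 * herm (fst \<xi>) (fst \<eta>))"
  unfolding hdist_def heis_norm_power2
proof (rule arg_cong[where f = cmod], rule complex_eqI)
  show "Re (Complex ((norm (fst (heis_mult (heis_inv \<xi>) \<eta>)))\<^sup>2) (snd (heis_mult (heis_inv \<xi>) \<eta>)))
      = Re (gauge_point \<xi> \<eta> - 2 * herm (fst \<xi>) (fst \<eta>))"
    using norm_add_power2_herm[of "- fst \<xi>" "fst \<eta>"]
    by (simp add: heis_mult_def heis_inv_def gauge_point_def)
qed (simp add: heis_mult_def heis_inv_def gauge_point_def)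

lemma hdist_commute: "hdist \<xi> \<eta> = hdist \<eta> \<xi>"
proof -
  have "cmod (gauge_point \<xi> \<eta> - 2 * herm (fst \<xi>) (fst \<eta>))
      = cmod (cnj (gauge_point \<xi> \<eta> - 2 * herm (fst \<xi>) (fst \<eta>)))"
        by (rule complex_mod_cnj[symmetric])
  also have "cnj (gauge_point \<xi> \<eta> - 2 * herm (fst \<xi>) (fst \<eta>))
    = gauge_point \<eta> \<xi> - 2 * herm (fst \<eta>) (fst \<xi>)"
    by (simp add: cnj_herm) (simp add: gauge_point_def complex_eq_iff)
  finally have "(hdist \<xi> \<eta>)\<^sup>2 = (hdist \<eta> \<xi>)\<^sup>2" by (simp only: hdist_power2)
  then show ?thesis by (subst (asm) power2_eq_iff_nonneg) auto
qed

lemma heis_mult_assoc: "heis_mult (heis_mult a b) c = heis_mult a (heis_mult b c)"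
  by (simp add: heis_mult_def herm_add algebra_simps)

lemma heis_mult_0 [simp]: "heis_mult 0 a = a" "heis_mult a 0 = a"
  by (simp_all add: heis_mult_def)

lemma heis_mult_inv_cancel [simp]:
  "heis_mult (heis_inv a) (heis_mult a b) = b" "heis_mult a (heis_mult (heis_inv a) b) = b"
  by (simp_all add: heis_mult_inv flip: heis_mult_assoc)

lemma hdist_eq_0_iff [simp]: "hdist \<xi> \<eta> = 0 \<longleftrightarrow> \<xi> = \<eta>"
  unfolding hdist_def heis_norm_eq_0_iff
  by (metis heis_mult_0(2) heis_mult_inv(1) heis_mult_inv_cancel(2))

lemma hdist_self [simp]: "hdist \<xi> \<xi> = 0"
  by simp

lemma hdist_pos_iff [simp]: "0 < hdist \<xi> \<eta> \<longleftrightarrow> \<xi> \<noteq> \<eta>"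
  using hdist_nonneg[of \<xi> \<eta>] hdist_eq_0_iff[of \<xi> \<eta>] by linarith

lemma hdist_0 [simp]: "hdist 0 \<eta> = heis_norm \<eta>" "hdist \<eta> 0 = heis_norm \<eta>"
proof -
  have [simp]: "heis_inv (0 :: 'a heis) = 0" by (simp add: heis_inv_def zero_prod_def)
  show "hdist 0 \<eta> = heis_norm \<eta>" by (simp add: hdist_def)
  then show "hdist \<eta> 0 = heis_norm \<eta>" by (simp add: hdist_commute)
qed

text \<open>The squared norm is the modulus of \<open>|z|^2 + i t\<close>. For a product this number
  is the sum of those of the factors plus twice their Hermitian product, so Cauchy-Schwarz completes
  the square.\<close>

lemma heis_norm_triangle: "heis_norm (heis_mult a b) \<le> heis_norm a + heis_norm b"
proof -
  let ?g = "\<lambda>\<xi> :: 'a heis. Complex ((norm (fst \<xi>))\<^sup>2) (snd \<xi>)"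
  have norm_fst_le: "norm (fst \<xi>) \<le> heis_norm \<xi>" for \<xi> :: "'a heis"
    using heis_norm_power4[of \<xi>] by (subst power_mono_iff[of _ _ 4, symmetric]) auto
  have eq: "?g (heis_mult a b) = ?g a + ?g b + 2 * herm (fst a) (fst b)"
    by (simp add: complex_eq_iff heis_mult_def norm_add_power2_herm)
  have "(heis_norm (heis_mult a b))\<^sup>2 \<le> cmod (?g a) + cmod (?g b) + cmod (2 * herm (fst a) (fst b))"
    unfolding heis_norm_power2 eq
    using norm_triangle_ineq[of "?g a + ?g b" "2 * herm (fst a) (fst b)"]
      norm_triangle_ineq[of "?g a" "?g b"] by linarith
  also have "\<dots> \<le> (heis_norm a)\<^sup>2 + (heis_norm b)\<^sup>2 + 2 * (heis_norm a * heis_norm b)"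
  proof -
    have "cmod (herm (fst a) (fst b)) \<le> heis_norm a * heis_norm b"
      by (rule order_trans[OF norm_herm_le]) (intro mult_mono norm_fst_le; simp)
    then show ?thesis by (simp add: norm_mult heis_norm_power2)
  qed
  also have "\<dots> = (heis_norm a + heis_norm b)\<^sup>2" by (simp add: power2_sum)
  finally show ?thesis by (rule power2_le_imp_le) simp
qed

lemma hdist_triangle: "hdist \<xi> \<zeta> \<le> hdist \<xi> \<eta> + hdist \<eta> \<zeta>"
proof -
  have "heis_mult (heis_inv \<xi>) \<zeta> =
      heis_mult (heis_mult (heis_inv \<xi>) \<eta>) (heis_mult (heis_inv \<eta>) \<zeta>)"
    by (simp add: heis_mult_assoc)
  then show ?thesis unfolding hdist_def by (metis heis_norm_triangle)
qed

lemma heis_norm_dil [simp]: "heis_norm (dil s \<xi>) = \<bar>s\<bar> * heis_norm \<xi>"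
proof -
  have "heis_norm (dil s \<xi>) ^ 4 = (\<bar>s\<bar> * heis_norm \<xi>) ^ 4"
    unfolding heis_norm_power4 power_mult_distrib 
    by (simp add: dil_def power_mult_distrib distrib_left)
  then show ?thesis by (subst (asm) power_eq_iff_eq_base) auto
qed

lemma hdist_dil: "hdist (dil s \<xi>) (dil s \<eta>) = \<bar>s\<bar> * hdist \<xi> \<eta>"
proof -
  have "heis_mult (heis_inv (dil s \<xi>)) (dil s \<eta>) = dil s (heis_mult (heis_inv \<xi>) \<eta>)"
    by (simp add: heis_mult_def heis_inv_def dil_def power2_eq_square algebra_simps)
  then show ?thesis by (simp add: hdist_def)
qed

lemma dil_1 [simp]: "dil 1 \<xi> = \<xi>" and dil_dil: "dil s (dil t \<xi>) = dil (s * t) \<xi>"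
  and dil_0 [simp]: "dil s 0 = 0"
  and dil_eq_0_iff [simp]: "dil s \<xi> = 0 \<longleftrightarrow> s = 0 \<or> \<xi> = 0"
  by (auto simp: dil_def power_mult_distrib prod_eq_iff)

lemma continuous_on_heis_norm [continuous_intros]:
  "continuous_on S f \<Longrightarrow> continuous_on S (\<lambda>x. heis_norm (f x))"
  unfolding heis_norm_def by (intro continuous_on_powr' continuous_intros) auto

lemma continuous_on_herm [continuous_intros]:
  "continuous_on S f \<Longrightarrow> continuous_on S g \<Longrightarrow> continuous_on S (\<lambda>x. herm (f x) (g x))"
  unfolding herm_def by (intro continuous_intros)

lemma continuous_on_heis_mult [continuous_intros]:
  "continuous_on S f \<Longrightarrow> continuous_on S g \<Longrightarrow> continuous_on S (\<lambda>x. heis_mult (f x) (g x))"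
  unfolding heis_mult_def by (intro continuous_intros)

lemma continuous_on_hdist [continuous_intros]:
  "continuous_on S f \<Longrightarrow> continuous_on S g \<Longrightarrow> continuous_on S (\<lambda>x. hdist (f x) (g x))"
  unfolding hdist_def heis_inv_def by (intro continuous_intros)

lemma continuous_on_dil [continuous_intros]:
  "continuous_on S f \<Longrightarrow> continuous_on S g \<Longrightarrow> continuous_on S (\<lambda>x. dil (f x) (g x))"
  unfolding dil_def by (intro continuous_intros)

lemma continuous_on_rot [continuous_intros]:
  "continuous_on S f \<Longrightarrow> continuous_on S g \<Longrightarrow> continuous_on S (\<lambda>x. rot (f x) (g x))"
  unfolding rot_def vector_scalar_mult_def 
  by (intro continuous_intros continuous_on_vec_lambda) 

lemma measurable_heis_norm [measurable]: "heis_norm \<in> borel_measurable borel"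
  by (intro borel_measurable_continuous_onI continuous_intros)

lemma measurable_dil [measurable]: "(\<lambda>x. dil (fst x) (snd x)) \<in> borel_measurable borel"
  by (intro borel_measurable_continuous_onI continuous_intros)

section \<open>Lebesgue measure on the Heisenberg group\<close>

lemma nn_integral_lborel_translate:
  fixes f :: "'a::euclidean_space \<Rightarrow> ennreal"
  assumes [measurable]: "f \<in> borel_measurable borel"
  shows "(\<integral>\<^sup>+x. f (a + x) \<partial>lborel) = (\<integral>\<^sup>+x. f x \<partial>lborel)"
proof -
  have "(\<integral>\<^sup>+x. f x \<partial>lborel) = (\<integral>\<^sup>+x. f x \<partial>distr lborel borel ((+) a))"
    by (simp add: lborel_distr_plus)
  also have "\<dots> = (\<integral>\<^sup>+x. f (a + x) \<partial>lborel)"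
    by (rule nn_integral_distr) auto
  finally show ?thesis ..
qed

lemma nn_integral_lborel_scale:
  fixes f :: "'a::euclidean_space \<Rightarrow> ennreal"
  assumes [measurable]: "f \<in> borel_measurable borel" and "c \<noteq> 0"
  shows "(\<integral>\<^sup>+x. f x \<partial>lborel) = ennreal (\<bar>c\<bar> ^ DIM('a)) * (\<integral>\<^sup>+x. f (c *\<^sub>R x) \<partial>lborel)"
proof -
  have "(\<integral>\<^sup>+x. f x \<partial>lborel) =
    (\<integral>\<^sup>+x. f x \<partial>density (distr lborel borel (\<lambda>x. 0 + c *\<^sub>R x)) (\<lambda>_. ennreal (\<bar>c\<bar> ^ DIM('a))))"
    using lborel_affine[OF assms(2), of "0::'a"] by simp
  also have "\<dots> = ennreal (\<bar>c\<bar> ^ DIM('a)) * (\<integral>\<^sup>+x. f (c *\<^sub>R x) \<partial>lborel)"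
    by (simp add: nn_integral_density nn_integral_distr nn_integral_cmult)
  finally show ?thesis .
qed

lemma nn_integral_heis:
  fixes f :: "'n::finite heis \<Rightarrow> ennreal"
  assumes [measurable]: "f \<in> borel_measurable borel"
  shows "(\<integral>\<^sup>+\<xi>. f \<xi> \<partial>lborel) = (\<integral>\<^sup>+z. \<integral>\<^sup>+t. f (z, t) \<partial>lborel \<partial>lborel)"
proof -
  have "f \<in> borel_measurable (lborel \<Otimes>\<^sub>M lborel)" by (simp add: lborel_prod)
  from lborel.nn_integral_fst[OF this] show ?thesis by (simp add: lborel_prod)
qed

text \<open>Left translation is a shear: over each fixed \<open>z\<close> it only shifts
  \<open>t\<close>, by an amount depending on \<open>z\<close>. Two Euclidean translations therefore
  suffice.\<close>

lemma nn_integral_heis_mult: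
  fixes f :: "'n::finite heis \<Rightarrow> ennreal"
  assumes [measurable]: "f \<in> borel_measurable borel"
  shows "(\<integral>\<^sup>+\<eta>. f (heis_mult \<xi> \<eta>) \<partial>lborel) = (\<integral>\<^sup>+\<eta>. f \<eta> \<partial>lborel)"
proof -
  have [measurable]: "heis_mult \<xi> \<in> borel_measurable borel"
    by (intro borel_measurable_continuous_onI continuous_intros)
  have m[measurable]: "(\<lambda>(z, t). f (z, t)) \<in> borel_measurable (borel \<Otimes>\<^sub>M borel)"
    by (simp add: borel_prod)
  have "(\<integral>\<^sup>+\<eta>. f (heis_mult \<xi> \<eta>) \<partial>lborel)
      = (\<integral>\<^sup>+z. \<integral>\<^sup>+t. f (fst \<xi> + z, (snd \<xi> + 2 * Im (herm (fst \<xi>) z)) + t) \<partial>lborel \<partial>lborel)"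
    by (subst nn_integral_heis) (measurable, simp add: heis_mult_def algebra_simps)
  also have "\<dots> = (\<integral>\<^sup>+z. \<integral>\<^sup>+t. f (fst \<xi> + z, t) \<partial>lborel \<partial>lborel)"
  proof (rule nn_integral_cong)
    fix z
    show "(\<integral>\<^sup>+t. f (fst \<xi> + z, (snd \<xi> + 2 * Im (herm (fst \<xi>) z)) + t) \<partial>lborel)
        = (\<integral>\<^sup>+t. f (fst \<xi> + z, t) \<partial>lborel)"
      by (rule nn_integral_lborel_translate[of "\<lambda>t. f (fst \<xi> + z, t)"]) measurable
  qed
  also have "\<dots> = (\<integral>\<^sup>+z. \<integral>\<^sup>+t. f (z, t) \<partial>lborel \<partial>lborel)"
    by (subst nn_integral_lborel_translate[of "\<lambda>z. \<integral>\<^sup>+t. f (z, t) \<partial>lborel"]) auto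
  finally show ?thesis by (simp add: nn_integral_heis)
qed

abbreviation hdim :: "'n::finite itself \<Rightarrow> nat"
  where "hdim _ \<equiv> 2 * CARD('n) + 2"

lemma borel_measurable_dil [measurable (raw)]:
  assumes [measurable]: "f \<in> borel_measurable M" "g \<in> borel_measurable M"
  shows "(\<lambda>x. dil (f x) (g x)) \<in> borel_measurable M"
proof -
  have "(\<lambda>x. (f x, g x)) \<in> borel_measurable M" by measurable
  from measurable_compose[OF this measurable_dil] show ?thesis by simp
qed

lemma nn_integral_dil:
  fixes f :: "'n::finite heis \<Rightarrow> ennreal"
  assumes [measurable]: "f \<in> borel_measurable borel" and s: "s > 0"
  shows "(\<integral>\<^sup>+\<eta>. f \<eta> \<partial>lborel) = ennreal (s ^ hdim TYPE('n)) * (\<integral>\<^sup>+\<eta>. f (dil s \<eta>) \<partial>lborel)"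
proof -
  have m[measurable]: "(\<lambda>(z, t). f (z, t)) \<in> borel_measurable (borel \<Otimes>\<^sub>M borel)"
    by (simp add: borel_prod)
  have "(\<integral>\<^sup>+\<eta>. f \<eta> \<partial>lborel) = (\<integral>\<^sup>+z. \<integral>\<^sup>+t. f (z, t) \<partial>lborel \<partial>lborel)"
    by (simp add: nn_integral_heis)
  also have "\<dots> = ennreal (s ^ (2 * CARD('n))) * (\<integral>\<^sup>+z. \<integral>\<^sup>+t. f (s *\<^sub>R z, t) \<partial>lborel \<partial>lborel)"
    using s by (subst nn_integral_lborel_scale[where c = s]) (auto simp: mult.commute)
  also have "(\<integral>\<^sup>+z. \<integral>\<^sup>+t. f (s *\<^sub>R z, t) \<partial>lborel \<partial>lborel)
      = (\<integral>\<^sup>+z. ennreal (s\<^sup>2) * \<integral>\<^sup>+t. f (s *\<^sub>R z, s\<^sup>2 * t) \<partial>lborel \<partial>lborel)"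
    using s by (intro nn_integral_cong, subst nn_integral_lborel_scale[where c = "s\<^sup>2"]) auto
  also have "\<dots> = ennreal (s\<^sup>2) * (\<integral>\<^sup>+\<eta>. f (dil s \<eta>) \<partial>lborel)"
  proof -
    have "(\<integral>\<^sup>+\<eta>. f (dil s \<eta>) \<partial>lborel) = (\<integral>\<^sup>+z. \<integral>\<^sup>+t. f (s *\<^sub>R z, s\<^sup>2 * t) \<partial>lborel \<partial>lborel)"
      by (subst nn_integral_heis) (measurable, simp add: dil_def)
    then show ?thesis by (simp add: nn_integral_cmult)
  qed
  finally show ?thesis
    using s by (simp add: power_add power2_eq_square ennreal_mult' ac_simps)
qed

text \<open>The determinant is avoided by testing against the unit ball, which \<open>R\<close>
  preserves. The integral times the ball volume \<open>V\<close> is a double integral in which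
  translation invariance and Fubini move \<open>R\<close> from one factor to the other.\<close>

lemma nn_integral_linear_isometry:
  fixes R S :: "'a::euclidean_space \<Rightarrow> 'a" and f :: "'a \<Rightarrow> ennreal"
  assumes R: "linear R" and RS: "\<And>x. R (S x) = x" and nR: "\<And>x. norm (R x) = norm x"
    and f [measurable]: "f \<in> borel_measurable borel"
      and S [measurable]: "S \<in> borel_measurable borel"
  shows "(\<integral>\<^sup>+x. f (R x) \<partial>lborel) = (\<integral>\<^sup>+x. f x \<partial>lborel)"
proof -
  have [measurable]: "R \<in> borel_measurable borel"
    using R by (intro borel_measurable_continuous_onI linear_continuous_on) (simp add:
      linear_conv_bounded_linear)
  define V where "V = emeasure lborel (ball (0::'a) 1)"
  define g :: "'a \<Rightarrow> ennreal" where "g = indicator (ball 0 1)"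
  have [measurable]: "g \<in> borel_measurable borel" unfolding g_def
    by (intro borel_measurable_indicator) auto
  have V: "V \<noteq> 0" "V \<noteq> top"
    using unit_ball_vol_pos[of "DIM('a)"] by (auto simp: V_def emeasure_ball less_le)
  have V_ball: "(\<integral>\<^sup>+x. g (y - x) \<partial>lborel) = V" for y
  proof -
    have "(\<integral>\<^sup>+x. g (y - x) \<partial>lborel) = (\<integral>\<^sup>+x. g (y - (y + x)) \<partial>lborel)"
      by (subst nn_integral_lborel_translate[of "\<lambda>x. g (y - x)"]) auto
    also have "\<dots> = (\<integral>\<^sup>+x. indicator (ball (0::'a) 1) x \<partial>lborel)"
      by (intro nn_integral_cong) (simp add: g_def indicator_def)
    finally show ?thesis by (simp add: V_def)
  qed
  have "(\<integral>\<^sup>+x. f x \<partial>lborel) * V = (\<integral>\<^sup>+y. (\<integral>\<^sup>+x. f x \<partial>lborel) * g y \<partial>lborel)"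
  proof -
    have "integral\<^sup>N lborel g = V" by (simp add: g_def V_def)
    then show ?thesis by (simp add: nn_integral_cmult)
  qed
  also have "\<dots> = (\<integral>\<^sup>+y. \<integral>\<^sup>+x. f (R y + x) * g y \<partial>lborel \<partial>lborel)"
    by (subst nn_integral_multc) (simp_all add: nn_integral_lborel_translate)
  also have "\<dots> = (\<integral>\<^sup>+x. \<integral>\<^sup>+y. f (R y + x) * g y \<partial>lborel \<partial>lborel)"
    by (rule lborel_pair.Fubini') measurable
  also have "\<dots> = (\<integral>\<^sup>+x. \<integral>\<^sup>+y. f (R y) * g (y - S x) \<partial>lborel \<partial>lborel)"
  proof (rule nn_integral_cong)
    fix x
    show "(\<integral>\<^sup>+y. f (R y + x) * g y \<partial>lborel) = (\<integral>\<^sup>+y. f (R y) * g (y - S x) \<partial>lborel)"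
      by (subst nn_integral_lborel_translate[symmetric, of _ "S x"])
         (auto simp: linear_add[OF R] RS add.commute)
  qed
  also have "\<dots> = (\<integral>\<^sup>+y. \<integral>\<^sup>+x. f (R y) * g (y - S x) \<partial>lborel \<partial>lborel)"
    by (rule lborel_pair.Fubini') measurable
  also have "\<dots> = (\<integral>\<^sup>+y. \<integral>\<^sup>+x. f (R y) * g (R y - x) \<partial>lborel \<partial>lborel)"
  proof (intro nn_integral_cong)
    fix x y
    have "norm (y - S x) = norm (R y - x)" by (metis nR RS R linear_diff)
    then show "f (R y) * g (y - S x) = f (R y) * g (R y - x)" by (simp add: g_def indicator_def)
  qed
  also have "\<dots> = (\<integral>\<^sup>+y. f (R y) \<partial>lborel) * V"
    by (simp add: nn_integral_cmult V_ball nn_integral_multc)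
  finally have "(\<integral>\<^sup>+x. f x \<partial>lborel) * V = (\<integral>\<^sup>+y. f (R y) \<partial>lborel) * V" .
  with V show ?thesis by (metis ennreal_mult_cancel_left mult.commute)
qed

lemma norm_vector_scalar_mult: "norm (c *s (z :: complex ^ 'n::finite)) = norm c * norm z"
proof -
  have "(norm (c *s z))\<^sup>2 = (norm c * norm z)\<^sup>2"
    by (simp add: norm_vec_power2 power_mult_distrib norm_mult sum_distrib_left)
  then show ?thesis by (subst (asm) power2_eq_iff_nonneg) auto
qed

lemma borel_measurable_rot [measurable]: "rot \<theta> \<in> borel_measurable borel"
  by (intro borel_measurable_continuous_onI continuous_intros)

lemma nn_integral_rot:
  fixes f :: "'n::finite heis \<Rightarrow> ennreal"
  assumes [measurable]: "f \<in> borel_measurable borel"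
  shows "(\<integral>\<^sup>+\<eta>. f (rot \<theta> \<eta>) \<partial>lborel) = (\<integral>\<^sup>+\<eta>. f \<eta> \<partial>lborel)"
proof (rule nn_integral_linear_isometry)
  have cc: "cis \<theta> * cis (- \<theta>) = 1"
    by (simp only: cis_mult) simp
  show "linear (rot \<theta> :: 'n heis \<Rightarrow> _)"
    by (rule linearI) (auto simp: rot_def vec_eq_iff algebra_simps)
  show "rot \<theta> (rot (- \<theta>) x) = x" for x :: "'n heis"
    by (simp add: rot_def vec_eq_iff cc flip: mult.assoc)
  show "norm (rot \<theta> x) = norm x" for x :: "'n heis"
    by (simp add: rot_def norm_prod_def norm_vector_scalar_mult)
qed auto

text \<open>The map \<open>(r, t)\<close> to \<open>(l^2 r / \<rho>^2, l^4 t / \<rho>^4)\<close> of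
  the theorem, written as a dilation whose factor depends on the point. At the origin the quotient
  is \<open>0\<close> by convention, so \<open>0\<close> is fixed.\<close>

definition hinv :: "real \<Rightarrow> 'n::finite heis \<Rightarrow> 'n heis"
  where "hinv l \<xi> = dil (l\<^sup>2 / (heis_norm \<xi>)\<^sup>2) \<xi>"

lemma borel_measurable_hinv [measurable (raw)]:
  assumes [measurable]: "f \<in> borel_measurable M" "g \<in> borel_measurable M"
  shows "(\<lambda>x. hinv (f x) (g x)) \<in> borel_measurable M"
  unfolding hinv_def by measurable

lemma heis_norm_hinv: "heis_norm (hinv l \<xi>) = l\<^sup>2 / heis_norm \<xi>"
  by (simp add: hinv_def power2_eq_square)

lemma hinv_hinv: "l > 0 \<Longrightarrow> \<xi> \<noteq> 0 \<Longrightarrow> hinv l (hinv l \<xi>) = \<xi>"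
  unfolding hinv_def[of l "hinv l \<xi>"] heis_norm_hinv
  by (simp add: hinv_def dil_dil field_simps power2_eq_square)

lemma nn_integral_inverse:
  assumes "0 < a" "a < b"
  shows "(\<integral>\<^sup>+s. ennreal (inverse s) * indicator {a..b} s \<partial>lborel) = ennreal (ln (b / a))"
proof -
  have "(\<integral>\<^sup>+s. ennreal (inverse s) * indicator {a..b} s \<partial>lborel) = ennreal (ln b - ln a)"
    using assms by (intro nn_integral_FTC_Icc) (auto intro!: derivative_eq_intros simp:
      inverse_eq_divide)
  then show ?thesis using assms by (simp add: ln_div)
qed

text \<open>The Jacobian is found without differentiating. The measure \<open>m\<close> with density
  \<open>|\<eta>|^(-Q)\<close> is invariant under dilations, and \<open>hinv\<close> reverses
  dilations, so it preserves \<open>m\<close>. The weight in the claim is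
  \<open>|hinv l \<eta>|^Q * |\<eta>|^(-Q)\<close>.\<close>

lemma nn_integral_hinv:
  fixes f :: "'n::finite heis \<Rightarrow> ennreal"
  assumes [measurable]: "f \<in> borel_measurable borel" and l: "l > 0"
  shows "(\<integral>\<^sup>+\<eta>. f (hinv l \<eta>) * ennreal ((l / heis_norm \<eta>) ^ (2 * hdim TYPE('n))) \<partial>lborel)
    = (\<integral>\<^sup>+\<eta>. f \<eta> \<partial>lborel)"
proof -
  let ?Q = "hdim TYPE('n)"
  define m :: "'n heis \<Rightarrow> ennreal" where "m = (\<lambda>\<eta>. ennreal (inverse (heis_norm \<eta> ^ ?Q)))"
  \<comment> \<open>A cutoff whose integral over each dilation orbit against \<open>ds / s\<close>
    is the finite positive number \<open>ln 4\<close>, both in \<open>s\<close> and in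
    \<open>1 / s\<close>. It serves to insert a dilation integral and to cancel it at the
    end.\<close>
  define W :: "real \<Rightarrow> ennreal" where "W = indicator {1/2..2}"
  define d :: "real \<Rightarrow> ennreal" where "d s = ennreal (inverse s) * indicator {0<..} s" for s
  have [measurable]: "m \<in> borel_measurable borel" "W \<in> borel_measurable borel" "d \<in>
    borel_measurable borel"
    unfolding m_def W_def d_def by measurable
  have m_dil: "ennreal (s ^ ?Q) * m (dil s \<eta>) = m \<eta>" if "s > 0" for s \<eta>
    using that by (simp add: m_def power_mult_distrib ennreal_mult'[symmetric] del: power_add
      power_Suc)
  have dil_inv: "(\<integral>\<^sup>+\<eta>. h \<eta> * m \<eta> \<partial>lborel) = (\<integral>\<^sup>+\<eta>. h (dil s \<eta>) * m \<eta> \<partial>lborel)"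
    if "s > 0" and [measurable]: "h \<in> borel_measurable borel" for h s
  proof -
    have "(\<integral>\<^sup>+\<eta>. h \<eta> * m \<eta> \<partial>lborel)
        = ennreal (s ^ ?Q) * (\<integral>\<^sup>+\<eta>. h (dil s \<eta>) * m (dil s \<eta>) \<partial>lborel)"
      using that by (intro nn_integral_dil) auto
    also have "\<dots> = (\<integral>\<^sup>+\<eta>. h (dil s \<eta>) * (ennreal (s ^ ?Q) * m (dil s \<eta>)) \<partial>lborel)"
      by (subst nn_integral_cmult[symmetric]) (auto intro!: nn_integral_cong simp: ac_simps)
    finally show ?thesis using that by (simp only: m_dil)
  qed
  have W1: "(\<integral>\<^sup>+s. W (s * r) * d s \<partial>lborel) = ennreal (ln 4)" if "r > 0" for r
  proof -
    have "(\<integral>\<^sup>+s. W (s * r) * d s \<partial>lborel)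
        = (\<integral>\<^sup>+s. ennreal (inverse s) * indicator {1 / (2 * r)..2 / r} s \<partial>lborel)"
    proof (rule nn_integral_cong)
      fix s :: real
      show "W (s * r) * d s = ennreal (inverse s) * indicator {1 / (2 * r)..2 / r} s"
      proof (cases "s > 0")
        case True
        with that show ?thesis by (auto simp: W_def d_def indicator_def field_simps)
      next
        case False
        moreover have "1 / (2 * r) > 0" using that by simp
        ultimately have "\<not> 1 / (2 * r) \<le> s" by linarith
        with False show ?thesis by (simp add: d_def)
      qed
    qed
    also have "\<dots> = ennreal (ln ((2 / r) / (1 / (2 * r))))"
      using that by (intro nn_integral_inverse) (auto simp: field_simps)
    finally show ?thesis using that by simp
  qed
  have W2: "(\<integral>\<^sup>+s. W (inverse s * r) * d s \<partial>lborel) = ennreal (ln 4)" if "r > 0" for r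
  proof -
    have "(\<integral>\<^sup>+s. W (inverse s * r) * d s \<partial>lborel)
        = (\<integral>\<^sup>+s. ennreal (inverse s) * indicator {r / 2..2 * r} s \<partial>lborel)"
    proof (rule nn_integral_cong)
      fix s :: real
      show "W (inverse s * r) * d s = ennreal (inverse s) * indicator {r / 2..2 * r} s"
      proof (cases "s > 0")
        case True
        with that show ?thesis by (auto simp: W_def d_def indicator_def field_simps)
      next
        case False
        moreover have "r / 2 > 0" using that by simp
        ultimately have "\<not> r / 2 \<le> s" by linarith
        with False show ?thesis by (simp add: d_def)
      qed
    qed
    also have "\<dots> = ennreal (ln ((2 * r) / (r / 2)))"
      using that by (intro nn_integral_inverse) (auto simp: field_simps)
    finally show ?thesis using that by simp
  qed
  have d_scale: "(\<integral>\<^sup>+s. h (c * s) * d s \<partial>lborel) = (\<integral>\<^sup>+s. h s * d s \<partial>lborel)"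
    if c: "c > 0" and [measurable]: "h \<in> borel_measurable borel" for c h
  proof -
    have "(\<integral>\<^sup>+s. h s * d s \<partial>lborel) = ennreal c * (\<integral>\<^sup>+s. h (c * s) * d (c * s) \<partial>lborel)"
      using c by (subst nn_integral_lborel_scale[where c = c]) auto
    also have "\<dots> = (\<integral>\<^sup>+s. h (c * s) * (ennreal c * d (c * s)) \<partial>lborel)"
      by (subst nn_integral_cmult[symmetric]) (auto intro!: nn_integral_cong simp: ac_simps)
    also have "\<dots> = (\<integral>\<^sup>+s. h (c * s) * d s \<partial>lborel)"
    proof -
      have "ennreal c * d (c * s) = d s" for s
        using c by (auto simp: d_def indicator_def zero_less_mult_iff ennreal_mult'[symmetric])
      then show ?thesis by simp
    qed
    finally show ?thesis ..
  qed
  have main: "(\<integral>\<^sup>+\<eta>. F (hinv l \<eta>) * m \<eta> \<partial>lborel) = (\<integral>\<^sup>+\<eta>. F \<eta> * m \<eta> \<partial>lborel)"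
    if [measurable]: "F \<in> borel_measurable borel" for F
  proof -
    have m0: "m 0 = 0" by (simp add: m_def)
    have "(\<integral>\<^sup>+\<eta>. F (hinv l \<eta>) * m \<eta> \<partial>lborel) * ennreal (ln 4)
        = (\<integral>\<^sup>+\<eta>. F (hinv l \<eta>) * m \<eta> * ennreal (ln 4) \<partial>lborel)"
      by (simp add: nn_integral_multc)
    also have "\<dots> = (\<integral>\<^sup>+\<eta>. \<integral>\<^sup>+s. F (hinv l \<eta>) * m \<eta> * (W (s * heis_norm \<eta>) * d s) \<partial>lborel \<partial>lborel)"
    proof (rule nn_integral_cong)
      fix \<eta> :: "'n heis"
      show "F (hinv l \<eta>) * m \<eta> * ennreal (ln 4) =
          (\<integral>\<^sup>+s. F (hinv l \<eta>) * m \<eta> * (W (s * heis_norm \<eta>) * d s) \<partial>lborel)"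
        by (cases "\<eta> = 0") (simp_all add: m0 W1 nn_integral_cmult)
    qed
    also have "\<dots> = (\<integral>\<^sup>+s. \<integral>\<^sup>+\<eta>. F (hinv l \<eta>) * m \<eta> * (W (s * heis_norm \<eta>) * d s) \<partial>lborel \<partial>lborel)"
      by (rule lborel_pair.Fubini') measurable
    \<comment> \<open>Dilating \<open>\<eta>\<close> by \<open>1 / s\<close> frees the cutoff of
      \<open>s\<close>. As \<open>hinv\<close> reverses dilations, the factor \<open>s\<close>
      reappears in the argument of \<open>F\<close>.\<close>
    also have "\<dots> = (\<integral>\<^sup>+s. \<integral>\<^sup>+\<eta>. F (dil (l\<^sup>2 / (heis_norm \<eta>)\<^sup>2 * s) \<eta>) * m \<eta> * (W (heis_norm \<eta>)
      * d s) \<partial>lborel \<partial>lborel)"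
    proof (rule nn_integral_cong)
      fix s :: real
      show "(\<integral>\<^sup>+\<eta>. F (hinv l \<eta>) * m \<eta> * (W (s * heis_norm \<eta>) * d s) \<partial>lborel) =
        (\<integral>\<^sup>+\<eta>. F (dil (l\<^sup>2 / (heis_norm \<eta>)\<^sup>2 * s) \<eta>) * m \<eta> * (W (heis_norm \<eta>) * d s) \<partial>lborel)"
      proof (cases "s > 0")
        case True
        have *: "hinv l (dil (inverse s) \<eta>) = dil (l\<^sup>2 / (heis_norm \<eta>)\<^sup>2 * s) \<eta>" for \<eta> :: "'n heis"
          using True by (simp add: hinv_def dil_dil field_simps power2_eq_square)
        have "(\<integral>\<^sup>+\<eta>. F (hinv l \<eta>) * m \<eta> * (W (s * heis_norm \<eta>) * d s) \<partial>lborel) =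
          (\<integral>\<^sup>+\<eta>. (F (hinv l \<eta>) * (W (s * heis_norm \<eta>) * d s)) * m \<eta> \<partial>lborel)"
          by (simp add: ac_simps)
        moreover have "\<dots> = (\<integral>\<^sup>+\<eta>. (F (hinv l (dil (inverse s) \<eta>)) *
            (W (s * heis_norm (dil (inverse s) \<eta>)) * d s)) * m \<eta> \<partial>lborel)"
          using True by (subst dil_inv[of "inverse s"]) auto
        moreover have "s * heis_norm (dil (inverse s) \<eta>) = heis_norm \<eta>" for \<eta> :: "'n heis"
          using True by simp
        ultimately show ?thesis by (simp only: *) (simp add: ac_simps)
      qed (simp add: d_def)
    qed
    also have "\<dots> = (\<integral>\<^sup>+\<eta>. \<integral>\<^sup>+s. F (dil (l\<^sup>2 / (heis_norm \<eta>)\<^sup>2 * s) \<eta>) * m \<eta> * (W (heis_norm \<eta>)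
      * d s) \<partial>lborel \<partial>lborel)"
      by (rule lborel_pair.Fubini') measurable
    \<comment> \<open>Here the inversion disappears: for fixed \<open>\<eta>\<close> the factor
      \<open>l^2 / |\<eta>|^2\<close> is a constant that the invariance of \<open>ds / s\<close>
      absorbs. What follows undoes the first half without it.\<close>
    also have "\<dots> = (\<integral>\<^sup>+\<eta>. \<integral>\<^sup>+s. F (dil s \<eta>) * m \<eta> * (W (heis_norm \<eta>) * d s) \<partial>lborel \<partial>lborel)"
    proof (rule nn_integral_cong)
      fix \<eta> :: "'n heis"
      show "(\<integral>\<^sup>+s. F (dil (l\<^sup>2 / (heis_norm \<eta>)\<^sup>2 * s) \<eta>) * m \<eta> * (W (heis_norm \<eta>) * d s) \<partial>lborel) =
        (\<integral>\<^sup>+s. F (dil s \<eta>) * m \<eta> * (W (heis_norm \<eta>) * d s) \<partial>lborel)"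
      proof (cases "\<eta> = 0")
        case False
        then have "l\<^sup>2 / (heis_norm \<eta>)\<^sup>2 > 0" using l by simp
        from d_scale[OF this, of "\<lambda>s. F (dil s \<eta>) * m \<eta> * W (heis_norm \<eta>)"]
        show ?thesis by (simp add: mult.assoc)
      qed (simp add: m0)
    qed
    also have "\<dots> = (\<integral>\<^sup>+s. \<integral>\<^sup>+\<eta>. F (dil s \<eta>) * m \<eta> * (W (heis_norm \<eta>) * d s) \<partial>lborel \<partial>lborel)"
      by (rule lborel_pair.Fubini'[symmetric]) measurable
    also have "\<dots> = (\<integral>\<^sup>+s. \<integral>\<^sup>+\<eta>. F \<eta> * m \<eta> * (W (inverse s * heis_norm \<eta>) * d s) \<partial>lborel \<partial>lborel)"
    proof (rule nn_integral_cong)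
      fix s :: real
      show "(\<integral>\<^sup>+\<eta>. F (dil s \<eta>) * m \<eta> * (W (heis_norm \<eta>) * d s) \<partial>lborel) =
        (\<integral>\<^sup>+\<eta>. F \<eta> * m \<eta> * (W (inverse s * heis_norm \<eta>) * d s) \<partial>lborel)"
      proof (cases "s > 0")
        case True
        have "(\<integral>\<^sup>+\<eta>. F \<eta> * m \<eta> * (W (inverse s * heis_norm \<eta>) * d s) \<partial>lborel) =
          (\<integral>\<^sup>+\<eta>. (F \<eta> * (W (inverse s * heis_norm \<eta>) * d s)) * m \<eta> \<partial>lborel)"
          by (simp add: ac_simps)
        moreover have "\<dots> = (\<integral>\<^sup>+\<eta>. (F (dil s \<eta>) * (W (inverse s * heis_norm (dil s \<eta>)) * d s))
          * m \<eta> \<partial>lborel)"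
          using True by (subst dil_inv[of s]) auto
        moreover have "inverse s * heis_norm (dil s \<eta>) = heis_norm \<eta>" for \<eta> :: "'n heis"
          using True by simp
        ultimately show ?thesis by (simp only:) (simp only: ac_simps)
      qed (simp add: d_def)
    qed
    also have "\<dots> = (\<integral>\<^sup>+\<eta>. \<integral>\<^sup>+s. F \<eta> * m \<eta> * (W (inverse s * heis_norm \<eta>) * d s) \<partial>lborel \<partial>lborel)"
      by (rule lborel_pair.Fubini') measurable
    also have "\<dots> = (\<integral>\<^sup>+\<eta>. F \<eta> * m \<eta> * ennreal (ln 4) \<partial>lborel)"
    proof (rule nn_integral_cong)
      fix \<eta> :: "'n heis"
      show "(\<integral>\<^sup>+s. F \<eta> * m \<eta> * (W (inverse s * heis_norm \<eta>) * d s) \<partial>lborel)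
        = F \<eta> * m \<eta> * ennreal (ln 4)"
        by (cases "\<eta> = 0") (simp_all add: m0 W2 nn_integral_cmult)
    qed
    also have "\<dots> = (\<integral>\<^sup>+\<eta>. F \<eta> * m \<eta> \<partial>lborel) * ennreal (ln 4)"
      by (simp add: nn_integral_multc)
    finally show ?thesis
      by (simp add: mult_right_ennreal_cancel)
  qed
  have ae: "AE \<eta> in lborel. \<eta> \<noteq> (0 :: 'n heis)" by (rule AE_lborel_singleton)
  have "(\<integral>\<^sup>+\<eta>. f (hinv l \<eta>) * ennreal ((l / heis_norm \<eta>) ^ (2 * ?Q)) \<partial>lborel)
      = (\<integral>\<^sup>+\<eta>. (\<lambda>\<eta>. f \<eta> * ennreal (heis_norm \<eta> ^ ?Q)) (hinv l \<eta>) * m \<eta> \<partial>lborel)"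
  proof (intro nn_integral_cong_AE, rule AE_mp[OF ae], intro AE_I2 impI)
    fix \<eta> :: "'n heis" assume "\<eta> \<noteq> 0"
    have "(l / heis_norm \<eta>) ^ (2 * ?Q) = (l\<^sup>2 / heis_norm \<eta>) ^ ?Q * inverse (heis_norm \<eta> ^ ?Q)"
      unfolding power_mult by (simp only: power_divide divide_inverse mult_ac power2_eq_square
        power_mult_distrib power_inverse[symmetric])
    then show "f (hinv l \<eta>) * ennreal ((l / heis_norm \<eta>) ^ (2 * ?Q))
        = (\<lambda>\<eta>. f \<eta> * ennreal (heis_norm \<eta> ^ ?Q)) (hinv l \<eta>) * m \<eta>"
      by (simp add: heis_norm_hinv m_def ennreal_mult mult.assoc del: power_add power_Suc)
  qed
  also have "\<dots> = (\<integral>\<^sup>+\<eta>. f \<eta> * ennreal (heis_norm \<eta> ^ ?Q) * m \<eta> \<partial>lborel)"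
    by (subst main) auto
  also have "\<dots> = (\<integral>\<^sup>+\<eta>. f \<eta> \<partial>lborel)"
  proof (intro nn_integral_cong_AE, rule AE_mp[OF ae], intro AE_I2 impI)
    fix \<eta> :: "'n heis" assume "\<eta> \<noteq> 0"
    then show "f \<eta> * ennreal (heis_norm \<eta> ^ ?Q) * m \<eta> = f \<eta>"
      by (simp add: m_def mult.assoc ennreal_mult'[symmetric] del: power_add power_Suc)
  qed
  finally show ?thesis .
qed

section \<open>The kernel and the Hardy--Littlewood--Sobolev inequality\<close>

lemma nn_integral_powr_from_0:
  assumes "a > -1" "c \<ge> 0"
  shows "(\<integral>\<^sup>+s. ennreal (s powr a) * indicator {0<..<c} s \<partial>lborel)
    = ennreal (c powr (a + 1) / (a + 1))"
proof -
  have "(\<integral>\<^sup>+s. ennreal (s powr a) * indicator {0<..<c} s \<partial>lborel)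
      = (\<integral>\<^sup>+s. ennreal (if s \<in> {0..c} then s powr a else 0) \<partial>lborel)"
  proof (rule nn_integral_cong_AE)
    have "AE s in lborel. s \<noteq> c" "AE s in lborel. s \<noteq> (0::real)" by (rule AE_lborel_singleton)+
    then show "AE s in lborel. ennreal (s powr a) * indicator {0<..<c} s
        = ennreal (if s \<in> {0..c} then s powr a else 0)"
      by eventually_elim (auto simp: indicator_def)
  qed
  also have "\<dots> = ennreal (c powr (a + 1) / (a + 1))"
  proof (rule nn_integral_has_integral_lborel)
    show "((\<lambda>s. if s \<in> {0..c} then s powr a else 0) has_integral (c powr (a + 1) / (a + 1))) UNIV"
      unfolding has_integral_restrict_UNIV by (rule has_integral_powr_from_0[OF assms])
  qed auto
  finally show ?thesis .
qed

lemma powr_eq_integral: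
  assumes "0 < d" "d < R" "0 < (a::real)"
  shows "ennreal (d powr - a) =
    (\<integral>\<^sup>+s. ennreal (a * s powr (- a - 1)) * indicator {d..R} s \<partial>lborel) + ennreal (R powr - a)"
proof -
  have "(\<integral>\<^sup>+s. ennreal (a * s powr (- a - 1)) * indicator {d..R} s \<partial>lborel)
      = ennreal ((- (R powr - a)) - (- (d powr - a)))"
    using assms by (intro nn_integral_FTC_Icc) (auto intro!: derivative_eq_intros)
  moreover have "R powr - a \<le> d powr - a"
    using assms by (intro powr_mono2') auto
  ultimately show ?thesis by (simp flip: ennreal_plus)
qed

locale heis_kernel =
  fixes Q \<alpha> :: real and N :: "'n::finite itself"
  assumes Q_eq: "Q = 2 * real CARD('n) + 2" and \<alpha>_pos: "0 < \<alpha>" and \<alpha>_less: "\<alpha> < Q"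
begin

text \<open>\<open>\<sigma>\<close> is the conformally critical power. \<open>p\<close> is the
  exponent of the diagonal Hardy-Littlewood-Sobolev inequality, and
  \<open>\<sigma> * p = \<sigma> + 1\<close> turns the \<open>p\<close>-norm of
  \<open>u powr \<sigma>\<close> into the energy of \<open>u\<close>. \<open>\<gamma>\<close> is the
  power of the measure of a set that bounds the potential of its indicator.\<close>

definition \<sigma> :: real where "\<sigma> = (Q + \<alpha>) / (Q - \<alpha>)"
definition \<gamma> :: real where "\<gamma> = \<alpha> / Q"
definition p :: real where "p = 2 * Q / (Q + \<alpha>)"

lemma Q_pos: "Q > 0" using \<alpha>_pos \<alpha>_less by linarith

lemma Q_nat: "Q = real (hdim TYPE('n))" by (simp add: Q_eq)

lemma \<gamma>_pos: "0 < \<gamma>" and \<gamma>_less: "\<gamma> < 1"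
  using \<alpha>_pos \<alpha>_less by (auto simp: \<gamma>_def)

lemma p_gt_1: "1 < p" and \<sigma>_gt_1: "1 < \<sigma>"
  using \<alpha>_pos \<alpha>_less by (auto simp: p_def \<sigma>_def field_simps)

lemma exponent_rels: "p - 1 = 1 - p * \<gamma>" "p * (1 + \<gamma>) = 2" "\<sigma> * p = \<sigma> + 1"
  "(\<sigma> - 1) = \<gamma> * (\<sigma> + 1)" "(Q - \<alpha>) * \<sigma> = Q + \<alpha>" "(Q - \<alpha>) * (\<sigma> + 1) = 2 * Q"
proof -
  have nz: "Q \<noteq> 0" "Q + \<alpha> \<noteq> 0" "Q - \<alpha> \<noteq> 0" using \<alpha>_pos \<alpha>_less by auto
  have g: "1 + \<gamma> = (Q + \<alpha>) / Q" using nz by (simp add: \<gamma>_def field_simps)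
  show pg: "p * (1 + \<gamma>) = 2" unfolding g p_def using nz by simp
  then show "p - 1 = 1 - p * \<gamma>" by (simp add: algebra_simps)
  show s: "(Q - \<alpha>) * \<sigma> = Q + \<alpha>" using nz by (simp add: \<sigma>_def)
  then show "(Q - \<alpha>) * (\<sigma> + 1) = 2 * Q" by (simp add: algebra_simps)
  have s1: "\<sigma> + 1 = 2 * Q / (Q - \<alpha>)" "\<sigma> - 1 = 2 * \<alpha> / (Q - \<alpha>)"
    using nz by (auto simp: \<sigma>_def field_simps)
  show "\<sigma> * p = \<sigma> + 1" unfolding s1 using nz by (simp add: \<sigma>_def p_def)
  show "\<sigma> - 1 = \<gamma> * (\<sigma> + 1)" unfolding s1 \<gamma>_def using nz by simp
qed

definition kern :: "'n heis \<Rightarrow> 'n heis \<Rightarrow> ennreal"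
  where "kern \<xi> \<eta> = ennreal (hdist \<xi> \<eta> powr - (Q - \<alpha>))"

lemma borel_measurable_hdist [measurable (raw)]:
  fixes f :: "_ \<Rightarrow> 'n heis"
  assumes [measurable]: "f \<in> borel_measurable M" "g \<in> borel_measurable M"
  shows "(\<lambda>x. hdist (f x) (g x)) \<in> borel_measurable M"
proof -
  have *: "(\<lambda>x. hdist (fst x) (snd x :: 'n heis)) \<in> borel_measurable borel"
    by (intro borel_measurable_continuous_onI continuous_intros)
  have "(\<lambda>x. (f x, g x)) \<in> borel_measurable M" by measurable
  from measurable_compose[OF this *] show ?thesis by simp
qed

lemma borel_measurable_kern [measurable (raw)]:
  assumes [measurable]: "f \<in> borel_measurable M" "g \<in> borel_measurable M"
  shows "(\<lambda>x. kern (f x) (g x)) \<in> borel_measurable M"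
  unfolding kern_def by measurable

lemma kern_commute: "kern \<xi> \<eta> = kern \<eta> \<xi>"
  by (simp add: kern_def hdist_commute)

definition unit_vol :: real where "unit_vol = measure lborel {\<eta> :: 'n heis. heis_norm \<eta> < 1}"

lemma emeasure_hball: 
  assumes s: "s > 0"
  shows "emeasure lborel {\<eta> :: 'n heis. hdist \<xi> \<eta> < s} = ennreal (unit_vol * s powr Q)"
proof -
  let ?B = "{\<eta> :: 'n heis. heis_norm \<eta> < 1}"
  have fin: "emeasure lborel ?B < \<infinity>"
  proof -
    have "?B \<subseteq> ball 0 2"
    proof
      fix \<eta> :: "'n heis" assume "\<eta> \<in> ?B"
      then have "heis_norm \<eta> ^ 4 < 1 ^ 4" by (intro power_strict_mono) auto
      then have *: "norm (fst \<eta>) ^ 4 < 1" "(snd \<eta>)\<^sup>2 < 1"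
        unfolding heis_norm_power4 by (auto simp: add_nonneg_pos intro: le_less_trans[rotated])
      have "norm (fst \<eta>) < 1" using *(1) by (simp add: power_less_one_iff)
      moreover have "\<bar>snd \<eta>\<bar> < 1" using *(2) by (simp add: abs_square_less_1)
      ultimately show "\<eta> \<in> ball 0 2"
        using norm_Pair_le[of "fst \<eta>" "snd \<eta>"] by simp
    qed
    then have "emeasure lborel ?B \<le> emeasure lborel (ball (0 :: 'n heis) 2)"
      by (intro emeasure_mono) auto
    then show ?thesis using emeasure_lborel_ball_finite[of "0 :: 'n heis" 2]
      by (simp add: less_top top.extremum_strict order_le_less_trans)
  qed
  have "emeasure lborel {\<eta> :: 'n heis. hdist \<xi> \<eta> < s}
      = (\<integral>\<^sup>+\<eta>. indicator {\<eta>. hdist \<xi> \<eta> < s} \<eta> \<partial>lborel)"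
    by (subst nn_integral_indicator) auto
  also have "\<dots> = (\<integral>\<^sup>+\<eta>. indicator {..<s} (hdist \<xi> \<eta>) \<partial>lborel)"
    by (intro nn_integral_cong) (auto simp: indicator_def)
  also have "\<dots> = (\<integral>\<^sup>+\<eta>. indicator {..<s} (heis_norm (heis_mult (heis_inv \<xi>) \<eta>)) \<partial>lborel)"
    by (simp add: hdist_def)
  also have "\<dots> = (\<integral>\<^sup>+\<eta>. indicator {..<s} (heis_norm (\<eta> :: 'n heis)) \<partial>lborel)"
    by (rule nn_integral_heis_mult) measurable
  also have "\<dots> = ennreal (s ^ hdim TYPE('n)) *
      (\<integral>\<^sup>+\<eta>. indicator {..<s} (heis_norm (dil s \<eta> :: 'n heis)) \<partial>lborel)"
    by (rule nn_integral_dil) (use s in measurable)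
  also have "(\<integral>\<^sup>+\<eta>. indicator {..<s} (heis_norm (dil s \<eta> :: 'n heis)) \<partial>lborel)
    = (\<integral>\<^sup>+\<eta>. indicator ?B \<eta> \<partial>lborel)"
    using s by (intro nn_integral_cong) (auto simp: indicator_def)
  also have "\<dots> = ennreal unit_vol"
    using fin by (subst nn_integral_indicator) (auto simp: unit_vol_def emeasure_eq_ennreal_measure)
  also have "s ^ hdim TYPE('n) = s powr Q"
    by (simp only: Q_nat powr_realpow[OF s])
  finally show ?thesis
    by (simp add: mult.commute ennreal_mult'')
qed

lemma unit_vol_pos: "unit_vol > 0"
proof -
  have "open {\<eta> :: 'n heis. heis_norm \<eta> < 1}"
    by (intro open_Collect_less continuous_intros)
  moreover have "(0 :: 'n heis) \<in> {\<eta>. heis_norm \<eta> < 1}" by simp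
  ultimately obtain e where e: "e > 0" "ball (0 :: 'n heis) e \<subseteq> {\<eta>. heis_norm \<eta> < 1}"
    unfolding open_contains_ball by blast
  have "0 < emeasure lborel (ball (0 :: 'n heis) e)"
    using e(1) by (simp add: emeasure_ball)
  also have "\<dots> \<le> emeasure lborel {\<eta> :: 'n heis. heis_norm \<eta> < 1}"
    by (intro emeasure_mono e) auto
  finally have "emeasure lborel {\<eta> :: 'n heis. heis_norm \<eta> < 1} \<noteq> 0" by simp
  with emeasure_hball[of 1 0] show ?thesis
    by (auto simp: unit_vol_def measure_nonneg zero_less_measure_iff less_le)
qed

definition C0 :: real where "C0 = (Q - \<alpha>) * unit_vol / \<alpha> + 1"

lemma C0_pos: "C0 > 0"
  using \<alpha>_pos \<alpha>_less unit_vol_pos by (auto simp: C0_def add_pos_pos)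

text \<open>The worst set of given measure is comparable to a ball about \<open>\<xi>\<close>.
  Within distance \<open>R\<close> the kernel is written as a superposition of ball indicators and
  \<open>E\<close> is enlarged to whole balls, which gives the first summand of \<open>C0\<close>.
  Elsewhere the kernel is at most its value at \<open>R\<close>, which gives the second.\<close>

lemma nn_integral_kern_on_le:
  assumes [measurable]: "E \<in> sets borel" and E: "emeasure lborel E \<le> ennreal e" and e: "e > 0"
  shows "(\<integral>\<^sup>+\<eta>. kern \<xi> \<eta> * indicator E \<eta> \<partial>lborel) \<le> ennreal (C0 * e powr \<gamma>)"
proof -
  define a where "a = Q - \<alpha>"
  have a: "a > 0" using \<alpha>_less by (simp add: a_def)
  \<comment> \<open>The radius at which a ball has measure of order \<open>e\<close>; it balances
    the two contributions to the same power of \<open>e\<close>.\<close>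
  define R where "R = e powr (1 / Q)"
  have R: "R > 0" using e by (simp add: R_def)
  define w where "w s = ennreal (a * s powr (- a - 1)) * indicator {0<..<R} s" for s
  have [measurable]: "w \<in> borel_measurable borel" unfolding w_def by measurable
  have "kern \<xi> \<eta> * indicator E \<eta> \<le> (\<integral>\<^sup>+s. w s * indicator {hdist \<xi> \<eta><..} s \<partial>lborel)
      + ennreal (R powr - a) * indicator E \<eta>" if "\<xi> \<noteq> \<eta>" for \<eta>
  proof (cases "hdist \<xi> \<eta> < R")
    case True
    let ?d = "hdist \<xi> \<eta>"
    have "?d > 0" using that by simp
    have "kern \<xi> \<eta> = (\<integral>\<^sup>+s. ennreal (a * s powr (- a - 1)) * indicator {?d..R} s \<partial>lborel)
      + ennreal (R powr - a)"
      unfolding kern_def a_def[symmetric] by (rule powr_eq_integral) fact+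
    also have "(\<integral>\<^sup>+s. ennreal (a * s powr (- a - 1)) * indicator {?d..R} s \<partial>lborel)
        = (\<integral>\<^sup>+s. w s * indicator {?d<..} s \<partial>lborel)"
    proof (rule nn_integral_cong_AE)
      have "AE s in lborel. s \<noteq> ?d" "AE s in lborel. s \<noteq> R" by (rule AE_lborel_singleton)+
      then show "AE s in lborel. ennreal (a * s powr (- a - 1)) * indicator {?d..R} s
        = w s * indicator {?d<..} s"
        by eventually_elim (use \<open>?d > 0\<close> in \<open>auto simp: indicator_def w_def simp del:
          hdist_pos_iff\<close>)
    qed
    finally show ?thesis by (auto simp: indicator_def)
  next
    case False
    then have "hdist \<xi> \<eta> powr - a \<le> R powr - a"
      using R a by (intro powr_mono2') auto
    then show ?thesis by (auto simp: kern_def indicator_def a_def intro!: add_increasing)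
  qed
  then have "AE \<eta> in lborel. kern \<xi> \<eta> * indicator E \<eta>
    \<le> (\<integral>\<^sup>+s. w s * indicator {hdist \<xi> \<eta><..} s \<partial>lborel)
      + ennreal (R powr - a) * indicator E \<eta>"
    using AE_lborel_singleton[of \<xi>] by (auto elim!: eventually_mono)
  then have "(\<integral>\<^sup>+\<eta>. kern \<xi> \<eta> * indicator E \<eta> \<partial>lborel)
    \<le> (\<integral>\<^sup>+\<eta>. (\<integral>\<^sup>+s. w s * indicator {hdist \<xi> \<eta><..} s \<partial>lborel)
      + ennreal (R powr - a) * indicator E \<eta> \<partial>lborel)"
    by (rule nn_integral_mono_AE)
  also have "\<dots> = (\<integral>\<^sup>+\<eta>. \<integral>\<^sup>+s. w s * indicator {\<eta>. hdist \<xi> \<eta> < s} \<eta> \<partial>lborel \<partial>lborel)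
      + ennreal (R powr - a) * emeasure lborel E"
  proof -
    have "indicator {hdist \<xi> \<eta><..} s = (indicator {\<eta>. hdist \<xi> \<eta> < s} \<eta> :: ennreal)" for s \<eta>
      by (simp add: indicator_def)
    then show ?thesis by (simp add: nn_integral_add nn_integral_cmult)
  qed
  also have "(\<integral>\<^sup>+\<eta>. \<integral>\<^sup>+s. w s * indicator {\<eta>. hdist \<xi> \<eta> < s} \<eta> \<partial>lborel \<partial>lborel)
      = (\<integral>\<^sup>+s. \<integral>\<^sup>+\<eta>. w s * indicator {\<eta>. hdist \<xi> \<eta> < s} \<eta> \<partial>lborel \<partial>lborel)"
    by (rule lborel_pair.Fubini') measurable
  also have "\<dots> = (\<integral>\<^sup>+s. ennreal (a * unit_vol) * (ennreal (s powr (\<alpha> - 1))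
    * indicator {0<..<R} s) \<partial>lborel)"
  proof (rule nn_integral_cong)
    fix s :: real
    have "(\<integral>\<^sup>+\<eta>. w s * indicator {\<eta>. hdist \<xi> \<eta> < s} \<eta> \<partial>lborel)
      = w s * emeasure lborel {\<eta>. hdist \<xi> \<eta> < s}"
      by (subst nn_integral_cmult) auto
    also have "\<dots> = ennreal (a * unit_vol) * (ennreal (s powr (\<alpha> - 1)) * indicator {0<..<R} s)"
    proof (cases "0 < s \<and> s < R")
      case True
      have "s powr (- a - 1) * s powr Q = s powr (\<alpha> - 1)"
        using True by (simp add: a_def flip: powr_add)
      then have "a * s powr (- a - 1) * (unit_vol * s powr Q) = a * unit_vol * s powr (\<alpha> - 1)"
        by (simp add: ac_simps)
      with True a unit_vol_pos show ?thesis 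
        by (simp add: w_def emeasure_hball flip: ennreal_mult')
    qed (auto simp: w_def)
    finally show "(\<integral>\<^sup>+\<eta>. w s * indicator {\<eta>. hdist \<xi> \<eta> < s} \<eta> \<partial>lborel) = \<dots>" .
  qed
  also have "\<dots> = ennreal (a * unit_vol) * ennreal (R powr \<alpha> / \<alpha>)"
    using R \<alpha>_pos by (simp add: nn_integral_cmult nn_integral_powr_from_0)
  also have "R powr \<alpha> = e powr \<gamma>"
    by (simp add: R_def powr_powr \<gamma>_def)
  also have "ennreal (R powr - a) * emeasure lborel E \<le> ennreal (R powr - a * e)"
    using mult_left_mono[OF E, of "ennreal (R powr - a)"] e by (simp add: ennreal_mult')
  also have "R powr - a * e = e powr \<gamma>"
  proof -
    have "R powr - a * e = e powr (- a / Q) * e powr 1" using e by (simp add: R_def powr_powr)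
    also have "\<dots> = e powr (- a / Q + 1)" by (rule powr_add[symmetric])
    also have "- a / Q + 1 = \<gamma>" using Q_pos by (simp add: a_def \<gamma>_def field_simps)
    finally show ?thesis .
  qed
  also have "ennreal (a * unit_vol) * ennreal (e powr \<gamma> / \<alpha>) + ennreal (e powr \<gamma>)
    = ennreal (C0 * e powr \<gamma>)"
  proof -
    have "C0 * e powr \<gamma> = a * unit_vol * (e powr \<gamma> / \<alpha>) + e powr \<gamma>"
      using \<alpha>_pos by (simp add: C0_def a_def field_simps)
    moreover have "ennreal (a * unit_vol) * ennreal (e powr \<gamma> / \<alpha>)
      = ennreal (a * unit_vol * (e powr \<gamma> / \<alpha>))"
      using a unit_vol_pos \<alpha>_pos by (intro ennreal_mult[symmetric]) auto
    ultimately show ?thesis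
      using a unit_vol_pos \<alpha>_pos by (simp only:) (rule ennreal_plus[symmetric]; simp)
  qed
  finally show ?thesis by (simp add: add_left_mono)
qed

definition C1 :: real where "C1 = C0 / (p - 1)"

lemma C1_pos: "C1 > 0"
  using C0_pos p_gt_1 by (simp add: C1_def)

text \<open>Layer cake in the values of \<open>f\<close>: Chebyshev bounds the level sets, the
  previous estimate bounds their potentials, and \<open>a powr (- (p * \<gamma>))\<close> is
  integrable at \<open>0\<close> because \<open>p * \<gamma> < 1\<close>. Cutting at height
  \<open>b\<close> makes the integral finite and produces the exponent \<open>p - 1\<close>.\<close>

lemma nn_integral_kern_min_le:
  fixes f :: "'n heis \<Rightarrow> real"
  assumes [measurable]: "f \<in> borel_measurable borel" and f: "\<And>\<eta>. f \<eta> \<ge> 0"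
    and M: "(\<integral>\<^sup>+\<eta>. ennreal (f \<eta> powr p) \<partial>lborel) \<le> ennreal M" "M > 0" and b: "b \<ge> 0"
  shows "(\<integral>\<^sup>+\<eta>. kern \<xi> \<eta> * ennreal (min (f \<eta>) b) \<partial>lborel)
    \<le> ennreal (C1 * M powr \<gamma> * b powr (p - 1))"
proof -
  have level: "emeasure lborel {\<eta>. a < f \<eta>} \<le> ennreal (M * a powr - p)" if a: "a > 0" for a
  proof -
    have "emeasure lborel {\<eta>. a < f \<eta>} = (\<integral>\<^sup>+\<eta>. indicator {\<eta>. a < f \<eta>} \<eta> \<partial>lborel)"
      by (subst nn_integral_indicator) auto
    also have "\<dots> \<le> (\<integral>\<^sup>+\<eta>. ennreal (a powr - p) * ennreal (f \<eta> powr p) \<partial>lborel)"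
    proof (rule nn_integral_mono)
      fix \<eta>
      show "indicator {\<eta>. a < f \<eta>} \<eta> \<le> ennreal (a powr - p) * ennreal (f \<eta> powr p)"
      proof (cases "a < f \<eta>")
        case True
        then have "a powr p \<le> f \<eta> powr p" using a p_gt_1 by (intro powr_mono2) auto
        then have "1 \<le> a powr - p * f \<eta> powr p"
          using a by (simp add: powr_minus field_simps)
        then show ?thesis using True by (simp flip: ennreal_mult')
      qed auto
    qed
    also have "\<dots> \<le> ennreal (a powr - p) * ennreal M"
      by (subst nn_integral_cmult) (auto intro!: mult_left_mono M)
    finally show ?thesis using M by (simp add: mult.commute flip: ennreal_mult')
  qed
  have "(\<integral>\<^sup>+\<eta>. kern \<xi> \<eta> * ennreal (min (f \<eta>) b) \<partial>lborel)
      = (\<integral>\<^sup>+\<eta>. kern \<xi> \<eta> * (\<integral>\<^sup>+a. indicator {0<..<b} a * indicator {..<f \<eta>} a \<partial>lborel) \<partial>lborel)"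
  proof (rule nn_integral_cong)
    fix \<eta>
    have "(\<integral>\<^sup>+a. indicator {0<..<b} a * indicator {..<f \<eta>} a \<partial>lborel)
      = (\<integral>\<^sup>+a. indicator {0<..<min (f \<eta>) b} a \<partial>lborel)"
      by (intro nn_integral_cong) (auto simp: indicator_def)
    also have "\<dots> = ennreal (min (f \<eta>) b)"
      using b f[of \<eta>] by simp
    finally show "kern \<xi> \<eta> * ennreal (min (f \<eta>) b)
        = kern \<xi> \<eta> * (\<integral>\<^sup>+a. indicator {0<..<b} a * indicator {..<f \<eta>} a \<partial>lborel)" by simp
  qed
  also have "\<dots> = (\<integral>\<^sup>+\<eta>. \<integral>\<^sup>+a. indicator {0<..<b} a * (kern \<xi> \<eta>
    * indicator {\<eta>. a < f \<eta>} \<eta>) \<partial>lborel \<partial>lborel)"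
    by (subst nn_integral_cmult[symmetric]) (auto intro!: nn_integral_cong simp: indicator_def)
  also have "\<dots> = (\<integral>\<^sup>+a. \<integral>\<^sup>+\<eta>. indicator {0<..<b} a * (kern \<xi> \<eta>
    * indicator {\<eta>. a < f \<eta>} \<eta>) \<partial>lborel \<partial>lborel)"
    by (rule lborel_pair.Fubini') measurable
  also have "\<dots> = (\<integral>\<^sup>+a. indicator {0<..<b} a * (\<integral>\<^sup>+\<eta>. kern \<xi> \<eta>
    * indicator {\<eta>. a < f \<eta>} \<eta> \<partial>lborel) \<partial>lborel)"
    by (simp add: nn_integral_cmult)
  also have "\<dots> \<le> (\<integral>\<^sup>+a. ennreal (C0 * M powr \<gamma>) * (ennreal (a powr (- (p * \<gamma>)))
    * indicator {0<..<b} a) \<partial>lborel)"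
  proof (rule nn_integral_mono)
    fix a :: real
    show "indicator {0<..<b} a * (\<integral>\<^sup>+\<eta>. kern \<xi> \<eta> * indicator {\<eta>. a < f \<eta>} \<eta> \<partial>lborel)
      \<le> ennreal (C0 * M powr \<gamma>) * (ennreal (a powr (- (p * \<gamma>))) * indicator {0<..<b} a)"
    proof (cases "0 < a \<and> a < b")
      case True
      have "(\<integral>\<^sup>+\<eta>. kern \<xi> \<eta> * indicator {\<eta>. a < f \<eta>} \<eta> \<partial>lborel)
        \<le> ennreal (C0 * (M * a powr - p) powr \<gamma>)"
        using True M by (intro nn_integral_kern_on_le level) auto
      also have "(M * a powr - p) powr \<gamma> = M powr \<gamma> * a powr (- (p * \<gamma>))"
        using True M by (simp add: powr_mult powr_powr)
      finally show ?thesis using True C0_pos by (simp add: ac_simps flip: ennreal_mult')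
    qed auto
  qed
  also have "\<dots> = ennreal (C0 * M powr \<gamma>) * ennreal (b powr (p - 1) / (p - 1))"
  proof -
    have e: "- (p * \<gamma>) = p - 2" using exponent_rels(1) by simp
    show ?thesis unfolding e using p_gt_1 b by (simp add: nn_integral_cmult nn_integral_powr_from_0)
  qed
  also have "\<dots> = ennreal (C1 * M powr \<gamma> * b powr (p - 1))"
    using C0_pos p_gt_1 by (simp add: C1_def flip: ennreal_mult')
  finally show ?thesis .
qed

text \<open>Since \<open>f f' = max f f' * min f f'\<close>,
  it suffices to bound the potential of the truncation of \<open>f\<close> at its value at the base point.\<close>

lemma Hardy_Littlewood_Sobolev:
  fixes f :: "'n heis \<Rightarrow> real"
  assumes [measurable]: "f \<in> borel_measurable borel" and f: "\<And>\<eta>. f \<eta> \<ge> 0"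
    and M: "(\<integral>\<^sup>+\<eta>. ennreal (f \<eta> powr p) \<partial>lborel) \<le> ennreal M" "M > 0"
  shows "(\<integral>\<^sup>+\<xi>. ennreal (f \<xi>) * (\<integral>\<^sup>+\<eta>. kern \<xi> \<eta> * ennreal (f \<eta>) \<partial>lborel) \<partial>lborel)
    \<le> ennreal (2 * C1 * M powr (1 + \<gamma>))"
proof -
  let ?h = "\<lambda>\<xi> \<eta>. ennreal (f \<xi>) * (kern \<xi> \<eta> * ennreal (min (f \<eta>) (f \<xi>)))"
  have half: "(\<integral>\<^sup>+\<xi>. \<integral>\<^sup>+\<eta>. ?h \<xi> \<eta> \<partial>lborel \<partial>lborel) \<le> ennreal (C1 * M powr (1 + \<gamma>))"
  proof -
    have "(\<integral>\<^sup>+\<xi>. \<integral>\<^sup>+\<eta>. ?h \<xi> \<eta> \<partial>lborel \<partial>lborel)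
        = (\<integral>\<^sup>+\<xi>. ennreal (f \<xi>) * (\<integral>\<^sup>+\<eta>. kern \<xi> \<eta> * ennreal (min (f \<eta>) (f \<xi>)) \<partial>lborel) \<partial>lborel)"
      by (simp add: nn_integral_cmult)
    also have "\<dots> \<le> (\<integral>\<^sup>+\<xi>. ennreal (C1 * M powr \<gamma>) * ennreal (f \<xi> powr p) \<partial>lborel)"
    proof (rule nn_integral_mono)
      fix \<xi>
      have "ennreal (f \<xi>) * (\<integral>\<^sup>+\<eta>. kern \<xi> \<eta> * ennreal (min (f \<eta>) (f \<xi>)) \<partial>lborel)
          \<le> ennreal (f \<xi>) * ennreal (C1 * M powr \<gamma> * f \<xi> powr (p - 1))"
        by (intro mult_left_mono nn_integral_kern_min_le M f) auto
      also have "\<dots> = ennreal (C1 * M powr \<gamma>) * ennreal (f \<xi> powr p)"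
      proof -
        have "f \<xi> * f \<xi> powr (p - 1) = f \<xi> powr p"
          using f[of \<xi>] by (cases "f \<xi> = 0") (auto simp: powr_mult_base)
        then show ?thesis using f C1_pos by (simp add: ac_simps flip: ennreal_mult')
      qed
      finally show "ennreal (f \<xi>) * (\<integral>\<^sup>+\<eta>. kern \<xi> \<eta> * ennreal (min (f \<eta>) (f \<xi>)) \<partial>lborel) \<le> \<dots>" .
    qed
    also have "\<dots> \<le> ennreal (C1 * M powr \<gamma>) * ennreal M"
      by (subst nn_integral_cmult) (auto intro!: mult_left_mono M)
    also have "\<dots> = ennreal (C1 * M powr (1 + \<gamma>))"
      using C1_pos M by (simp add: powr_add ac_simps flip: ennreal_mult')
    finally show ?thesis .
  qed
  have "(\<integral>\<^sup>+\<xi>. ennreal (f \<xi>) * (\<integral>\<^sup>+\<eta>. kern \<xi> \<eta> * ennreal (f \<eta>) \<partial>lborel) \<partial>lborel)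
      = (\<integral>\<^sup>+\<xi>. \<integral>\<^sup>+\<eta>. ennreal (f \<xi>) * (kern \<xi> \<eta> * ennreal (f \<eta>)) \<partial>lborel \<partial>lborel)"
    by (simp add: nn_integral_cmult)
  also have "\<dots> \<le> (\<integral>\<^sup>+\<xi>. \<integral>\<^sup>+\<eta>. ?h \<xi> \<eta> + ?h \<eta> \<xi> \<partial>lborel \<partial>lborel)"
  proof (intro nn_integral_mono)
    fix \<xi> \<eta>
    show "ennreal (f \<xi>) * (kern \<xi> \<eta> * ennreal (f \<eta>)) \<le> ?h \<xi> \<eta> + ?h \<eta> \<xi>"
      by (cases "f \<xi> \<le> f \<eta>") (simp_all add: min_def kern_commute[of \<eta> \<xi>] ac_simps add_increasing
        add_increasing2)
  qed
  also have "\<dots> = (\<integral>\<^sup>+\<xi>. \<integral>\<^sup>+\<eta>. ?h \<xi> \<eta> \<partial>lborel \<partial>lborel) + (\<integral>\<^sup>+\<xi>. \<integral>\<^sup>+\<eta>. ?h \<eta> \<xi> \<partial>lborel \<partial>lborel)"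
    by (simp add: nn_integral_add)
  also have "(\<integral>\<^sup>+\<xi>. \<integral>\<^sup>+\<eta>. ?h \<eta> \<xi> \<partial>lborel \<partial>lborel) = (\<integral>\<^sup>+\<eta>. \<integral>\<^sup>+\<xi>. ?h \<eta> \<xi> \<partial>lborel \<partial>lborel)"
    by (rule lborel_pair.Fubini') measurable
  also have "(\<integral>\<^sup>+\<xi>. \<integral>\<^sup>+\<eta>. ?h \<xi> \<eta> \<partial>lborel \<partial>lborel) + \<dots>
    \<le> ennreal (C1 * M powr (1 + \<gamma>)) + ennreal (C1 * M powr (1 + \<gamma>))"
    by (intro add_mono half)
  also have "\<dots> = ennreal (2 * C1 * M powr (1 + \<gamma>))"
    using C1_pos by (simp flip: ennreal_plus)
  finally show ?thesis .
qed

end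

section \<open>The circle average of the kernel\<close>

text \<open>The rigidity principle behind every strictness argument below: ordered functions with
  the same finite integral agree almost everywhere.\<close>

lemma nn_integral_eq_imp_AE_eq:
  assumes [measurable]: "f \<in> borel_measurable M" "g \<in> borel_measurable M"
    and le: "AE x in M. f x \<le> g x" and eq: "(\<integral>\<^sup>+x. g x \<partial>M) = (\<integral>\<^sup>+x. f x \<partial>M)"
    and fin: "(\<integral>\<^sup>+x. f x \<partial>M) \<noteq> \<infinity>"
  shows "AE x in M. f x = g x"
proof -
  have "(\<integral>\<^sup>+x. g x - f x \<partial>M) = (\<integral>\<^sup>+x. g x \<partial>M) - (\<integral>\<^sup>+x. f x \<partial>M)"
    by (rule nn_integral_diff) (use le fin in auto)
  also have "\<dots> = 0" using eq fin by (simp add: less_top)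
  finally have "AE x in M. g x - f x = 0" by (subst (asm) nn_integral_0_iff_AE) auto
  moreover have "AE x in M. f x \<noteq> \<infinity>" using fin by (intro nn_integral_PInf_AE) auto
  ultimately show ?thesis
    using le by eventually_elim (auto simp: diff_eq_0_iff_ennreal)
qed

lemma nn_integral_periodic_shift:
  fixes g :: "real \<Rightarrow> ennreal"
  assumes [measurable]: "g \<in> borel_measurable borel" and per: "\<And>x. g (x + P) = g x"
    and \<tau>: "0 \<le> \<tau>" "\<tau> \<le> P"
  shows "(\<integral>\<^sup>+x. g (x + \<tau>) * indicator {0..P} x \<partial>lborel) = (\<integral>\<^sup>+x. g x * indicator {0..P} x \<partial>lborel)"
proof -
  have "(\<integral>\<^sup>+x. g (x + \<tau>) * indicator {0..P} x \<partial>lborel)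
      = (\<integral>\<^sup>+x. g (\<tau> + x) * indicator {\<tau>..P + \<tau>} (\<tau> + x) \<partial>lborel)"
    by (intro nn_integral_cong) (auto simp: indicator_def add.commute)
  also have "\<dots> = (\<integral>\<^sup>+x. g x * indicator {\<tau>..P + \<tau>} x \<partial>lborel)"
    by (rule nn_integral_lborel_translate) measurable
  also have "\<dots> = (\<integral>\<^sup>+x. g x * indicator {\<tau>..P} x + g x * indicator {P<..P + \<tau>} x \<partial>lborel)"
    using \<tau> by (intro nn_integral_cong) (auto simp: indicator_def)
  also have "\<dots> = (\<integral>\<^sup>+x. g x * indicator {\<tau>..P} x \<partial>lborel) + (\<integral>\<^sup>+x. g x * indicator {P<..P
    + \<tau>} x \<partial>lborel)"
    by (rule nn_integral_add) measurable
  also have "(\<integral>\<^sup>+x. g x * indicator {P<..P + \<tau>} x \<partial>lborel)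
      = (\<integral>\<^sup>+x. g (P + x) * indicator {P<..P + \<tau>} (P + x) \<partial>lborel)"
    by (rule nn_integral_lborel_translate[symmetric]) measurable
  also have "\<dots> = (\<integral>\<^sup>+x. g x * indicator {0<..\<tau>} x \<partial>lborel)"
    by (intro nn_integral_cong) (auto simp: indicator_def per add.commute[of P])
  also have "(\<integral>\<^sup>+x. g x * indicator {\<tau>..P} x \<partial>lborel) + \<dots>
      = (\<integral>\<^sup>+x. g x * indicator {\<tau>..P} x + g x * indicator {0<..\<tau>} x \<partial>lborel)"
    by (rule nn_integral_add[symmetric]) measurable
  also have "\<dots> = (\<integral>\<^sup>+x. g x * indicator {0..P} x \<partial>lborel)"
  proof (rule nn_integral_cong_AE)
    have "AE x in lborel. x \<noteq> (0::real)" "AE x in lborel. x \<noteq> \<tau>" by (rule AE_lborel_singleton)+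
    then show "AE x in lborel. g x * indicator {\<tau>..P} x + g x * indicator {0<..\<tau>} x
      = g x * indicator {0..P} x"
      by eventually_elim (use \<tau> in \<open>auto simp: indicator_def\<close>)
  qed
  finally show ?thesis .
qed

definition gauge_abs :: "'n::finite heis \<Rightarrow> 'n heis \<Rightarrow> real"
  where "gauge_abs \<xi> \<eta> = cmod (gauge_point \<xi> \<eta>)"

text \<open>The real part of \<open>(|z|^2 + i t) (|w|^2 + i s)\<close>. Dilating either point by
  \<open>k\<close> multiplies it by \<open>k^2\<close>, whatever the other point is, so it behaves
  well under an inversion of one point only.\<close>

definition hcross :: "'n::finite heis \<Rightarrow> 'n heis \<Rightarrow> real"
  where "hcross \<xi> \<eta> = (norm (fst \<xi>))\<^sup>2 * (norm (fst \<eta>))\<^sup>2 - snd \<xi> * snd \<eta>"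

lemma gauge_abs_power2: "(gauge_abs \<xi> \<eta>)\<^sup>2 = heis_norm \<xi> ^ 4 + heis_norm \<eta> ^ 4 + 2 * hcross \<xi> \<eta>"
  unfolding gauge_abs_def cmod_power2 gauge_point_def heis_norm_power4 hcross_def
  by (simp add: power2_eq_square power4_eq_xxxx algebra_simps)

lemma gauge_abs_eq_sqrt: "gauge_abs \<xi> \<eta> = sqrt (heis_norm \<xi> ^ 4 + heis_norm \<eta> ^ 4 + 2 * hcross \<xi> \<eta>)"
  by (metis gauge_abs_power2 real_sqrt_unique gauge_abs_def norm_ge_zero)

lemma hcross_commute: "hcross \<xi> \<eta> = hcross \<eta> \<xi>"
  by (simp add: hcross_def mult.commute)

definition herm_abs :: "'n::finite heis \<Rightarrow> 'n heis \<Rightarrow> real"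
  where "herm_abs \<xi> \<eta> = 2 * cmod (herm (fst \<xi>) (fst \<eta>))"

lemma herm_abs_commute: "herm_abs \<xi> \<eta> = herm_abs \<eta> \<xi>"
  unfolding herm_abs_def by (metis cnj_herm complex_mod_cnj)

lemma herm_abs_nonneg [simp]: "0 \<le> herm_abs \<xi> \<eta>"
  by (simp add: herm_abs_def)

lemma herm_abs_le: "herm_abs \<xi> \<eta> \<le> (norm (fst \<xi>))\<^sup>2 + (norm (fst \<eta>))\<^sup>2"
proof -
  have "herm_abs \<xi> \<eta> \<le> 2 * (norm (fst \<xi>) * norm (fst \<eta>))"
    using norm_herm_le[of "fst \<xi>" "fst \<eta>"] by (simp add: herm_abs_def)
  also have "\<dots> \<le> (norm (fst \<xi>))\<^sup>2 + (norm (fst \<eta>))\<^sup>2"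
    using sum_squares_bound[of "norm (fst \<xi>)" "norm (fst \<eta>)"] by simp
  finally show ?thesis .
qed

text \<open>The strict inequality keeps the averaged kernel away from its singularity, hence finite
  and strictly monotone. The excluded set \<open>snd \<xi> = snd \<eta>\<close> is null for each
  \<open>\<xi>\<close>.\<close>

lemma herm_abs_less_gauge_abs:
  assumes "snd \<xi> \<noteq> snd \<eta>"
  shows "herm_abs \<xi> \<eta> < gauge_abs \<xi> \<eta>"
proof -
  have "(herm_abs \<xi> \<eta>)\<^sup>2 \<le> ((norm (fst \<xi>))\<^sup>2 + (norm (fst \<eta>))\<^sup>2)\<^sup>2"
    by (intro power_mono herm_abs_le) auto
  also have "\<dots> < (gauge_abs \<xi> \<eta>)\<^sup>2"
    using assms unfolding gauge_abs_def cmod_power2 gauge_point_def by simp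
  finally show ?thesis by (rule power2_less_imp_less) (simp add: gauge_abs_def)
qed

context heis_kernel
begin

definition \<beta> :: real where "\<beta> = (Q - \<alpha>) / 2"

lemma \<beta>_pos: "\<beta> > 0" using \<alpha>_less by (simp add: \<beta>_def)

text \<open>This is \<open>|a - c e^(i \<theta>)|^(-\<beta>)\<close>, written through the squared
  modulus. With \<open>a = |A|\<close> and \<open>c = 2 |<z, w>|\<close> it is the kernel along a
  circle orbit, because the square of \<open>hdist\<close> is the modulus and
  \<open>Q - \<alpha> = 2 * \<beta>\<close>.\<close>

definition circle_kern :: "real \<Rightarrow> real \<Rightarrow> real \<Rightarrow> real"
  where "circle_kern a c \<theta> = ((a - c * cos \<theta>)\<^sup>2 + (c * sin \<theta>)\<^sup>2) powr (- \<beta> / 2)"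

definition circle_avg :: "real \<Rightarrow> real \<Rightarrow> ennreal"
  where "circle_avg a c = ennreal (1 / (2 * pi)) * (\<integral>\<^sup>+\<theta>. ennreal (circle_kern a c \<theta>)
    * indicator {0..2 * pi} \<theta> \<partial>lborel)"

lemma borel_measurable_circle_kern [measurable (raw)]:
  assumes [measurable]: "f \<in> borel_measurable M" "g \<in> borel_measurable M" "h \<in> borel_measurable M"
  shows "(\<lambda>x. circle_kern (f x) (g x) (h x)) \<in> borel_measurable M"
  unfolding circle_kern_def by measurable

lemma borel_measurable_circle_avg [measurable (raw)]:
  assumes [measurable]: "f \<in> borel_measurable M" "g \<in> borel_measurable M"
  shows "(\<lambda>x. circle_avg (f x) (g x)) \<in> borel_measurable M"
  unfolding circle_avg_def by measurable

lemma circle_avg_scale: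
  assumes "s > 0"
  shows "circle_avg (s * a) (s * c) = ennreal (s powr - \<beta>) * circle_avg a c"
proof -
  have "circle_kern (s * a) (s * c) \<theta> = s powr - \<beta> * circle_kern a c \<theta>" for \<theta>
  proof -
    have "(s * a - s * c * cos \<theta>)\<^sup>2 + (s * c * sin \<theta>)\<^sup>2 = s\<^sup>2 * ((a - c * cos \<theta>)\<^sup>2 + (c * sin \<theta>)\<^sup>2)"
      by (simp add: power2_eq_square algebra_simps)
    moreover have "(s\<^sup>2) powr (- \<beta> / 2) = s powr - \<beta>"
      using assms by (simp add: powr_powr flip: powr_numeral)
    ultimately show ?thesis by (simp add: circle_kern_def powr_mult)
  qed
  then have "(\<integral>\<^sup>+\<theta>. ennreal (circle_kern (s * a) (s * c) \<theta>) * indicator {0..2 * pi} \<theta> \<partial>lborel)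
      = (\<integral>\<^sup>+\<theta>. ennreal (s powr - \<beta>) * (ennreal (circle_kern a c \<theta>) * indicator {0..2
        * pi} \<theta>) \<partial>lborel)"
    by (simp add: ennreal_mult' mult.assoc)
  also have "\<dots> = ennreal (s powr - \<beta>) * (\<integral>\<^sup>+\<theta>. ennreal (circle_kern a c \<theta>) * indicator {0..2
    * pi} \<theta> \<partial>lborel)"
    by (rule nn_integral_cmult) measurable
  finally show ?thesis by (simp only: circle_avg_def mult.left_commute)
qed

lemma circle_kern_base_pos:
  assumes "0 < a" "0 \<le> c" "c \<le> a" "0 < \<theta>" "\<theta> < 2 * pi"
  shows "0 < (a - c * cos \<theta>)\<^sup>2 + (c * sin \<theta>)\<^sup>2"
proof -
  have "cos \<theta> \<noteq> 1"
  proof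
    assume "cos \<theta> = 1"
    then obtain k where k: "\<theta> = of_int k * 2 * pi" by (auto simp: cos_one_2pi_int)
    with assms have "0 < real_of_int k" "real_of_int k < 1" by (auto simp: zero_less_mult_iff)
    then show False by auto
  qed
  then have "cos \<theta> < 1" using cos_le_one[of \<theta>] by linarith
  then have "c * cos \<theta> < a"
  proof (cases "c = 0")
    case False
    with assms \<open>cos \<theta> < 1\<close> have "c * cos \<theta> < c * 1" by (intro mult_strict_left_mono) auto
    with assms show ?thesis by linarith
  qed (use assms in auto)
  then show ?thesis by (intro add_pos_nonneg) auto
qed

text \<open>Since \<open>c \<le> a\<close>, the real part of \<open>a - c e^(i \<theta>)\<close> is
  nonnegative and grows with \<open>a\<close>, while the imaginary part stays the same. The angles
  \<open>0\<close> and \<open>2 * pi\<close> are excluded because the modulus may vanish there, and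
  \<open>powr\<close> would then give \<open>0\<close> instead of infinity.\<close>

lemma circle_kern_antimono:
  assumes "0 < a" "0 \<le> c" "c \<le> a" "a \<le> a'" "0 < \<theta>" "\<theta> < 2 * pi"
  shows "circle_kern a' c \<theta> \<le> circle_kern a c \<theta>" and "a < a'
    \<Longrightarrow> circle_kern a' c \<theta> < circle_kern a c \<theta>"
proof -
  have cc: "0 \<le> a - c * cos \<theta>"
    using assms mult_left_mono[of "cos \<theta>" 1 c] by auto
  show "circle_kern a' c \<theta> \<le> circle_kern a c \<theta>"
    unfolding circle_kern_def using assms circle_kern_base_pos[OF assms(1-3,5,6)] \<beta>_pos cc
    by (intro powr_mono2' add_right_mono power_mono) auto
  show "circle_kern a' c \<theta> < circle_kern a c \<theta>" if "a < a'"
    unfolding circle_kern_def using assms that circle_kern_base_pos[OF assms(1-3,5,6)] \<beta>_pos cc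
    by (intro powr_less_mono2_neg add_strict_right_mono power_strict_mono) auto
qed

lemma AE_circle: "AE \<theta> in lborel. \<theta> \<noteq> 0 \<and> \<theta> \<noteq> 2 * pi"
proof -
  have "AE \<theta> in lborel. \<theta> \<noteq> (0::real)" "AE \<theta> in lborel. \<theta> \<noteq> 2 * pi" by (rule AE_lborel_singleton)+
  then show ?thesis by eventually_elim simp
qed

lemma circle_avg_antimono:
  assumes "0 < a" "0 \<le> c" "c \<le> a" "a \<le> a'"
  shows "circle_avg a' c \<le> circle_avg a c"
  unfolding circle_avg_def
proof (intro mult_left_mono nn_integral_mono_AE)
  show "AE \<theta> in lborel. ennreal (circle_kern a' c \<theta>) * indicator {0..2 * pi} \<theta>
      \<le> ennreal (circle_kern a c \<theta>) * indicator {0..2 * pi} \<theta>"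
    using AE_circle
    by eventually_elim (use circle_kern_antimono(1)[OF assms] in \<open>auto simp: indicator_def less_le
      ennreal_leI\<close>)
qed auto

lemma circle_avg_finite:
  assumes "0 \<le> c" "c < a"
  shows "circle_avg a c < \<infinity>"
proof -
  have "circle_kern a c \<theta> \<le> ((a - c)\<^sup>2) powr (- \<beta> / 2)" for \<theta>
  proof -
    have "a - c \<le> a - c * cos \<theta>" using assms mult_left_mono[of "cos \<theta>" 1 c] by auto
    then have "(a - c)\<^sup>2 \<le> (a - c * cos \<theta>)\<^sup>2"
      using assms by (intro power_mono) auto
    then have "(a - c)\<^sup>2 \<le> (a - c * cos \<theta>)\<^sup>2 + (c * sin \<theta>)\<^sup>2"
      using zero_le_power2[of "c * sin \<theta>"] by linarith
    then show ?thesis unfolding circle_kern_def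
      using assms \<beta>_pos by (intro powr_mono2') auto
  qed
  then have "(\<integral>\<^sup>+\<theta>. ennreal (circle_kern a c \<theta>) * indicator {0..2 * pi} \<theta> \<partial>lborel)
      \<le> (\<integral>\<^sup>+\<theta>. ennreal (((a - c)\<^sup>2) powr (- \<beta> / 2)) * indicator {0..2 * pi} \<theta> \<partial>lborel)"
    by (intro nn_integral_mono mult_right_mono ennreal_leI) auto
  also have "\<dots> < \<infinity>"
    by (subst nn_integral_cmult_indicator) (auto simp flip: ennreal_mult')
  finally show ?thesis by (auto simp: circle_avg_def ennreal_mult_less_top)
qed

lemma circle_avg_strict_antimono:
  assumes "0 \<le> c" "c < a" "a < a'"
  shows "circle_avg a' c < circle_avg a c"
proof (rule le_neq_trans)
  show "circle_avg a' c \<le> circle_avg a c" by (rule circle_avg_antimono) (use assms in auto)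
  show "circle_avg a' c \<noteq> circle_avg a c"
  proof
    assume eq: "circle_avg a' c = circle_avg a c"
    let ?f = "\<lambda>a \<theta>. ennreal (circle_kern a c \<theta>) * indicator {0..2 * pi} \<theta>"
    have "ennreal (1 / (2 * pi)) \<noteq> 0" "ennreal (1 / (2 * pi)) \<noteq> top" by auto
    with eq have "(\<integral>\<^sup>+\<theta>. ?f a \<theta> \<partial>lborel) = (\<integral>\<^sup>+\<theta>. ?f a' \<theta> \<partial>lborel)"
      unfolding circle_avg_def by (auto simp: ennreal_mult_cancel_left)
    moreover have "(\<integral>\<^sup>+\<theta>. ?f a' \<theta> \<partial>lborel) \<noteq> \<infinity>"
      using circle_avg_finite[of c a'] assms by (auto simp: circle_avg_def ennreal_mult_eq_top_iff)
    moreover have "AE \<theta> in lborel. ?f a' \<theta> \<le> ?f a \<theta>"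
      using AE_circle by eventually_elim 
        (use circle_kern_antimono(1)[of a c a'] assms in \<open>auto simp: indicator_def less_le
          ennreal_leI\<close>)
    ultimately have "AE \<theta> in lborel. ?f a' \<theta> = ?f a \<theta>"
      by (intro nn_integral_eq_imp_AE_eq) auto
    with AE_circle have "AE \<theta> in lborel. \<theta> \<notin> {0..2 * pi}"
    proof eventually_elim
      case (elim \<theta>)
      show ?case
      proof
        assume "\<theta> \<in> {0..2 * pi}"
        with elim have "0 < \<theta>" "\<theta> < 2 * pi" by auto
        then have "circle_kern a' c \<theta> < circle_kern a c \<theta>" using assms
          by (intro circle_kern_antimono(2)) auto
        moreover have "0 \<le> circle_kern a' c \<theta>" by (simp add: circle_kern_def)
        ultimately show False using elim \<open>\<theta> \<in> _\<close> by auto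
      qed
    qed
    then have "emeasure lborel {0..2 * pi} = 0"
      by (subst (asm) AE_iff_measurable[of "{0..2*pi}"]) auto
    then show False by simp
  qed
qed

section \<open>The averaged kernel and its behaviour under inversion\<close>

definition kern_avg :: "'n heis \<Rightarrow> 'n heis \<Rightarrow> ennreal"
  where "kern_avg \<xi> \<eta> = circle_avg (gauge_abs \<xi> \<eta>) (herm_abs \<xi> \<eta>)"

text \<open>The averaged kernel with one point inverted and the Kelvin weight of that point
  included, as \<open>kern_avg_hinv_left\<close> shows. The closed form makes it visible that it
  does not matter which of the two points is inverted.\<close>

definition kern_avg_refl :: "real \<Rightarrow> 'n heis \<Rightarrow> 'n heis \<Rightarrow> ennreal"
  where "kern_avg_refl l \<xi> \<eta> = circle_avg (sqrt (l ^ 4 + heis_norm \<xi> ^ 4 * heis_norm \<eta> ^ 4 / l ^ 4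
    + 2 * hcross \<xi> \<eta>)) (herm_abs \<xi> \<eta>)"

lemma borel_measurable_herm_abs [measurable (raw)]:
  fixes f :: "_ \<Rightarrow> 'n heis"
  assumes [measurable]: "f \<in> borel_measurable M" "g \<in> borel_measurable M"
  shows "(\<lambda>x. herm_abs (f x) (g x)) \<in> borel_measurable M"
    and "(\<lambda>x. hcross (f x) (g x)) \<in> borel_measurable M"
proof -
  have *: "(\<lambda>x. herm_abs (fst x) (snd x :: 'n heis)) \<in> borel_measurable borel"
    "(\<lambda>x. hcross (fst x) (snd x :: 'n heis)) \<in> borel_measurable borel"
    unfolding herm_abs_def hcross_def by (intro borel_measurable_continuous_onI continuous_intros)+
  have **: "(\<lambda>x. (f x, g x)) \<in> borel_measurable M" by measurable
  from measurable_compose[OF ** *(1)] measurable_compose[OF ** *(2)]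
  show "(\<lambda>x. herm_abs (f x) (g x)) \<in> borel_measurable M"
    and "(\<lambda>x. hcross (f x) (g x)) \<in> borel_measurable M" by simp_all
qed

lemma borel_measurable_kern_avg [measurable (raw)]:
  assumes [measurable]: "f \<in> borel_measurable M" "g \<in> borel_measurable M"
  shows "(\<lambda>x. kern_avg (f x) (g x)) \<in> borel_measurable M"
    and "(\<lambda>x. kern_avg_refl l (f x) (g x)) \<in> borel_measurable M"
  unfolding kern_avg_def kern_avg_refl_def gauge_abs_eq_sqrt by measurable

lemma kern_avg_commute: "kern_avg \<xi> \<eta> = kern_avg \<eta> \<xi>"
  by (simp add: kern_avg_def gauge_abs_eq_sqrt hcross_commute[of \<xi>] herm_abs_commute[of \<xi>]
    add.commute)

lemma kern_avg_refl_commute: "kern_avg_refl l \<xi> \<eta> = kern_avg_refl l \<eta> \<xi>"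
  by (simp add: kern_avg_refl_def hcross_commute[of \<xi>] herm_abs_commute[of \<xi>] mult.commute)

text \<open>A rotation of \<open>\<eta>\<close> leaves \<open>gauge_point\<close> alone and
  multiplies the Hermitian product by a phase. Once the argument of \<open>A\<close> is divided out,
  only the two moduli and one relative angle remain.\<close>

lemma kern_rot:
  obtains \<tau> where "0 \<le> \<tau>" "\<tau> \<le> 2 * pi"
    "\<And>\<theta>. kern \<xi> (rot \<theta> \<eta>) = ennreal (circle_kern (gauge_abs \<xi> \<eta>) (herm_abs \<xi> \<eta>) (\<theta> + \<tau>))"
proof -
  define A where "A = gauge_point \<xi> \<eta>"
  define h where "h = herm (fst \<xi>) (fst \<eta>)"
  define w where "w = cis (Arg h - Arg A)"
  have key: "cis (Arg A) * w = cis (Arg h)" by (simp add: w_def cis_mult)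
  define \<tau> where "\<tau> = Arg2pi w"
  have "cmod w = 1" by (simp add: w_def)
  then have w: "w = cis \<tau>" using Arg2pi_eq[of w] by (simp add: \<tau>_def cis_conv_exp)
  have 1: "kern \<xi> (rot \<theta> \<eta>) = ennreal (circle_kern (gauge_abs \<xi> \<eta>) (herm_abs \<xi> \<eta>) (\<theta>
    + (2 * pi - \<tau>)))" for \<theta>
  proof -
    have "gauge_point \<xi> (rot \<theta> \<eta>) = A" by (simp add: A_def gauge_point_def rot_def
      norm_vector_scalar_mult)
    then have "(hdist \<xi> (rot \<theta> \<eta>))\<^sup>2 = cmod (A - 2 * (cis (- \<theta>) * h))"
      unfolding hdist_power2 by (simp add: rot_def h_def cis_cnj)
    also have "A = rcis (cmod A) (Arg A)" by (simp add: rcis_cmod_Arg)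
    also have "h = rcis (cmod h) (Arg h)" by (simp add: rcis_cmod_Arg)
    also have "cmod (rcis (cmod A) (Arg A) - 2 * (cis (- \<theta>) * rcis (cmod h) (Arg h)))
        = cmod (cis (Arg A) * (of_real (cmod A) - of_real (2 * cmod h) * (cis (- \<theta>) * w)))"
      unfolding rcis_def key[symmetric] by (simp add: algebra_simps del: cis_mult)
    also have "\<dots> = cmod (of_real (cmod A) - of_real (2 * cmod h) * cis (\<tau> - \<theta>))"
      by (simp add: norm_mult w cis_mult)
    finally have "((hdist \<xi> (rot \<theta> \<eta>))\<^sup>2)\<^sup>2
        = (cmod A - 2 * cmod h * cos (\<tau> - \<theta>))\<^sup>2 + (2 * cmod h * sin (\<tau> - \<theta>))\<^sup>2"
      by (simp add: cmod_power2)
    also have "cos (\<tau> - \<theta>) = cos (\<theta> + (2 * pi - \<tau>))"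
      using cos_periodic[of "\<theta> - \<tau>"] cos_minus[of "\<tau> - \<theta>"] by (simp add: algebra_simps)
    also have "sin (\<tau> - \<theta>) = - sin (\<theta> + (2 * pi - \<tau>))"
      using sin_periodic[of "\<theta> - \<tau>"] sin_minus[of "\<theta> - \<tau>"] by (simp add: algebra_simps)
    finally have 2: "((hdist \<xi> (rot \<theta> \<eta>))\<^sup>2)\<^sup>2 =
      (cmod A - 2 * cmod h * cos (\<theta> + (2 * pi - \<tau>)))\<^sup>2 + (2 * cmod h * sin (\<theta> + (2 * pi - \<tau>)))\<^sup>2"
      by simp
    have "hdist \<xi> (rot \<theta> \<eta>) powr - (Q - \<alpha>) = (((hdist \<xi> (rot \<theta> \<eta>))\<^sup>2)\<^sup>2) powr (- \<beta> / 2)"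
    proof (cases "hdist \<xi> (rot \<theta> \<eta>) = 0")
      case False
      define d where "d = hdist \<xi> (rot \<theta> \<eta>)"
      from False have "d > 0" using hdist_nonneg[of \<xi> "rot \<theta> \<eta>"] unfolding d_def by linarith
      then have "((d\<^sup>2)\<^sup>2) powr (- \<beta> / 2) = ((d powr 2) powr 2) powr (- \<beta> / 2)" by simp
      also have "\<dots> = d powr (2 * 2 * (- \<beta> / 2))" by (simp only: powr_powr)
      also have "2 * 2 * (- \<beta> / 2) = - (Q - \<alpha>)" by (simp add: \<beta>_def field_simps)
      finally show ?thesis unfolding d_def ..
    qed simp
    then show ?thesis unfolding 2 by (simp add: kern_def circle_kern_def gauge_abs_def
      herm_abs_def A_def h_def)
  qed
  \<comment> \<open>The shift is \<open>2 * pi - \<tau>\<close> and not \<open>- \<tau>\<close> so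
    that it lies within one period, as the shift lemma for periodic functions demands.\<close>
  have 2: "0 \<le> 2 * pi - \<tau>" "2 * pi - \<tau> \<le> 2 * pi"
    using Arg2pi_ge_0[of w] Arg2pi_lt_2pi[of w] by (auto simp: \<tau>_def)
  show thesis by (rule that[OF 2 1])
qed

lemma kern_circle_average:
  "ennreal (1 / (2 * pi)) * (\<integral>\<^sup>+\<theta>. kern \<xi> (rot \<theta> \<eta>) * indicator {0..2 * pi} \<theta> \<partial>lborel)
    = kern_avg \<xi> \<eta>"
proof -
  obtain \<tau> where \<tau>: "0 \<le> \<tau>" "\<tau> \<le> 2 * pi"
    "\<And>\<theta>. kern \<xi> (rot \<theta> \<eta>) = ennreal (circle_kern (gauge_abs \<xi> \<eta>) (herm_abs \<xi> \<eta>) (\<theta> + \<tau>))"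
    by (rule kern_rot) blast
  have "(\<integral>\<^sup>+\<theta>. kern \<xi> (rot \<theta> \<eta>) * indicator {0..2 * pi} \<theta> \<partial>lborel)
      = (\<integral>\<^sup>+\<theta>. ennreal (circle_kern (gauge_abs \<xi> \<eta>) (herm_abs \<xi> \<eta>) \<theta>) * indicator {0..2
        * pi} \<theta> \<partial>lborel)"
    unfolding \<tau>(3) by (rule nn_integral_periodic_shift[OF _ _ \<tau>(1,2)]) (auto simp: circle_kern_def)
  then show ?thesis by (simp add: kern_avg_def circle_avg_def)
qed

text \<open>Both \<open>f\<close> and Lebesgue measure are invariant under \<open>rot\<close>, so
  the integral does not depend on the angle by which the second argument of the kernel is rotated;
  averaging over that angle and exchanging integrals moves the average onto the kernel.\<close>

lemma nn_integral_kern_eq_kern_avg: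
  assumes [measurable]: "f \<in> borel_measurable borel" and inv: "\<And>\<theta> \<eta>. f (rot \<theta> \<eta>) = f \<eta>"
  shows "(\<integral>\<^sup>+\<eta>. kern \<xi> \<eta> * f \<eta> \<partial>lborel) = (\<integral>\<^sup>+\<eta>. kern_avg \<xi> \<eta> * f \<eta> \<partial>lborel)"
proof -
  let ?I = "\<integral>\<^sup>+\<eta>. kern \<xi> \<eta> * f \<eta> \<partial>lborel"
  let ?c = "ennreal (1 / (2 * pi))"
  have rot2: "(\<lambda>x. rot (f x) (g x :: 'n heis)) \<in> borel_measurable M"
    if [measurable]: "f \<in> borel_measurable M" "g \<in> borel_measurable M" for f g and M :: "'b measure"
  proof -
    have *: "(\<lambda>x. rot (fst x) (snd x :: 'n heis)) \<in> borel_measurable borel"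
      by (intro borel_measurable_continuous_onI continuous_intros)
    have "(\<lambda>x. (f x, g x)) \<in> borel_measurable M" by measurable
    from measurable_compose[OF this *] show ?thesis by simp
  qed
  note [measurable (raw)] = rot2
  have "?I = ?c * (\<integral>\<^sup>+\<theta>. ?I * indicator {0..2 * pi} \<theta> \<partial>lborel)"
  proof -
    have "(\<integral>\<^sup>+\<theta>. ?I * indicator {0..2 * pi} \<theta> \<partial>lborel) = ennreal (2 * pi) * ?I"
      by (subst nn_integral_cmult_indicator) (simp_all add: mult.commute)
    moreover have "?c * ennreal (2 * pi) = 1" by (simp flip: ennreal_mult')
    ultimately show ?thesis by (simp flip: mult.assoc)
  qed
  also have "(\<integral>\<^sup>+\<theta>. ?I * indicator {0..2 * pi} \<theta> \<partial>lborel)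
      = (\<integral>\<^sup>+\<theta>. \<integral>\<^sup>+\<eta>. kern \<xi> (rot \<theta> \<eta>) * f \<eta> * indicator {0..2 * pi} \<theta> \<partial>lborel \<partial>lborel)"
  proof (rule nn_integral_cong)
    fix \<theta>
    have "?I = (\<integral>\<^sup>+\<eta>. kern \<xi> (rot \<theta> \<eta>) * f (rot \<theta> \<eta>) \<partial>lborel)"
      by (rule nn_integral_rot[symmetric]) measurable
    then show "?I * indicator {0..2 * pi} \<theta> = (\<integral>\<^sup>+\<eta>. kern \<xi> (rot \<theta> \<eta>) * f \<eta> * indicator {0..2
      * pi} \<theta> \<partial>lborel)"
      by (simp add: nn_integral_multc inv)
  qed
  also have "\<dots> = (\<integral>\<^sup>+\<eta>. \<integral>\<^sup>+\<theta>. kern \<xi> (rot \<theta> \<eta>) * f \<eta> * indicator {0..2 * pi} \<theta> \<partial>lborel \<partial>lborel)"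
    by (rule lborel_pair.Fubini') measurable
  also have "?c * \<dots> = (\<integral>\<^sup>+\<eta>. ?c * (\<integral>\<^sup>+\<theta>. kern \<xi> (rot \<theta> \<eta>) * f \<eta> * indicator {0..2
    * pi} \<theta> \<partial>lborel) \<partial>lborel)"
    by (rule nn_integral_cmult[symmetric]) measurable
  also have "\<dots> = (\<integral>\<^sup>+\<eta>. kern_avg \<xi> \<eta> * f \<eta> \<partial>lborel)"
  proof (rule nn_integral_cong)
    fix \<eta>
    have "(\<integral>\<^sup>+\<theta>. kern \<xi> (rot \<theta> \<eta>) * f \<eta> * indicator {0..2 * pi} \<theta> \<partial>lborel)
        = (\<integral>\<^sup>+\<theta>. f \<eta> * (kern \<xi> (rot \<theta> \<eta>) * indicator {0..2 * pi} \<theta>) \<partial>lborel)"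
      by (simp add: ac_simps)
    also have "\<dots> = f \<eta> * (\<integral>\<^sup>+\<theta>. kern \<xi> (rot \<theta> \<eta>) * indicator {0..2 * pi} \<theta> \<partial>lborel)"
      by (rule nn_integral_cmult) measurable
    finally show "?c * (\<integral>\<^sup>+\<theta>. kern \<xi> (rot \<theta> \<eta>) * f \<eta> * indicator {0..2 * pi} \<theta> \<partial>lborel)
      = kern_avg \<xi> \<eta> * f \<eta>"
      by (simp add: kern_circle_average[symmetric] ac_simps)
  qed
  finally show ?thesis .
qed

text \<open>Undoing the dilation by \<open>l^2 / |\<xi>|^2\<close> multiplies both arguments of
  \<open>circle_avg\<close> by the common factor \<open>s = (|\<xi>| / l)^2\<close>. Homogeneity of
  degree \<open>- \<beta>\<close> turns this factor into the Kelvin weight.\<close>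

lemma kern_avg_hinv_left:
  assumes l: "l > 0" and "\<xi> \<noteq> 0"
  shows "ennreal ((l / heis_norm \<xi>) powr (Q - \<alpha>)) * kern_avg (hinv l \<xi>) \<eta> = kern_avg_refl l \<xi> \<eta>"
proof -
  define r where "r = heis_norm \<xi>"
  have r: "r > 0" using assms by (simp add: r_def)
  define s where "s = (r / l)\<^sup>2"
  have s: "s > 0" using r l by (simp add: s_def)
  have hc: "hcross (hinv l \<xi>) \<eta> = (l ^ 4 / r ^ 4) * hcross \<xi> \<eta>"
    using l r by (simp add: hcross_def hinv_def dil_def r_def[symmetric] field_simps)
  have "s\<^sup>2 * (heis_norm (hinv l \<xi>) ^ 4 + heis_norm \<eta> ^ 4 + 2 * hcross (hinv l \<xi>) \<eta>)
      = l ^ 4 + r ^ 4 * heis_norm \<eta> ^ 4 / l ^ 4 + 2 * hcross \<xi> \<eta>"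
    unfolding hc heis_norm_hinv r_def[symmetric] s_def
    using l r by (simp add: field_simps power2_eq_square power4_eq_xxxx)
  then have 1: "sqrt (l ^ 4 + heis_norm \<xi> ^ 4 * heis_norm \<eta> ^ 4 / l ^ 4 + 2 * hcross \<xi> \<eta>)
    = s * gauge_abs (hinv l \<xi>) \<eta>"
    unfolding gauge_abs_eq_sqrt r_def[symmetric] using s
      by (metis real_sqrt_mult real_sqrt_abs abs_of_pos)
  have 2: "herm_abs \<xi> \<eta> = s * herm_abs (hinv l \<xi>) \<eta>"
    using l r by (simp add: herm_abs_def hinv_def dil_def s_def r_def[symmetric] power_divide)
  have "s powr - \<beta> = (l / r) powr (Q - \<alpha>)"
  proof -
    have "s powr - \<beta> = ((r / l) powr 2) powr - \<beta>"
      using l r by (simp add: s_def)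
    also have "\<dots> = (r / l) powr (2 * - \<beta>)" by (rule powr_powr)
    also have "2 * - \<beta> = - (Q - \<alpha>)" by (simp add: \<beta>_def field_simps)
    finally have "s powr - \<beta> = (r / l) powr (- (Q - \<alpha>))" .
    also have "\<dots> = (l / r) powr (Q - \<alpha>)"
      unfolding powr_minus using l r by (simp add: powr_divide)
    finally show ?thesis .
  qed
  then show ?thesis unfolding kern_avg_refl_def kern_avg_def 1 2 circle_avg_scale[OF s]
    by (simp add: r_def)
qed

text \<open>The one-sided formula is applied twice, with the symmetry of
  \<open>kern_avg_refl\<close> in between: inverting the second point as well undoes the reflection
  and leaves its reciprocal weight.\<close>

lemma kern_avg_hinv_both:
  assumes l: "l > 0" and "\<xi> \<noteq> 0" "\<eta> \<noteq> 0"
  shows "ennreal ((l / heis_norm \<xi>) powr (Q - \<alpha>)) *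
    (ennreal ((l / heis_norm \<eta>) powr (Q - \<alpha>)) * kern_avg (hinv l \<xi>) (hinv l \<eta>)) = kern_avg \<xi> \<eta>"
proof -
  have nz: "hinv l \<eta> \<noteq> 0" using assms by (simp add: hinv_def)
  have "ennreal ((l / heis_norm \<xi>) powr (Q - \<alpha>)) * kern_avg (hinv l \<xi>) (hinv l \<eta>)
    = kern_avg_refl l \<xi> (hinv l \<eta>)"
    by (rule kern_avg_hinv_left) fact+
  also have "\<dots> = ennreal ((l / heis_norm (hinv l \<eta>)) powr (Q - \<alpha>)) * kern_avg \<eta> \<xi>"
    using kern_avg_hinv_left[OF l nz, of \<xi>] hinv_hinv[OF l assms(3)]
      by (simp add: kern_avg_refl_commute[of l \<xi>])
  finally have "ennreal ((l / heis_norm \<eta>) powr (Q - \<alpha>)) *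
      (ennreal ((l / heis_norm \<xi>) powr (Q - \<alpha>)) * kern_avg (hinv l \<xi>) (hinv l \<eta>))
      = ennreal ((l / heis_norm \<eta>) powr (Q - \<alpha>) * (heis_norm \<eta> / l) powr (Q - \<alpha>)) * kern_avg \<xi> \<eta>"
    using assms by (simp add: heis_norm_hinv kern_avg_commute[of \<eta>] ennreal_mult' mult.assoc
      power2_eq_square)
  also have "(l / heis_norm \<eta>) powr (Q - \<alpha>) * (heis_norm \<eta> / l) powr (Q - \<alpha>) = 1"
    using assms by (simp flip: powr_mult)
  finally show ?thesis by (simp add: ac_simps)
qed

lemma kern_avg_refl_less:
  assumes l: "l > 0" and "l < heis_norm \<xi>" "l < heis_norm \<eta>" "snd \<xi> \<noteq> snd \<eta>"
  shows "kern_avg_refl l \<xi> \<eta> < kern_avg \<xi> \<eta>" and "kern_avg \<xi> \<eta> < \<infinity>"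
proof -
  note hl = herm_abs_less_gauge_abs[OF assms(4)]
  show "kern_avg \<xi> \<eta> < \<infinity>" unfolding kern_avg_def using hl by (intro circle_avg_finite) auto
  have "0 < (heis_norm \<xi> ^ 4 - l ^ 4) * (heis_norm \<eta> ^ 4 - l ^ 4) / l ^ 4"
    using assms by (intro divide_pos_pos mult_pos_pos) (auto intro!: power_strict_mono)
  also have "\<dots> = l ^ 4 + heis_norm \<xi> ^ 4 * heis_norm \<eta> ^ 4 / l ^ 4 - (heis_norm \<xi> ^ 4
    + heis_norm \<eta> ^ 4)"
    using l by (simp add: field_simps)
  finally have "gauge_abs \<xi> \<eta> < sqrt (l ^ 4 + heis_norm \<xi> ^ 4 * heis_norm \<eta> ^ 4 / l ^ 4
    + 2 * hcross \<xi> \<eta>)"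
    unfolding gauge_abs_eq_sqrt by (intro real_sqrt_less_mono) simp
  then show "kern_avg_refl l \<xi> \<eta> < kern_avg \<xi> \<eta>"
    unfolding kern_avg_refl_def kern_avg_def using hl by (intro circle_avg_strict_antimono) auto
qed

end

section \<open>Solutions and their Kelvin transforms\<close>

text \<open>Convexity of \<open>powr s\<close>. The upper bound linearises the comparison of
  \<open>u\<close> with its Kelvin transform, the lower bound makes the difference of two ordered
  solutions a supersolution of the linearised equation. The mean value theorem is applied for
  \<open>x > 0\<close>, and \<open>x = 0\<close> is treated by hand.\<close>

lemma powr_diff_le:
  fixes x y s :: real
  assumes "0 \<le> x" "x \<le> y" "1 < s"
  shows "y powr s - x powr s \<le> s * y powr (s - 1) * (y - x)"
    and "s * x powr (s - 1) * (y - x) \<le> y powr s - x powr s"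
proof -
  have *: "\<exists>z. x \<le> z \<and> z \<le> y \<and> y powr s - x powr s = (y - x) * (s * z powr (s - 1))"
    if "0 < x" "x < y"
  proof -
    have "\<exists>z. x < z \<and> z < y \<and> y powr s - x powr s = (y - x) * (s * z powr (s - 1))"
      using that by (intro MVT2) (auto intro!: derivative_eq_intros)
    then show ?thesis by (metis less_imp_le)
  qed
  show "y powr s - x powr s \<le> s * y powr (s - 1) * (y - x)"
  proof (cases "0 < x \<and> x < y")
    case True
    then obtain z where z: "x \<le> z" "z \<le> y" "y powr s - x powr s = (y - x) * (s * z powr (s - 1))"
      using * by blast
    then have "z powr (s - 1) \<le> y powr (s - 1)" using True assms by (intro powr_mono2) auto
    then show ?thesis unfolding z(3) using True assms by (simp add: mult_left_mono mult.commute)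
  next
    case False
    then consider "x = y" | "x = 0" using assms by linarith
    then show ?thesis
    proof cases
      case 2
      have "y powr s = y powr (s - 1) * y" using assms 2 
        by (cases "y = 0") (auto simp: powr_diff)
      then have "y powr s \<le> s * (y powr (s - 1) * y)" using assms 2
        by (metis mult_le_cancel_right1 less_imp_le not_less powr_ge_zero)
      then show ?thesis using 2 by simp
    qed auto
  qed
  show "s * x powr (s - 1) * (y - x) \<le> y powr s - x powr s"
  proof (cases "0 < x \<and> x < y")
    case True
    then obtain z where z: "x \<le> z" "z \<le> y" "y powr s - x powr s = (y - x) * (s * z powr (s - 1))"
      using * by blast
    then have "x powr (s - 1) \<le> z powr (s - 1)" using True assms by (intro powr_mono2) auto
    then show ?thesis unfolding z(3) using True assms by (simp add: mult_left_mono mult.commute)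
  next
    case False
    then consider "x = y" | "x = 0" using assms by linarith
    then show ?thesis by cases (use assms in auto)
  qed
qed

lemma AE_snd_notin:
  fixes F :: "complex ^ 'n::finite \<Rightarrow> real set"
  assumes fin: "\<And>z. finite (F z)" and [measurable]: "{\<xi> :: 'n heis. snd \<xi> \<in> F (fst \<xi>)} \<in> sets borel"
  shows "AE \<xi> in lborel. snd \<xi> \<notin> F (fst \<xi>)"
proof -
  let ?S = "{\<xi> :: 'n heis. snd \<xi> \<in> F (fst \<xi>)}"
  have "emeasure lborel ?S = (\<integral>\<^sup>+z. \<integral>\<^sup>+t. indicator ?S (z, t) \<partial>lborel \<partial>lborel)"
    by (subst nn_integral_heis[symmetric]) auto
  also have "\<dots> = (\<integral>\<^sup>+(z :: complex ^ 'n). 0 \<partial>lborel)"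
  proof (rule nn_integral_cong)
    fix z
    have "(\<integral>\<^sup>+t. indicator ?S (z, t) \<partial>lborel) = (\<integral>\<^sup>+t. indicator (F z) t \<partial>lborel)"
      by (intro nn_integral_cong) (auto simp: indicator_def)
    also have "\<dots> = emeasure lborel (F z)"
      using fin by (intro nn_integral_indicator) (auto intro!: borel_closed finite_imp_closed)
    also have "\<dots> = 0" using fin by (intro emeasure_lborel_countable countable_finite)
    finally show "(\<integral>\<^sup>+t. indicator ?S (z, t) \<partial>lborel) = 0" .
  qed
  finally show ?thesis by (intro AE_I[of _ _ ?S]) auto
qed

lemma AE_snd_neq: "AE \<xi> in lborel. snd (\<xi> :: 'n::finite heis) \<noteq> c"
proof -
  have "{\<xi> :: 'n heis. snd \<xi> \<in> {c}} \<in> sets borel" by (simp add: borel_closed closed_Collect_eq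
    continuous_on_snd)
  from AE_snd_notin[OF _ this] show ?thesis by simp
qed

lemma AE_heis_norm_neq: "AE \<xi> in lborel. heis_norm (\<xi> :: 'n::finite heis) \<noteq> l"
proof -
  let ?F = "\<lambda>z :: complex ^ 'n. {t. norm z ^ 4 + t\<^sup>2 = l ^ 4}"
  have "finite (?F z)" for z
  proof (rule finite_subset)
    show "?F z \<subseteq> {sqrt (l ^ 4 - norm z ^ 4), - sqrt (l ^ 4 - norm z ^ 4)}"
    proof
      fix t assume "t \<in> ?F z"
      then have "sqrt (l ^ 4 - norm z ^ 4) = \<bar>t\<bar>" by (metis (mono_tags) mem_Collect_eq
        add_diff_cancel_left' real_sqrt_abs)
      then show "t \<in> {sqrt (l ^ 4 - norm z ^ 4), - sqrt (l ^ 4 - norm z ^ 4)}"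
        by (auto simp: abs_if split: if_splits)
    qed
  qed simp
  moreover have "{\<xi> :: 'n heis. snd \<xi> \<in> ?F (fst \<xi>)} \<in> sets borel"
    by (simp, intro borel_closed closed_Collect_eq continuous_intros)
  ultimately have "AE \<xi> :: 'n heis in lborel. snd \<xi> \<notin> ?F (fst \<xi>)" by (rule AE_snd_notin)
  then show ?thesis
  proof eventually_elim
    case (elim \<xi>)
    then show ?case using heis_norm_power4[of \<xi>] by auto
  qed
qed

lemma heis_norm_rot [simp]: "heis_norm (rot \<theta> \<xi>) = heis_norm \<xi>"
  by (simp add: heis_norm_def rot_def norm_vector_scalar_mult)

lemma hinv_rot: "hinv l (rot \<theta> \<xi>) = rot \<theta> (hinv l \<xi>)"
  by (simp add: hinv_def) (simp add: dil_def rot_def vec_eq_iff)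

lemma hinv_fixed: "l > 0 \<Longrightarrow> heis_norm \<xi> = l \<Longrightarrow> hinv l \<xi> = \<xi>"
  by (simp add: hinv_def)

definition circle_invariant :: "('n::finite heis \<Rightarrow> real) \<Rightarrow> bool"
  where "circle_invariant u \<longleftrightarrow> (\<forall>\<theta> \<xi>. u (rot \<theta> \<xi>) = u \<xi>)"

lemma circle_invariantD: "circle_invariant u \<Longrightarrow> u (rot \<theta> \<xi>) = u \<xi>"
  unfolding circle_invariant_def by blast

context heis_kernel
begin

text \<open>The equation for extended nonnegative integrals, where Fubini and monotonicity are free
  of integrability conditions. Finiteness at every point is still contained in it, as the left side
  is a real number. Local integrability is stated on Heisenberg balls about
  \<open>0\<close>.\<close>

definition solution :: "('n heis \<Rightarrow> real) \<Rightarrow> bool"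
  where "solution u \<longleftrightarrow> u \<in> borel_measurable borel \<and> (\<forall>\<xi>. 0 \<le> u \<xi>) \<and>
    (\<forall>\<xi>. ennreal (u \<xi>) = (\<integral>\<^sup>+\<eta>. kern \<xi> \<eta> * ennreal (u \<eta> powr \<sigma>) \<partial>lborel)) \<and>
    (\<forall>R. (\<integral>\<^sup>+\<eta>. ennreal (u \<eta> powr (\<sigma> + 1)) * indicator {\<eta>. heis_norm \<eta> < R} \<eta> \<partial>lborel) < \<infinity>)"

lemma solutionD:
  assumes "solution u"
  shows "u \<in> borel_measurable borel" "0 \<le> u \<xi>"
    "ennreal (u \<xi>) = (\<integral>\<^sup>+\<eta>. kern \<xi> \<eta> * ennreal (u \<eta> powr \<sigma>) \<partial>lborel)"
    "(\<integral>\<^sup>+\<eta>. ennreal (u \<eta> powr (\<sigma> + 1)) * indicator {\<eta>. heis_norm \<eta> < R} \<eta> \<partial>lborel) < \<infinity>"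
  using assms unfolding solution_def by blast+

lemma solution_lsc:
  assumes u: "solution u" and X: "X \<longlonglongrightarrow> \<xi>" and c: "c < u \<xi>"
  shows "\<forall>\<^sub>F n in sequentially. c < u (X n)"
proof (cases "c < 0")
  case True
  then have "c < u (X n)" for n using solutionD(2)[OF u, of "X n"] by linarith
  then show ?thesis by simp
next
  case False
  note [measurable] = solutionD(1)[OF u]
  let ?f = "\<lambda>\<eta>. ennreal (u \<eta> powr \<sigma>)"
  have "ennreal c < ennreal (u \<xi>)" using c False by (simp add: ennreal_lessI)
  also have "\<dots> = (\<integral>\<^sup>+\<eta>. kern \<xi> \<eta> * ?f \<eta> \<partial>lborel)" by (rule solutionD(3)[OF u])
  also have "\<dots> \<le> (\<integral>\<^sup>+\<eta>. liminf (\<lambda>n. kern (X n) \<eta> * ?f \<eta>) \<partial>lborel)"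
  proof (rule nn_integral_mono)
    fix \<eta>
    show "kern \<xi> \<eta> * ?f \<eta> \<le> liminf (\<lambda>n. kern (X n) \<eta> * ?f \<eta>)"
    \<comment> \<open>On the diagonal the kernel has the value \<open>0\<close>, so the bound is
      trivial there, although the kernel is not continuous at that point.\<close>
    proof (cases "\<xi> = \<eta>")
      case False
      have "(\<lambda>n. hdist (X n) \<eta>) \<longlonglongrightarrow> hdist \<xi> \<eta>"
      proof (rule continuous_on_tendsto_compose[where s = UNIV and f = "\<lambda>x. hdist x \<eta>"])
        show "continuous_on UNIV (\<lambda>x. hdist x \<eta>)" by (intro continuous_intros)
      qed (use X in auto)
      then have "(\<lambda>n. kern (X n) \<eta> * ?f \<eta>) \<longlonglongrightarrow> kern \<xi> \<eta> * ?f \<eta>"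
        unfolding kern_def using False by (intro tendsto_mult_ennreal tendsto_ennrealI
          tendsto_powr tendsto_const) auto
      then show ?thesis by (simp add: lim_imp_Liminf)
    qed (simp add: kern_def)
  qed
  also have "\<dots> \<le> liminf (\<lambda>n. \<integral>\<^sup>+\<eta>. kern (X n) \<eta> * ?f \<eta> \<partial>lborel)"
    by (rule nn_integral_liminf) measurable
  also have "\<dots> = liminf (\<lambda>n. ennreal (u (X n)))" by (simp only: solutionD(3)[OF u, symmetric])
  finally have "\<forall>\<^sub>F n in sequentially. ennreal c < ennreal (u (X n))" by (rule less_LiminfD)
  then show ?thesis using False by (simp add: ennreal_less_iff)
qed

definition kelvin :: "real \<Rightarrow> ('n heis \<Rightarrow> real) \<Rightarrow> 'n heis \<Rightarrow> real"
  where "kelvin l u \<xi> = (l / heis_norm \<xi>) powr (Q - \<alpha>) * u (hinv l \<xi>)"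

lemma borel_measurable_kelvin [measurable (raw)]:
  assumes [measurable]: "u \<in> borel_measurable borel" "f \<in> borel_measurable M"
  shows "(\<lambda>x. kelvin l u (f x)) \<in> borel_measurable M"
  unfolding kelvin_def by measurable

lemma kelvin_nonneg: "solution u \<Longrightarrow> 0 \<le> kelvin l u \<xi>"
  using solutionD(2) by (simp add: kelvin_def)

lemma kelvin_rot: "circle_invariant u \<Longrightarrow> kelvin l u (rot \<theta> \<xi>) = kelvin l u \<xi>"
  by (simp add: kelvin_def hinv_rot circle_invariantD)

lemma kelvin_fixed: "l > 0 \<Longrightarrow> heis_norm \<xi> = l \<Longrightarrow> kelvin l u \<xi> = u \<xi>"
  by (simp add: kelvin_def hinv_fixed)

lemma kelvin_hinv:
  assumes "l > 0" "\<xi> \<noteq> 0"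
  shows "kelvin l u (hinv l \<xi>) = (heis_norm \<xi> / l) powr (Q - \<alpha>) * u \<xi>"
  using assms by (simp add: kelvin_def heis_norm_hinv hinv_hinv power2_eq_square)

lemma ratio_powr_2Q:
  assumes "0 < (x :: real)"
  shows "x ^ (2 * hdim TYPE('n)) = x powr (2 * Q)"
proof -
  have "x powr real (2 * hdim TYPE('n)) = x ^ (2 * hdim TYPE('n))" using assms
    by (rule powr_realpow)
  moreover have "real (2 * hdim TYPE('n)) = 2 * Q" by (simp add: Q_eq)
  ultimately show ?thesis by simp
qed

lemma nn_integral_hinv_powr:
  fixes f :: "'n heis \<Rightarrow> ennreal"
  assumes [measurable]: "f \<in> borel_measurable borel" and l: "l > 0"
  shows "(\<integral>\<^sup>+\<eta>. f \<eta> \<partial>lborel) = (\<integral>\<^sup>+\<eta>. f (hinv l \<eta>) * ennreal ((l / heis_norm \<eta>) powr (2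
    * Q)) \<partial>lborel)"
proof -
  have "(\<integral>\<^sup>+\<eta>. f \<eta> \<partial>lborel) = (\<integral>\<^sup>+\<eta>. f (hinv l \<eta>) * ennreal ((l / heis_norm \<eta>) ^ (2
    * hdim TYPE('n))) \<partial>lborel)"
    by (rule nn_integral_hinv[symmetric]) fact+
  also have "\<dots> = (\<integral>\<^sup>+\<eta>. f (hinv l \<eta>) * ennreal ((l / heis_norm \<eta>) powr (2 * Q)) \<partial>lborel)"
  proof (rule nn_integral_cong)
    fix \<eta> :: "'n heis"
    have "(l / heis_norm \<eta>) ^ (2 * hdim TYPE('n)) = (l / heis_norm \<eta>) powr (2 * Q)"
    proof (cases "\<eta> = 0")
      case False
      then show ?thesis using l by (intro ratio_powr_2Q) auto
    qed simp
    then show "f (hinv l \<eta>) * ennreal ((l / heis_norm \<eta>) ^ (2 * hdim TYPE('n)))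
      = f (hinv l \<eta>) * ennreal ((l / heis_norm \<eta>) powr (2 * Q))" by simp
  qed
  finally show ?thesis .
qed

abbreviation outside :: "real \<Rightarrow> 'n heis set"
  where "outside l \<equiv> {\<eta>. l < heis_norm \<eta>}"

lemma kelvin_powr:
  assumes "solution u" "l > 0" 
  shows "kelvin l u \<eta> powr \<sigma> = (l / heis_norm \<eta>) powr (Q + \<alpha>) * u (hinv l \<eta>) powr \<sigma>"
    and "kelvin l u \<eta> powr (\<sigma> + 1) = (l / heis_norm \<eta>) powr (2 * Q) * u (hinv l \<eta>) powr (\<sigma> + 1)"
  using assms solutionD(2)[OF assms(1)] 
  by (auto simp: kelvin_def powr_mult powr_powr exponent_rels)

text \<open>The part of the integral inside the sphere is moved outside by \<open>hinv\<close>. The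
  Jacobian exponent \<open>2 * Q\<close> splits as \<open>(Q - \<alpha>) + (Q + \<alpha>)\<close>:
  the first part is the Kelvin weight of the kernel, the second turns
  \<open>u (hinv l \<eta>) powr \<sigma>\<close> into
  \<open>kelvin l u \<eta> powr \<sigma>\<close>.\<close>

lemma solution_decomp:
  assumes u: "solution u" and c: "circle_invariant u" and l: "l > 0"
  shows "ennreal (u \<xi>) = (\<integral>\<^sup>+\<eta>. (kern_avg \<xi> \<eta> * ennreal (u \<eta> powr \<sigma>) +
    kern_avg \<xi> (hinv l \<eta>) * ennreal ((l / heis_norm \<eta>) powr (Q - \<alpha>))
      * ennreal (kelvin l u \<eta> powr \<sigma>)) * indicator (outside l) \<eta> \<partial>lborel)"
proof -
  note [measurable] = solutionD(1)[OF u]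
  let ?f = "\<lambda>\<eta>. kern_avg \<xi> \<eta> * ennreal (u \<eta> powr \<sigma>)"
  let ?B = "{\<eta> :: 'n heis. heis_norm \<eta> < l}"
  have "ennreal (u \<xi>) = (\<integral>\<^sup>+\<eta>. ?f \<eta> \<partial>lborel)"
    using c solutionD(3)[OF u, of \<xi>] by (subst nn_integral_kern_eq_kern_avg[symmetric]) (auto
      simp: circle_invariantD)
  also have "\<dots> = (\<integral>\<^sup>+\<eta>. ?f \<eta> * indicator (outside l) \<eta> + ?f \<eta> * indicator ?B \<eta> \<partial>lborel)"
  proof (rule nn_integral_cong_AE)
    show "AE \<eta> in lborel. ?f \<eta> = ?f \<eta> * indicator (outside l) \<eta> + ?f \<eta> * indicator ?B \<eta>"
      using AE_heis_norm_neq[of l] by eventually_elim (auto simp: indicator_def)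
  qed
  also have "\<dots> = (\<integral>\<^sup>+\<eta>. ?f \<eta> * indicator (outside l) \<eta> \<partial>lborel)
    + (\<integral>\<^sup>+\<eta>. ?f \<eta> * indicator ?B \<eta> \<partial>lborel)"
    by (rule nn_integral_add) measurable
  also have "(\<integral>\<^sup>+\<eta>. ?f \<eta> * indicator ?B \<eta> \<partial>lborel)
      = (\<integral>\<^sup>+\<eta>. ?f (hinv l \<eta>) * indicator ?B (hinv l \<eta>) * ennreal ((l / heis_norm \<eta>) powr (2
        * Q)) \<partial>lborel)"
    by (rule nn_integral_hinv_powr[OF _ l]) measurable
  also have "\<dots> = (\<integral>\<^sup>+\<eta>. kern_avg \<xi> (hinv l \<eta>) * ennreal ((l / heis_norm \<eta>) powr (Q - \<alpha>))
    * ennreal (kelvin l u \<eta> powr \<sigma>) * indicator (outside l) \<eta> \<partial>lborel)"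
  proof (rule nn_integral_cong)
    fix \<eta> :: "'n heis"
    show "?f (hinv l \<eta>) * indicator ?B (hinv l \<eta>) * ennreal ((l / heis_norm \<eta>) powr (2 * Q))
      = kern_avg \<xi> (hinv l \<eta>) * ennreal ((l / heis_norm \<eta>) powr (Q - \<alpha>))
        * ennreal (kelvin l u \<eta> powr \<sigma>) * indicator (outside l) \<eta>"
    proof (cases "\<eta> = 0")
      case False
      then have "indicator ?B (hinv l \<eta>) = (indicator (outside l) \<eta> :: ennreal)"
        using l by (simp add: indicator_def heis_norm_hinv divide_less_eq power2_eq_square)
      moreover have "(l / heis_norm \<eta>) powr (2 * Q)
        = (l / heis_norm \<eta>) powr (Q - \<alpha>) * (l / heis_norm \<eta>) powr (Q + \<alpha>)"
        by (simp flip: powr_add)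
      ultimately show ?thesis
        unfolding kelvin_powr[OF u l] by (simp add: ennreal_mult'' ac_simps)
    qed simp
  qed
  also have "(\<integral>\<^sup>+\<eta>. ?f \<eta> * indicator (outside l) \<eta> \<partial>lborel) + \<dots> =
    (\<integral>\<^sup>+\<eta>. ?f \<eta> * indicator (outside l) \<eta> + kern_avg \<xi> (hinv l \<eta>)
      * ennreal ((l / heis_norm \<eta>) powr (Q - \<alpha>)) * ennreal (kelvin l u \<eta> powr \<sigma>)
        * indicator (outside l) \<eta> \<partial>lborel)"
    by (rule nn_integral_add[symmetric]) measurable
  finally show ?thesis by (simp only: distrib_right)
qed

text \<open>\<open>u\<close> and its Kelvin transform become integrals over the same region of the
  same two densities, with the two kernels exchanged. The comparison is thereby reduced to the sign
  of \<open>kern_avg - kern_avg_refl\<close>.\<close>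

lemma solution_rep:
  assumes u: "solution u" and c: "circle_invariant u" and l: "l > 0" and \<xi>: "\<xi> \<noteq> 0"
  shows "ennreal (u \<xi>) = (\<integral>\<^sup>+\<eta>. (kern_avg \<xi> \<eta> * ennreal (u \<eta> powr \<sigma>) +
      kern_avg_refl l \<xi> \<eta> * ennreal (kelvin l u \<eta> powr \<sigma>))
        * indicator (outside l) \<eta> \<partial>lborel)" (is ?A)
    and "ennreal (kelvin l u \<xi>) = (\<integral>\<^sup>+\<eta>. (kern_avg_refl l \<xi> \<eta> * ennreal (u \<eta> powr \<sigma>) +
      kern_avg \<xi> \<eta> * ennreal (kelvin l u \<eta> powr \<sigma>)) * indicator (outside l) \<eta> \<partial>lborel)" (is ?B)
proof -
  note [measurable] = solutionD(1)[OF u]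
  show ?A
    unfolding solution_decomp[OF u c l, of \<xi>]
  proof (rule nn_integral_cong)
    fix \<eta> :: "'n heis"
    show "(kern_avg \<xi> \<eta> * ennreal (u \<eta> powr \<sigma>) + kern_avg \<xi> (hinv l \<eta>)
      * ennreal ((l / heis_norm \<eta>) powr (Q - \<alpha>)) *
        ennreal (kelvin l u \<eta> powr \<sigma>)) * indicator (outside l) \<eta> =
      (kern_avg \<xi> \<eta> * ennreal (u \<eta> powr \<sigma>) + kern_avg_refl l \<xi> \<eta> * ennreal (kelvin l u \<eta> powr \<sigma>))
        * indicator (outside l) \<eta>"
    proof (cases "l < heis_norm \<eta>")
      case True
      then have "\<eta> \<noteq> 0" using l by auto
      from kern_avg_hinv_left[OF l this, of \<xi>]
      have "kern_avg \<xi> (hinv l \<eta>) * ennreal ((l / heis_norm \<eta>) powr (Q - \<alpha>)) = kern_avg_refl l \<xi> \<eta>"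
        by (simp add: kern_avg_commute[of \<xi>] kern_avg_refl_commute[of l \<xi>] mult.commute)
      then show ?thesis by simp
    qed simp
  qed
  let ?c = "ennreal ((l / heis_norm \<xi>) powr (Q - \<alpha>))"
  have "ennreal (kelvin l u \<xi>) = ?c * ennreal (u (hinv l \<xi>))"
    using solutionD(2)[OF u] by (simp add: kelvin_def ennreal_mult)
  also have "\<dots> = (\<integral>\<^sup>+\<eta>. ?c * ((kern_avg (hinv l \<xi>) \<eta> * ennreal (u \<eta> powr \<sigma>) +
    kern_avg (hinv l \<xi>) (hinv l \<eta>) * ennreal ((l / heis_norm \<eta>) powr (Q - \<alpha>))
      * ennreal (kelvin l u \<eta> powr \<sigma>)) * indicator (outside l) \<eta>) \<partial>lborel)"
    unfolding solution_decomp[OF u c l, of "hinv l \<xi>"]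
      by (rule nn_integral_cmult[symmetric]) measurable
  also have "\<dots> = (\<integral>\<^sup>+\<eta>. (kern_avg_refl l \<xi> \<eta> * ennreal (u \<eta> powr \<sigma>) +
      kern_avg \<xi> \<eta> * ennreal (kelvin l u \<eta> powr \<sigma>)) * indicator (outside l) \<eta> \<partial>lborel)"
  proof (rule nn_integral_cong)
    fix \<eta> :: "'n heis"
    show "?c * ((kern_avg (hinv l \<xi>) \<eta> * ennreal (u \<eta> powr \<sigma>) +
        kern_avg (hinv l \<xi>) (hinv l \<eta>) * ennreal ((l / heis_norm \<eta>) powr (Q - \<alpha>))
          * ennreal (kelvin l u \<eta> powr \<sigma>)) * indicator (outside l) \<eta>)
      = (kern_avg_refl l \<xi> \<eta> * ennreal (u \<eta> powr \<sigma>)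
        + kern_avg \<xi> \<eta> * ennreal (kelvin l u \<eta> powr \<sigma>)) * indicator (outside l) \<eta>"
    proof (cases "l < heis_norm \<eta>")
      case True
      then have "\<eta> \<noteq> 0" using l by auto
      have 1: "?c * kern_avg (hinv l \<xi>) \<eta> = kern_avg_refl l \<xi> \<eta>" by (rule kern_avg_hinv_left) fact+
      have 2: "?c * (ennreal ((l / heis_norm \<eta>) powr (Q - \<alpha>)) * kern_avg (hinv l \<xi>) (hinv l \<eta>))
        = kern_avg \<xi> \<eta>"
        by (rule kern_avg_hinv_both) fact+
      show ?thesis unfolding 1[symmetric] 2[symmetric]
        by (simp only: distrib_left distrib_right ac_simps)
    qed simp
  qed
  finally show ?B .
qed

section \<open>Moving spheres\<close>


text \<open>Real representatives of the two kernel values, so that their difference may be used in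
  the arithmetic below.\<close>

lemma AE_kern_avg_refl_less:
  assumes "l > 0" "l < heis_norm \<xi>"
  shows "AE \<eta> in lborel. \<eta> \<in> outside l \<longrightarrow>
    (\<exists>x y. 0 \<le> y \<and> y < x \<and> kern_avg \<xi> \<eta> = ennreal x \<and> kern_avg_refl l \<xi> \<eta> = ennreal y)"
  using AE_snd_neq[of "snd \<xi>"]
proof eventually_elim
  case (elim \<eta>)
  show ?case
  proof
    assume "\<eta> \<in> outside l"
    then have \<eta>: "l < heis_norm \<eta>" by simp
    from elim have "snd \<xi> \<noteq> snd \<eta>" by simp
    note * = kern_avg_refl_less[OF assms \<eta> this]
    then obtain x y where "0 \<le> x" "0 \<le> y" "kern_avg \<xi> \<eta> = ennreal x" "kern_avg_refl l \<xi> \<eta>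
      = ennreal y"
      by (cases "kern_avg \<xi> \<eta>"; cases "kern_avg_refl l \<xi> \<eta>") auto
    then show "\<exists>x y. 0 \<le> y \<and> y < x \<and> kern_avg \<xi> \<eta> = ennreal x \<and> kern_avg_refl l \<xi> \<eta> = ennreal y"
      using *(1) by (auto simp: ennreal_less_iff)
  qed
qed

text \<open>Formally, subtracting the two representations leaves
  \<open>kern_avg - kern_avg_refl\<close>, which lies between \<open>0\<close> and
  \<open>kern_avg\<close>, times
  \<open>kelvin l u \<eta> powr \<sigma> - u \<eta> powr \<sigma>\<close>, which is at most
  \<open>g\<close>. Invariance of \<open>g\<close> brings back the original kernel, to which the
  Hardy-Littlewood-Sobolev inequality applies.\<close>

lemma kelvin_le_add:
  assumes u: "solution u" and c: "circle_invariant u" and l: "l > 0" and \<xi>: "l < heis_norm \<xi>"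
    and g [measurable]: "g \<in> borel_measurable borel" and g0: "\<And>\<eta>. 0
      \<le> g \<eta>" and gc: "circle_invariant g"
    and gl: "\<And>\<eta>. l < heis_norm \<eta> \<Longrightarrow> kelvin l u \<eta> powr \<sigma> \<le> u \<eta> powr \<sigma> + g \<eta>"
  shows "ennreal (kelvin l u \<xi>) \<le> ennreal (u \<xi>) + (\<integral>\<^sup>+\<eta>. kern \<xi> \<eta> * ennreal (g \<eta>) \<partial>lborel)"
proof -
  note [measurable] = solutionD(1)[OF u]
  have \<xi>0: "\<xi> \<noteq> 0" using l \<xi> by auto
  have "ennreal (kelvin l u \<xi>) = (\<integral>\<^sup>+\<eta>. (kern_avg_refl l \<xi> \<eta> * ennreal (u \<eta> powr \<sigma>) +
      kern_avg \<xi> \<eta> * ennreal (kelvin l u \<eta> powr \<sigma>)) * indicator (outside l) \<eta> \<partial>lborel)"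
    by (rule solution_rep(2)) fact+
  also have "\<dots> \<le> (\<integral>\<^sup>+\<eta>. (kern_avg \<xi> \<eta> * ennreal (u \<eta> powr \<sigma>) +
      kern_avg_refl l \<xi> \<eta> * ennreal (kelvin l u \<eta> powr \<sigma>)) * indicator (outside l) \<eta>
        + kern_avg \<xi> \<eta> * ennreal (g \<eta>) \<partial>lborel)"
  proof (rule nn_integral_mono_AE)
    show "AE \<eta> in lborel. (kern_avg_refl l \<xi> \<eta> * ennreal (u \<eta> powr \<sigma>)
      + kern_avg \<xi> \<eta> * ennreal (kelvin l u \<eta> powr \<sigma>)) * indicator (outside l) \<eta>
      \<le> (kern_avg \<xi> \<eta> * ennreal (u \<eta> powr \<sigma>) + kern_avg_refl l \<xi> \<eta>
        * ennreal (kelvin l u \<eta> powr \<sigma>)) * indicator (outside l) \<eta> + kern_avg \<xi> \<eta> * ennreal (g \<eta>)"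
      using AE_kern_avg_refl_less[OF l \<xi>]
    proof eventually_elim
      case (elim \<eta>)
      show ?case
      proof (cases "\<eta> \<in> outside l")
        case True
        with elim obtain x y where xy: "0 \<le> y" "y < x" "kern_avg \<xi> \<eta>
          = ennreal x" "kern_avg_refl l \<xi> \<eta> = ennreal y" by blast
        define P where "P = u \<eta> powr \<sigma>"
        define R where "R = kelvin l u \<eta> powr \<sigma>"
        have PR: "0 \<le> P" "0 \<le> R" by (auto simp: P_def R_def)
        have "R \<le> P + g \<eta>" using gl[of \<eta>] True by (simp add: P_def R_def)
        then have "(x - y) * R \<le> (x - y) * (P + g \<eta>)" using xy by (intro mult_left_mono) auto
        then have "y * P + x * R \<le> x * P + y * R + (x - y) * g \<eta>" by (simp add: algebra_simps)
        also have "\<dots> \<le> x * P + y * R + x * g \<eta>"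
          using xy g0[of \<eta>] by (intro add_left_mono mult_right_mono) auto
        finally have "ennreal (y * P + x * R) \<le> ennreal (x * P + y * R + x * g \<eta>)"
          by (rule ennreal_leI)
        then show ?thesis
          using True xy PR g0[of \<eta>] by (simp add: P_def[symmetric] R_def[symmetric] ennreal_mult)
      qed simp
    qed
  qed
  also have "\<dots> = ennreal (u \<xi>) + (\<integral>\<^sup>+\<eta>. kern_avg \<xi> \<eta> * ennreal (g \<eta>) \<partial>lborel)"
    unfolding solution_rep(1)[OF u c l \<xi>0] by (rule nn_integral_add) measurable
  also have "(\<integral>\<^sup>+\<eta>. kern_avg \<xi> \<eta> * ennreal (g \<eta>) \<partial>lborel)
    = (\<integral>\<^sup>+\<eta>. kern \<xi> \<eta> * ennreal (g \<eta>) \<partial>lborel)"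
    by (rule nn_integral_kern_eq_kern_avg[symmetric]) (auto simp: circle_invariantD[OF gc])
  finally show ?thesis .
qed

definition above_kelvin :: "('n heis \<Rightarrow> real) \<Rightarrow> real \<Rightarrow> bool"
  where "above_kelvin u l \<longleftrightarrow> (\<forall>\<xi>. l \<le> heis_norm \<xi> \<longrightarrow> kelvin l u \<xi> \<le> u \<xi>)"

text \<open>The Kelvin transform is an involution off the origin, so passing to the inverse point
  exchanges the roles of \<open>u\<close> and \<open>kelvin l u\<close> up to a common positive
  factor.\<close>

lemma kelvin_less_hinv_iff:
  assumes l: "l > 0" and "\<eta> \<noteq> 0"
  shows "kelvin l u (hinv l \<eta>) < u (hinv l \<eta>) \<longleftrightarrow> u \<eta> < kelvin l u \<eta>"
proof -
  define t where "t = (heis_norm \<eta> / l) powr (Q - \<alpha>)"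
  have t: "t > 0" using assms by (simp add: t_def)
  have "(l / heis_norm \<eta>) powr (Q - \<alpha>) = 1 / t"
    using assms by (simp add: t_def powr_divide)
  then have "kelvin l u \<eta> = u (hinv l \<eta>) / t" by (simp add: kelvin_def)
  then have "u (hinv l \<eta>) = t * kelvin l u \<eta>" using t by simp
  moreover have "kelvin l u (hinv l \<eta>) = t * u \<eta>" using assms by (simp add: kelvin_hinv t_def)
  ultimately show ?thesis using mult_less_cancel_left_pos[OF t] by simp
qed

text \<open>Conformal invariance of the critical norm: the weight of
  \<open>kelvin l u powr (\<sigma> + 1)\<close> is exactly the Jacobian of \<open>hinv\<close>. A
  region outside the sphere is thus controlled by the local integrability of
  \<open>u\<close>.\<close>

lemma nn_integral_kelvin_bad_set:
  assumes u: "solution u" and l: "l > 0"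
  shows "(\<integral>\<^sup>+\<eta>. ennreal (kelvin l u \<eta> powr (\<sigma> + 1))
    * indicator {\<eta>. l < heis_norm \<eta> \<and> u \<eta> < kelvin l u \<eta>} \<eta> \<partial>lborel)
    = (\<integral>\<^sup>+\<eta>. ennreal (u \<eta> powr (\<sigma> + 1)) * indicator {\<eta>. heis_norm \<eta> < l \<and> kelvin l u \<eta> < u \<eta>} \<eta>
      \<partial>lborel)"
proof -
  note [measurable] = solutionD(1)[OF u]
  let ?A = "{\<eta>. heis_norm \<eta> < l \<and> kelvin l u \<eta> < u \<eta>}"
  let ?B = "{\<eta>. l < heis_norm \<eta> \<and> u \<eta> < kelvin l u \<eta>}"
  have "(\<integral>\<^sup>+\<eta>. ennreal (u \<eta> powr (\<sigma> + 1)) * indicator ?A \<eta> \<partial>lborel)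
    = (\<integral>\<^sup>+\<eta>. ennreal (u (hinv l \<eta>) powr (\<sigma> + 1)) * indicator ?A (hinv l \<eta>)
      * ennreal ((l / heis_norm \<eta>) powr (2 * Q)) \<partial>lborel)"
    by (rule nn_integral_hinv_powr[OF _ l]) measurable
  also have "\<dots> = (\<integral>\<^sup>+\<eta>. ennreal (kelvin l u \<eta> powr (\<sigma> + 1)) * indicator ?B \<eta> \<partial>lborel)"
  proof (rule nn_integral_cong)
    fix \<eta> :: "'n heis"
    show "ennreal (u (hinv l \<eta>) powr (\<sigma> + 1)) * indicator ?A (hinv l \<eta>)
      * ennreal ((l / heis_norm \<eta>) powr (2 * Q))
      = ennreal (kelvin l u \<eta> powr (\<sigma> + 1)) * indicator ?B \<eta>"
    proof (cases "\<eta> = 0")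
      case False
      then have "heis_norm (hinv l \<eta>) < l \<longleftrightarrow> l < heis_norm \<eta>"
        using l by (simp add: heis_norm_hinv divide_less_eq power2_eq_square)
      then have "indicator ?A (hinv l \<eta>) = (indicator ?B \<eta> :: ennreal)"
        using kelvin_less_hinv_iff[OF l False, of u] by (simp add: indicator_def)
      then show ?thesis unfolding kelvin_powr[OF u l] by (simp add: ennreal_mult'' ac_simps)
    qed (use l in \<open>simp add: kelvin_def\<close>)
  qed
  finally show ?thesis ..
qed

text \<open>In the region where \<open>u\<close> lies below its Kelvin transform the comparison function satisfies
  a linear inequality whose potential is small in the critical norm, so the
  Hardy--Littlewood--Sobolev inequality forces it to vanish.\<close>

lemma above_kelvin_small:
  obtains \<epsilon> where "\<epsilon> > 0" "\<And>u l. solution u \<Longrightarrow> circle_invariant u \<Longrightarrow> l > 0 \<Longrightarrow>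
    (\<integral>\<^sup>+\<eta>. ennreal (u \<eta> powr (\<sigma> + 1)) * indicator {\<eta>. heis_norm \<eta> < l \<and> kelvin l u \<eta> < u \<eta>} \<eta>
      \<partial>lborel) < ennreal \<epsilon>
    \<Longrightarrow> above_kelvin u l"
proof -
  \<comment> \<open>\<open>\<tau>\<close> makes the Hardy-Littlewood-Sobolev term below equal to
    \<open>G / 2\<close>, and \<open>\<epsilon>\<close> then makes the remaining term smaller than
    \<open>G / 2\<close>.\<close>
  define \<tau> where "\<tau> = (4 * \<sigma> * C1) powr (1 / \<gamma>)"
  have s1: "\<sigma> > 1" and C1: "C1 > 0" and g0: "\<gamma> > 0" by (rule \<sigma>_gt_1 C1_pos \<gamma>_pos)+
  have \<tau>: "\<tau> > 0" using s1 C1 by (simp add: \<tau>_def)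
  have \<tau>_powr: "\<tau> powr - \<gamma> = 1 / (4 * \<sigma> * C1)"
  proof -
    have "\<tau> powr - \<gamma> = (4 * \<sigma> * C1) powr (1 / \<gamma> * - \<gamma>)" unfolding \<tau>_def by (rule powr_powr)
    also have "1 / \<gamma> * - \<gamma> = - 1" using g0 by simp
    also have "(4 * \<sigma> * C1) powr - 1 = 1 / (4 * \<sigma> * C1)" using s1 C1 by (intro powr_neg_one) auto
    finally show ?thesis .
  qed
  define \<epsilon> where "\<epsilon> = 1 / (2 * \<tau>)"
  have "\<epsilon> > 0" using \<tau> by (simp add: \<epsilon>_def)
  moreover have "above_kelvin u l" if u: "solution u" and c: "circle_invariant u" and l: "l > 0"
    and small: "(\<integral>\<^sup>+\<eta>. ennreal (u \<eta> powr (\<sigma> + 1)) * indicator {\<eta>. heis_norm \<eta> < l \<and> kelvin l u \<eta> <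
      u \<eta>} \<eta> \<partial>lborel) < ennreal \<epsilon>"
    for u l
  proof -
    note [measurable] = solutionD(1)[OF u]
    let ?B = "{\<eta>. l < heis_norm \<eta> \<and> u \<eta> < kelvin l u \<eta>}"
    define U where "U = kelvin l u"
    have [measurable]: "U \<in> borel_measurable borel" unfolding U_def by measurable
    \<comment> \<open>The positive excess of the nonlinearity outside the sphere. Its potential
      bounds \<open>U - u\<close> by \<open>kelvin_le_add\<close>, and convexity bounds
      \<open>g\<close> in turn by \<open>U - u\<close>.\<close>
    define g where "g \<eta> = (if l < heis_norm \<eta> \<and> u \<eta> < U \<eta> then U \<eta> powr \<sigma> - u \<eta> powr \<sigma> else 0)"
      for \<eta>
    have [measurable]: "g \<in> borel_measurable borel" unfolding g_def by measurable
    have u0: "0 \<le> u \<eta>" for \<eta> using solutionD(2)[OF u] .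
    have U0: "0 \<le> U \<eta>" for \<eta> using kelvin_nonneg[OF u] by (simp add: U_def)
    have g_nn: "0 \<le> g \<eta>" for \<eta>
      using u0[of \<eta>] s1 by (auto simp: g_def intro!: powr_mono2)
    have gc: "circle_invariant g" unfolding circle_invariant_def g_def U_def
      by (simp add: kelvin_rot[OF c] circle_invariantD[OF c])
    have gB: "g \<eta> = 0" if "\<eta> \<notin> ?B" for \<eta> using that by (auto simp: g_def U_def)
    have pot: "ennreal (U \<xi>) \<le> ennreal (u \<xi>) + (\<integral>\<^sup>+\<eta>. kern \<xi> \<eta> * ennreal (g \<eta>) \<partial>lborel)"
      if "l < heis_norm \<xi>" for \<xi>
      unfolding U_def
    proof (rule kelvin_le_add[OF u c l that _ g_nn gc])
      fix \<eta> :: "'n heis" assume "l < heis_norm \<eta>"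
      then show "kelvin l u \<eta> powr \<sigma> \<le> u \<eta> powr \<sigma> + g \<eta>"
        using kelvin_nonneg[OF u, of l \<eta>] s1 by (auto simp: g_def U_def not_less intro: powr_mono2)
    qed auto
    define Y where "Y = enn2real (\<integral>\<^sup>+\<eta>. ennreal (U \<eta> powr (\<sigma> + 1)) * indicator ?B \<eta> \<partial>lborel)"
    have Y_less: "(\<integral>\<^sup>+\<eta>. ennreal (U \<eta> powr (\<sigma> + 1)) * indicator ?B \<eta> \<partial>lborel) < ennreal \<epsilon>"
      unfolding U_def nn_integral_kelvin_bad_set[OF u l] by (rule small)
    then have Y: "(\<integral>\<^sup>+\<eta>. ennreal (U \<eta> powr (\<sigma> + 1)) * indicator ?B \<eta> \<partial>lborel) = ennreal Y"
      unfolding Y_def by (intro ennreal_enn2real[symmetric]) (auto simp: less_top intro: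
        order_less_trans)
    have Ye: "0 \<le> Y" "Y < \<epsilon>" using Y_less unfolding Y by (auto simp: Y_def ennreal_less_iff)
    have gp_le: "ennreal (g \<eta> powr p) \<le> ennreal (U \<eta> powr (\<sigma> + 1)) * indicator ?B \<eta>" for \<eta>
    proof (cases "\<eta> \<in> ?B")
      case True
      then have "g \<eta> \<le> U \<eta> powr \<sigma>" by (auto simp: g_def)
      then have "g \<eta> powr p \<le> (U \<eta> powr \<sigma>) powr p" using g_nn p_gt_1 by (intro powr_mono2) auto
      then show ?thesis using True by (simp add: powr_powr exponent_rels ennreal_leI)
    qed (simp add: gB)
    have "(\<integral>\<^sup>+\<eta>. ennreal (g \<eta> powr p) \<partial>lborel) \<le> ennreal Y"
      unfolding Y[symmetric] by (intro nn_integral_mono gp_le)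
    \<comment> \<open>Finiteness of \<open>G\<close>, a consequence of
      \<open>g \<eta> powr p \<le> U \<eta> powr (\<sigma> + 1)\<close> on the bad set, is what
      permits the absorption argument.\<close>
    then obtain G where G: "(\<integral>\<^sup>+\<eta>. ennreal (g \<eta> powr p) \<partial>lborel) = ennreal G" "G \<ge> 0"
      by (cases "\<integral>\<^sup>+\<eta>. ennreal (g \<eta> powr p) \<partial>lborel") (auto simp: top_unique)
    have "G = 0"
    proof (rule ccontr)
      assume "G \<noteq> 0"
      with G have Gp: "G > 0" by simp
      define t where "t = 1 / (\<tau> * G)"
      have t: "t > 0" using \<tau> Gp by (simp add: t_def)
      \<comment> \<open>A pointwise split takes the place of Hoelder's inequality. If
        \<open>U powr (\<sigma> + 1) \<le> t * g powr p\<close>, then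
        \<open>U powr (\<sigma> - 1)\<close> is at most
        \<open>t powr \<gamma> * g powr (p * \<gamma>)\<close>, and convexity together with
        \<open>p - 1 + p * \<gamma> = 1\<close> gives the first term. Otherwise the second term
        alone suffices.\<close>
      have pw: "ennreal (g \<eta> powr p) \<le> ennreal (\<sigma> * t powr \<gamma>) * (ennreal (g \<eta>) * (\<integral>\<^sup>+\<zeta>. kern \<eta> \<zeta>
        * ennreal (g \<zeta>) \<partial>lborel))
        + ennreal (1 / t) * (ennreal (U \<eta> powr (\<sigma> + 1)) * indicator ?B \<eta>)" for \<eta>
      proof (cases "\<eta> \<in> ?B \<and> g \<eta> > 0")
        case False
        then have "g \<eta> = 0" using gB[of \<eta>] g_nn[of \<eta>] by linarith
        then show ?thesis by simp
      next
        case True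
        then have B: "l < heis_norm \<eta>" "u \<eta> < U \<eta>" and gp: "g \<eta> > 0" by (auto simp: U_def)
        have "g \<eta> powr p \<le> \<sigma> * t powr \<gamma> * (g \<eta> * (U \<eta> - u \<eta>)) + 1 / t * U \<eta> powr (\<sigma> + 1)"
        proof (cases "U \<eta> powr (\<sigma> + 1) \<le> t * g \<eta> powr p")
          case True
          have Up: "U \<eta> > 0" using B u0[of \<eta>] by linarith
          have "U \<eta> powr (\<sigma> - 1) = (U \<eta> powr (\<sigma> + 1)) powr \<gamma>"
            by (simp add: powr_powr exponent_rels mult.commute)
          also have "\<dots> \<le> (t * g \<eta> powr p) powr \<gamma>" using True g0 by (intro powr_mono2) auto
          also have "\<dots> = t powr \<gamma> * g \<eta> powr (p * \<gamma>)" using t gp by (simp add: powr_mult powr_powr)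
          finally have 1: "U \<eta> powr (\<sigma> - 1) \<le> t powr \<gamma> * g \<eta> powr (p * \<gamma>)" .
          have "g \<eta> \<le> \<sigma> * U \<eta> powr (\<sigma> - 1) * (U \<eta> - u \<eta>)"
            using powr_diff_le(1)[of "u \<eta>" "U \<eta>" \<sigma>] B u0 s1 by (simp add: g_def)
          also have "\<dots> \<le> \<sigma> * (t powr \<gamma> * g \<eta> powr (p * \<gamma>)) * (U \<eta> - u \<eta>)"
            using 1 s1 B by (intro mult_right_mono mult_left_mono) auto
          finally have 2: "g \<eta> \<le> \<sigma> * (t powr \<gamma> * g \<eta> powr (p * \<gamma>)) * (U \<eta> - u \<eta>)" .
          have e: "g \<eta> powr (p - 1) * g \<eta> = g \<eta> powr p" "g \<eta> powr (p - 1) * g \<eta> powr (p * \<gamma>) = g \<eta>"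
          proof -
            show "g \<eta> powr (p - 1) * g \<eta> = g \<eta> powr p" using gp by (simp add: powr_diff)
            have "p - 1 + p * \<gamma> = 1" using exponent_rels(1) by simp
            then show "g \<eta> powr (p - 1) * g \<eta> powr (p * \<gamma>) = g \<eta>"
              using gp by (simp only: powr_add[symmetric]) simp
          qed
          have "g \<eta> powr p = g \<eta> powr (p - 1) * g \<eta>" by (simp only: e)
          also have "\<dots> \<le> g \<eta> powr (p - 1) * (\<sigma> * (t powr \<gamma> * g \<eta> powr (p * \<gamma>)) * (U \<eta> - u \<eta>))"
            using 2 by (intro mult_left_mono) auto
          also have "\<dots> = \<sigma> * t powr \<gamma> * ((g \<eta> powr (p - 1) * g \<eta> powr (p * \<gamma>)) * (U \<eta> - u \<eta>))"
            by (simp only: ac_simps)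
          also have "\<dots> = \<sigma> * t powr \<gamma> * (g \<eta> * (U \<eta> - u \<eta>))" unfolding e(2) ..
          finally show ?thesis using t by (simp add: add_increasing2)
        next
          case False
          then have "g \<eta> powr p \<le> 1 / t * U \<eta> powr (\<sigma> + 1)" using t by (simp add: field_simps)
          moreover have "0 \<le> \<sigma> * t powr \<gamma> * (g \<eta> * (U \<eta> - u \<eta>))" using s1 B gp by simp
          ultimately show ?thesis by linarith
        qed
        then have "ennreal (g \<eta> powr p) \<le> ennreal (\<sigma> * t powr \<gamma> * (g \<eta> * (U \<eta> - u \<eta>))
          + 1 / t * U \<eta> powr (\<sigma> + 1))"
          by (rule ennreal_leI)
        also have "\<dots> = ennreal (\<sigma> * t powr \<gamma> * (g \<eta> * (U \<eta> - u \<eta>))) + ennreal (1 / t * U \<eta> powr (\<sigma>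
          + 1))"
          using s1 B gp t by (intro ennreal_plus) auto
        also have "ennreal (\<sigma> * t powr \<gamma> * (g \<eta> * (U \<eta> - u \<eta>)))
          = ennreal (\<sigma> * t powr \<gamma>) * (ennreal (g \<eta>) * ennreal (U \<eta> - u \<eta>))"
          using s1 B gp by (simp add: ennreal_mult)
        also have "ennreal (1 / t * U \<eta> powr (\<sigma> + 1))
          = ennreal (1 / t) * (ennreal (U \<eta> powr (\<sigma> + 1)) * indicator ?B \<eta>)"
        proof -
          have "ennreal (1 / t * U \<eta> powr (\<sigma> + 1)) = ennreal (1 / t) * ennreal (U \<eta> powr (\<sigma> + 1))"
            using t by (intro ennreal_mult) auto
          then show ?thesis using True by simp
        qed
        also have "ennreal (U \<eta> - u \<eta>) \<le> (\<integral>\<^sup>+\<zeta>. kern \<eta> \<zeta> * ennreal (g \<zeta>) \<partial>lborel)"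
        proof -
          have "ennreal (u \<eta>) + ennreal (U \<eta> - u \<eta>)
            \<le> ennreal (u \<eta>) + (\<integral>\<^sup>+\<zeta>. kern \<eta> \<zeta> * ennreal (g \<zeta>) \<partial>lborel)"
            using pot[OF B(1)] B u0[of \<eta>] by (simp flip: ennreal_plus)
          then show ?thesis by (simp add: ennreal_add_left_cancel_le)
        qed
        finally show ?thesis by (simp add: mult_left_mono)
      qed
      have "ennreal G \<le> (\<integral>\<^sup>+\<eta>. ennreal (\<sigma> * t powr \<gamma>) * (ennreal (g \<eta>) * (\<integral>\<^sup>+\<zeta>. kern \<eta> \<zeta>
        * ennreal (g \<zeta>) \<partial>lborel))
        + ennreal (1 / t) * (ennreal (U \<eta> powr (\<sigma> + 1)) * indicator ?B \<eta>) \<partial>lborel)"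
        unfolding G(1)[symmetric] by (intro nn_integral_mono pw)
      also have "\<dots> = ennreal (\<sigma> * t powr \<gamma>) * (\<integral>\<^sup>+\<eta>. ennreal (g \<eta>) * (\<integral>\<^sup>+\<zeta>. kern \<eta> \<zeta>
        * ennreal (g \<zeta>) \<partial>lborel) \<partial>lborel)
        + ennreal (1 / t) * ennreal Y"
        by (simp add: nn_integral_add nn_integral_cmult Y)
      also have "\<dots> \<le> ennreal (\<sigma> * t powr \<gamma>) * ennreal (2 * C1 * G powr (1 + \<gamma>))
        + ennreal (1 / t) * ennreal Y"
        by (intro add_right_mono mult_left_mono Hardy_Littlewood_Sobolev g_nn) (auto simp: G Gp)
      also have "\<dots> = ennreal (\<sigma> * t powr \<gamma> * (2 * C1 * G powr (1 + \<gamma>)) + 1 / t * Y)"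
      proof -
        have "ennreal (\<sigma> * t powr \<gamma>) * ennreal (2 * C1 * G powr (1 + \<gamma>))
          = ennreal (\<sigma> * t powr \<gamma> * (2 * C1 * G powr (1 + \<gamma>)))"
          using s1 C1 by (intro ennreal_mult[symmetric]) auto
        moreover have "ennreal (1 / t) * ennreal Y = ennreal (1 / t * Y)"
          using t Ye by (intro ennreal_mult[symmetric]) auto
        ultimately show ?thesis
          using s1 C1 t Ye by (simp only:) (intro ennreal_plus[symmetric] mult_nonneg_nonneg; simp)
      qed
      finally have "G \<le> \<sigma> * t powr \<gamma> * (2 * C1 * G powr (1 + \<gamma>)) + 1 / t * Y"
        using s1 C1 t Ye by (subst (asm) ennreal_le_iff) auto
      also have "\<sigma> * t powr \<gamma> * (2 * C1 * G powr (1 + \<gamma>)) = G / 2"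
      proof -
        have "t powr \<gamma> * G powr (1 + \<gamma>) = \<tau> powr - \<gamma> * G"
          using \<tau> Gp by (simp add: t_def powr_divide powr_mult powr_add powr_minus field_simps)
        then have "\<sigma> * t powr \<gamma> * (2 * C1 * G powr (1 + \<gamma>)) = 2 * \<sigma> * C1 * (\<tau> powr - \<gamma> * G)"
          by (simp add: ac_simps)
        then show ?thesis unfolding \<tau>_powr using s1 C1 by simp
      qed
      also have "1 / t * Y < G / 2"
      proof -
        have "1 / t * Y = \<tau> * G * Y" by (simp add: t_def)
        also have "\<dots> < \<tau> * G * \<epsilon>" using Ye \<tau> Gp by (intro mult_strict_left_mono) auto
        also have "\<dots> = G / 2" using \<tau> by (simp add: \<epsilon>_def)
        finally show ?thesis .
      qed
      finally show False by simp
    qed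
    with G have "(\<integral>\<^sup>+\<eta>. ennreal (g \<eta> powr p) \<partial>lborel) = 0" by simp
    then have "AE \<eta> in lborel. ennreal (g \<eta> powr p) = 0" by (subst (asm) nn_integral_0_iff_AE) auto
    then have "AE \<eta> in lborel. kern \<xi> \<eta> * ennreal (g \<eta>) = 0" for \<xi>
      by eventually_elim auto
    then have pot0: "(\<integral>\<^sup>+\<eta>. kern \<xi> \<eta> * ennreal (g \<eta>) \<partial>lborel) = 0" for \<xi>
      by (subst nn_integral_0_iff_AE) auto
    show "above_kelvin u l"
      unfolding above_kelvin_def
    proof (intro allI impI)
      fix \<xi> :: "'n heis" assume "l \<le> heis_norm \<xi>"
      then consider "heis_norm \<xi> = l" | "l < heis_norm \<xi>" by linarith
      then show "kelvin l u \<xi> \<le> u \<xi>"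
      proof cases
        case 1
        then show ?thesis using l by (simp add: kelvin_fixed)
      next
        case 2
        from pot[OF this] show ?thesis using u0 by (simp add: pot0 U_def)
      qed
    qed
  qed
  ultimately show thesis by (rule that)
qed

text \<open>Contact at one outer point makes the two representing integrals equal. Since one kernel
  is strictly larger than the other almost everywhere, the densities must agree almost everywhere
  outside, and then both representations coincide at every outer point.\<close>

lemma above_kelvin_dichotomy:
  assumes u: "solution u" and c: "circle_invariant u" and l: "l > 0" and S: "above_kelvin u l"
    and \<xi>: "l < heis_norm \<xi>" "kelvin l u \<xi> = u \<xi>" and \<zeta>: "l < heis_norm \<zeta>"
  shows "kelvin l u \<zeta> = u \<zeta>"
proof -
  note [measurable] = solutionD(1)[OF u]
  have nz: "\<xi> \<noteq> 0" "\<zeta> \<noteq> 0" using l \<xi> \<zeta> by auto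
  let ?f = "\<lambda>\<eta>. (kern_avg_refl l \<xi> \<eta> * ennreal (u \<eta> powr \<sigma>)
    + kern_avg \<xi> \<eta> * ennreal (kelvin l u \<eta> powr \<sigma>)) * indicator (outside l) \<eta>"
  let ?g = "\<lambda>\<eta>. (kern_avg \<xi> \<eta> * ennreal (u \<eta> powr \<sigma>)
    + kern_avg_refl l \<xi> \<eta> * ennreal (kelvin l u \<eta> powr \<sigma>)) * indicator (outside l) \<eta>"
  have le: "kelvin l u \<eta> powr \<sigma> \<le> u \<eta> powr \<sigma>" if "l < heis_norm \<eta>" for \<eta>
  proof -
    have "kelvin l u \<eta> \<le> u \<eta>" using S that unfolding above_kelvin_def by (meson less_imp_le)
    then show ?thesis using kelvin_nonneg[OF u] \<sigma>_gt_1 by (intro powr_mono2) auto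
  qed
  have real_le: "y * P + x * R \<le> x * P + y * R" if "R \<le> P" "y \<le> x" for x y P R :: real
  proof -
    have "0 \<le> (x - y) * (P - R)" using that by simp
    then show ?thesis by (simp add: algebra_simps)
  qed
  have "AE \<eta> in lborel. ?f \<eta> = ?g \<eta>"
  proof (rule nn_integral_eq_imp_AE_eq)
    show "AE \<eta> in lborel. ?f \<eta> \<le> ?g \<eta>"
      using AE_kern_avg_refl_less[OF l \<xi>(1)]
    proof eventually_elim
      case (elim \<eta>)
      show ?case
      proof (cases "\<eta> \<in> outside l")
        case True
        with elim obtain x y where xy: "0 \<le> y" "y < x" "kern_avg \<xi> \<eta>
          = ennreal x" "kern_avg_refl l \<xi> \<eta> = ennreal y" by blast
        have "ennreal (y * u \<eta> powr \<sigma> + x * kelvin l u \<eta> powr \<sigma>)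
          \<le> ennreal (x * u \<eta> powr \<sigma> + y * kelvin l u \<eta> powr \<sigma>)"
          using xy le[of \<eta>] True by (intro ennreal_leI real_le) auto
        then show ?thesis using True xy by (simp add: ennreal_mult)
      qed simp
    qed
    show "integral\<^sup>N lborel ?g = integral\<^sup>N lborel ?f" "integral\<^sup>N lborel ?f \<noteq> \<infinity>"
      using solution_rep[OF u c l nz(1)] \<xi>(2) by (metis, metis ennreal_neq_top infinity_ennreal_def)
  qed measurable
  then have AE_eq: "AE \<eta> in lborel. \<eta> \<in> outside l \<longrightarrow> kelvin l u \<eta> powr \<sigma> = u \<eta> powr \<sigma>"
    using AE_kern_avg_refl_less[OF l \<xi>(1)]
  proof eventually_elim
    case (elim \<eta>)
    show ?case
    proof
      assume o: "\<eta> \<in> outside l"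
      with elim obtain x y where xy: "0 \<le> y" "y < x" "kern_avg \<xi> \<eta>
        = ennreal x" "kern_avg_refl l \<xi> \<eta> = ennreal y" by blast
      let ?P = "u \<eta> powr \<sigma>" and ?R = "kelvin l u \<eta> powr \<sigma>"
      have "ennreal (y * ?P + x * ?R) = ennreal (x * ?P + y * ?R)"
        using elim(1) o xy by (simp add: ennreal_mult)
      then have "y * ?P + x * ?R = x * ?P + y * ?R" using xy by (subst (asm) ennreal_inj) auto
      then have "(x - y) * (?P - ?R) = 0" by (simp add: algebra_simps)
      then show "?R = ?P" using xy by simp
    qed
  qed
  have "ennreal (kelvin l u \<zeta>) = ennreal (u \<zeta>)"
    unfolding solution_rep[OF u c l nz(2)]
  proof (rule nn_integral_cong_AE)
    show "AE \<eta> in lborel. (kern_avg_refl l \<zeta> \<eta> * ennreal (u \<eta> powr \<sigma>)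
      + kern_avg \<zeta> \<eta> * ennreal (kelvin l u \<eta> powr \<sigma>)) * indicator (outside l) \<eta>
      = (kern_avg \<zeta> \<eta> * ennreal (u \<eta> powr \<sigma>) + kern_avg_refl l \<zeta> \<eta>
        * ennreal (kelvin l u \<eta> powr \<sigma>)) * indicator (outside l) \<eta>"
      using AE_eq by eventually_elim (auto simp: indicator_def add.commute)
  qed
  then show ?thesis using kelvin_nonneg[OF u] solutionD(2)[OF u] by (simp add: ennreal_inj)
qed

text \<open>Only the radius varies: the inverted point moves continuously with it, so lower
  semicontinuity of \<open>u\<close> carries over after the continuous positive weight is divided
  out.\<close>

lemma kelvin_lsc:
  assumes u: "solution u" and X: "X \<longlonglongrightarrow> l" and l: "l > 0" and \<xi>: "\<xi> \<noteq> 0" and c: "c < kelvin l u \<xi>"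
  shows "\<forall>\<^sub>F n in sequentially. c < kelvin (X n) u \<xi>"
proof -
  define r where "r = heis_norm \<xi>"
  have r: "r > 0" using \<xi> by (simp add: r_def)
  define A where "A x = (x / r) powr (Q - \<alpha>)" for x
  have A: "A l > 0" using l r by (simp add: A_def)
  have AX: "(\<lambda>n. A (X n)) \<longlonglongrightarrow> A l"
    unfolding A_def using X l r by (intro tendsto_intros) auto
  have "c / A l < u (hinv l \<xi>)" using c A by (simp add: kelvin_def A_def r_def field_simps)
  then obtain d where d: "c / A l < d" "d < u (hinv l \<xi>)" using dense by blast
  have "(\<lambda>n. hinv (X n) \<xi>) \<longlonglongrightarrow> hinv l \<xi>"
    unfolding hinv_def dil_def r_def[symmetric] using X r by (intro tendsto_intros) auto
  from solution_lsc[OF u this d(2)] have 1: "\<forall>\<^sub>F n in sequentially. d < u (hinv (X n) \<xi>)" .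
  have "(\<lambda>n. c / A (X n)) \<longlonglongrightarrow> c / A l" using A by (intro tendsto_intros AX) auto
  then have 2: "\<forall>\<^sub>F n in sequentially. c / A (X n) < d" using d(1) by (rule order_tendstoD)
  have 3: "\<forall>\<^sub>F n in sequentially. 0 < A (X n)" using AX A by (rule order_tendstoD)
  from 1 2 3 show ?thesis
  proof eventually_elim
    case (elim n)
    then have "c / A (X n) < u (hinv (X n) \<xi>)" by linarith
    then show ?case using elim(3) by (simp add: kelvin_def A_def r_def field_simps)
  qed
qed

text \<open>A violation at radius \<open>l\<close> would, by lower semicontinuity in the radius,
  persist at slightly smaller radii, while the value \<open>u \<xi>\<close> on the other side does
  not change.\<close>

lemma above_kelvin_closed:
  assumes u: "solution u" and l: "l > 0" and S: "\<And>m. 0 < m \<Longrightarrow> m < l \<Longrightarrow> above_kelvin u m"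
  shows "above_kelvin u l"
  unfolding above_kelvin_def
proof (intro allI impI)
  fix \<xi> :: "'n heis" assume \<xi>: "l \<le> heis_norm \<xi>"
  show "kelvin l u \<xi> \<le> u \<xi>"
  proof (rule ccontr)
    assume "\<not> kelvin l u \<xi> \<le> u \<xi>"
    then have lt: "u \<xi> < kelvin l u \<xi>" by simp
    \<comment> \<open>The shift by \<open>2\<close> keeps \<open>X 0\<close> positive.\<close>
    define X where "X n = l * (1 - 1 / real (n + 2))" for n
    have "(\<lambda>n. l * (1 - 1 / real (n + 2))) \<longlonglongrightarrow> l * (1 - 0)"
      by (intro tendsto_intros LIMSEQ_ignore_initial_segment[of "\<lambda>n. 1 / real n" 0 2] lim_1_over_n)
    then have X: "X \<longlonglongrightarrow> l" unfolding X_def by simp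
    have "\<xi> \<noteq> 0" using l \<xi> by auto
    from kelvin_lsc[OF u X l this lt] obtain n where n: "u \<xi> < kelvin (X n) u \<xi>"
      by (auto simp: eventually_sequentially)
    have q: "0 < 1 / real (n + 2)" "1 / real (n + 2) < 1" by auto
    have "0 < X n" unfolding X_def using l q by (intro mult_pos_pos) auto
    moreover have "X n < l" unfolding X_def using l q mult_strict_left_mono[of "1 - 1 / real (n
      + 2)" 1 l] by simp
    ultimately show False using S[of "X n"] n \<xi> unfolding above_kelvin_def
      by (meson less_imp_le order_trans not_le)
  qed
qed

text \<open>Carried inside the ball, the strict inequality reads
  \<open>u \<eta> < kelvin l u \<eta>\<close>. It survives small changes of the radius by lower
  semicontinuity alone; outside, upper semicontinuity would be called for. Hence the inner bad sets
  shrink to a null set, and dominated convergence brings their energy below the threshold of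
  \<open>above_kelvin_small\<close>.\<close>

lemma above_kelvin_open:
  assumes u: "solution u" and c: "circle_invariant u" and l: "l > 0"
    and strict: "\<And>\<xi>. l < heis_norm \<xi> \<Longrightarrow> kelvin l u \<xi> < u \<xi>"
  obtains e where "e > 0" "\<And>m. l < m \<Longrightarrow> m < l + e \<Longrightarrow> above_kelvin u m"
proof -
  note [measurable] = solutionD(1)[OF u]
  obtain \<epsilon> where \<epsilon>: "\<epsilon> > 0" "\<And>u l. solution u \<Longrightarrow> circle_invariant u \<Longrightarrow> l > 0 \<Longrightarrow>
    (\<integral>\<^sup>+\<eta>. ennreal (u \<eta> powr (\<sigma> + 1)) * indicator {\<eta>. heis_norm \<eta> < l \<and> kelvin l u \<eta> < u \<eta>} \<eta>
      \<partial>lborel) < ennreal \<epsilon>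
    \<Longrightarrow> above_kelvin u l"
    by (rule above_kelvin_small) blast
  have "\<exists>e>0. \<forall>m. l < m \<and> m < l + e \<longrightarrow> above_kelvin u m"
  proof (rule ccontr)
    assume "\<not> ?thesis"
    then have "\<forall>n. \<exists>m. l < m \<and> m < l + 1 / real (Suc n) \<and> \<not> above_kelvin u m"
      by (metis of_nat_0_less_iff zero_less_Suc zero_less_divide_1_iff)
    then obtain X where Xn: "\<And>n. l < X n" "\<And>n. X n < l
      + 1 / real (Suc n)" "\<And>n. \<not> above_kelvin u (X n)" by metis
    have "(\<lambda>n. l + 1 / real (Suc n)) \<longlonglongrightarrow> l + 0"
      by (intro tendsto_intros LIMSEQ_Suc[of "\<lambda>n. 1 / real n" 0] lim_1_over_n)
    then have lim: "(\<lambda>n. l + 1 / real (Suc n)) \<longlonglongrightarrow> l" by simp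
    have X: "X \<longlonglongrightarrow> l"
    proof (rule tendsto_sandwich[OF _ _ tendsto_const lim])
      show "\<forall>\<^sub>F n in sequentially. l \<le> X n" using Xn(1)
        by (auto intro!: always_eventually less_imp_le)
      show "\<forall>\<^sub>F n in sequentially. X n \<le> l + 1 / real (Suc n)" using Xn(2)
        by (auto intro!: always_eventually less_imp_le)
    qed
    let ?s = "\<lambda>n \<eta>. ennreal (u \<eta> powr (\<sigma> + 1)) * indicator {\<eta>. heis_norm \<eta> < X n \<and> kelvin (X n) u
      \<eta> < u \<eta>} \<eta>"
    have "(\<lambda>n. \<integral>\<^sup>+\<eta>. ?s n \<eta> \<partial>lborel) \<longlonglongrightarrow> (\<integral>\<^sup>+(\<eta> :: 'n heis). 0 \<partial>lborel)"
    proof (rule nn_integral_dominated_convergence)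
      show "(\<integral>\<^sup>+\<eta>. ennreal (u \<eta> powr (\<sigma> + 1)) * indicator {\<eta>. heis_norm \<eta> < l + 1} \<eta> \<partial>lborel) < \<infinity>"
        by (rule solutionD(4)[OF u])
      show "AE \<eta> in lborel. ?s n \<eta> \<le> ennreal (u \<eta> powr (\<sigma> + 1)) * indicator {\<eta>. heis_norm \<eta> < l
        + 1} \<eta>" for n
      proof (rule AE_I2)
        fix \<eta> :: "'n heis"
        have "X n < l + 1" using Xn(2)[of n] by (rule less_le_trans) (simp add: field_simps)
        then show "?s n \<eta> \<le> ennreal (u \<eta> powr (\<sigma> + 1)) * indicator {\<eta>. heis_norm \<eta> < l + 1} \<eta>"
          by (auto simp: indicator_def)
      qed
      show "AE \<eta> in lborel. (\<lambda>n. ?s n \<eta>) \<longlonglongrightarrow> 0"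
        using AE_heis_norm_neq[of l] AE_heis_norm_neq[of 0]
      proof eventually_elim
        case (elim \<eta>)
        then have \<eta>: "\<eta> \<noteq> 0" by auto
        have "\<forall>\<^sub>F n in sequentially. ?s n \<eta> = 0"
        proof (cases "heis_norm \<eta> < l")
          case True
          define \<zeta> where "\<zeta> = hinv l \<eta>"
          have \<zeta>: "\<zeta> \<noteq> 0" "hinv l \<zeta> = \<eta>" using l \<eta>
            by (simp add: \<zeta>_def hinv_def, simp add: \<zeta>_def hinv_hinv)
          have "l < heis_norm \<zeta>"
            using True l \<eta> by (simp add: \<zeta>_def heis_norm_hinv less_divide_eq power2_eq_square)
          then have "kelvin l u (hinv l \<eta>) < u (hinv l \<eta>)" unfolding \<zeta>_def by (rule strict)
          then have "u \<eta> < kelvin l u \<eta>" using kelvin_less_hinv_iff[OF l \<eta>] by simp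
          from kelvin_lsc[OF u X l \<eta> this] show ?thesis by eventually_elim simp
        next
          case False
          with elim have "l < heis_norm \<eta>" by simp
          from order_tendstoD(2)[OF X this] show ?thesis by eventually_elim simp
        qed
        then show ?case by (rule tendsto_eventually)
      qed
    qed measurable
    then have "(\<lambda>n. \<integral>\<^sup>+\<eta>. ?s n \<eta> \<partial>lborel) \<longlonglongrightarrow> 0" by simp
    then have "\<forall>\<^sub>F n in sequentially. (\<integral>\<^sup>+\<eta>. ?s n \<eta> \<partial>lborel) < ennreal \<epsilon>"
      using \<epsilon>(1) by (intro order_tendstoD) auto
    then obtain n where "(\<integral>\<^sup>+\<eta>. ?s n \<eta> \<partial>lborel) < ennreal \<epsilon>" by (auto simp: eventually_sequentially)
    from \<epsilon>(2)[OF u c _ this] Xn(1,3)[of n] l show False by simp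
  qed
  then show thesis using that by blast
qed

text \<open>The energy of \<open>u\<close> is finite on the unit ball, so its integral over
  shrinking balls about \<open>0\<close> falls below the threshold of
  \<open>above_kelvin_small\<close>.\<close>

lemma above_kelvin_start:
  assumes u: "solution u" and c: "circle_invariant u"
  obtains e where "e > 0" "\<And>m. 0 < m \<Longrightarrow> m < e \<Longrightarrow> above_kelvin u m"
proof -
  note [measurable] = solutionD(1)[OF u]
  obtain \<epsilon> where \<epsilon>: "\<epsilon> > 0" "\<And>u l. solution u \<Longrightarrow> circle_invariant u \<Longrightarrow> l > 0 \<Longrightarrow>
    (\<integral>\<^sup>+\<eta>. ennreal (u \<eta> powr (\<sigma> + 1)) * indicator {\<eta>. heis_norm \<eta> < l \<and> kelvin l u \<eta> < u \<eta>} \<eta>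
      \<partial>lborel) < ennreal \<epsilon>
    \<Longrightarrow> above_kelvin u l"
    by (rule above_kelvin_small) blast
  let ?s = "\<lambda>n \<eta>. ennreal (u \<eta> powr (\<sigma> + 1)) * indicator {\<eta>. heis_norm \<eta> < 1 / real (Suc n)} \<eta>"
  have "(\<lambda>n. \<integral>\<^sup>+\<eta>. ?s n \<eta> \<partial>lborel) \<longlonglongrightarrow> (\<integral>\<^sup>+(\<eta> :: 'n heis). 0 \<partial>lborel)"
  proof (rule nn_integral_dominated_convergence)
    show "(\<integral>\<^sup>+\<eta>. ennreal (u \<eta> powr (\<sigma> + 1)) * indicator {\<eta>. heis_norm \<eta> < 1} \<eta> \<partial>lborel) < \<infinity>"
      by (rule solutionD(4)[OF u])
    show "AE \<eta> in lborel. ?s n \<eta> \<le> ennreal (u \<eta> powr (\<sigma> + 1)) * indicator {\<eta>. heis_norm \<eta> < 1} \<eta>"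
      for n
    proof (rule AE_I2)
      fix \<eta> :: "'n heis"
      have "1 / real (Suc n) \<le> 1" by simp
      then have "heis_norm \<eta> < 1" if "heis_norm \<eta> < 1 / real (Suc n)" using that by linarith
      then show "?s n \<eta> \<le> ennreal (u \<eta> powr (\<sigma> + 1)) * indicator {\<eta>. heis_norm \<eta> < 1} \<eta>"
        by (simp add: indicator_def del: of_nat_Suc)
    qed
    show "AE \<eta> in lborel. (\<lambda>n. ?s n \<eta>) \<longlonglongrightarrow> 0"
      using AE_heis_norm_neq[of 0]
    proof eventually_elim
      case (elim \<eta>)
      then have "0 < heis_norm \<eta>" by simp
      from order_tendstoD(2)[OF LIMSEQ_Suc[OF lim_1_over_n] this]
      have "\<forall>\<^sub>F n in sequentially. ?s n \<eta> = 0" by eventually_elim simp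
      then show ?case by (rule tendsto_eventually)
    qed
  qed measurable
  then have "(\<lambda>n. \<integral>\<^sup>+\<eta>. ?s n \<eta> \<partial>lborel) \<longlonglongrightarrow> 0" by simp
  then have "\<forall>\<^sub>F n in sequentially. (\<integral>\<^sup>+\<eta>. ?s n \<eta> \<partial>lborel) < ennreal \<epsilon>"
    using \<epsilon>(1) by (intro order_tendstoD) auto
  then obtain n where n: "(\<integral>\<^sup>+\<eta>. ?s n \<eta> \<partial>lborel) < ennreal \<epsilon>"
    by (auto simp: eventually_sequentially)
  show thesis
  proof (rule that[of "1 / real (Suc n)"])
    fix m assume m: "0 < m" "m < 1 / real (Suc n)"
    have "(\<integral>\<^sup>+\<eta>. ennreal (u \<eta> powr (\<sigma> + 1)) * indicator {\<eta>. heis_norm \<eta> < m \<and> kelvin m u \<eta> < u \<eta>}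
      \<eta> \<partial>lborel) \<le> (\<integral>\<^sup>+\<eta>. ?s n \<eta> \<partial>lborel)"
      using m by (intro nn_integral_mono) (auto simp: indicator_def simp del: of_nat_Suc)
    with n have "(\<integral>\<^sup>+\<eta>. ennreal (u \<eta> powr (\<sigma> + 1))
      * indicator {\<eta>. heis_norm \<eta> < m \<and> kelvin m u \<eta> < u \<eta>} \<eta> \<partial>lborel) < ennreal \<epsilon>"
      by (rule order.strict_trans1[rotated])
    then show "above_kelvin u m" using \<epsilon>(2) u c m by blast
  qed simp
qed

section \<open>Stability of ordered solutions\<close>


definition rescale :: "real \<Rightarrow> ('n heis \<Rightarrow> real) \<Rightarrow> 'n heis \<Rightarrow> real"
  where "rescale R u \<xi> = R powr \<beta> * u (dil R \<xi>)"

lemma power_hdim: "s > 0 \<Longrightarrow> s ^ hdim TYPE('n) = s powr Q" for s :: real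
  by (simp only: Q_nat powr_realpow)

lemma nn_integral_dil_powr:
  fixes f :: "'n heis \<Rightarrow> ennreal"
  assumes "f \<in> borel_measurable borel" and s: "s > 0"
  shows "(\<integral>\<^sup>+\<eta>. f \<eta> \<partial>lborel) = (\<integral>\<^sup>+\<eta>. ennreal (s powr Q) * f (dil s \<eta>) \<partial>lborel)"
proof -
  note [measurable] = assms(1)
  have "(\<integral>\<^sup>+\<eta>. f \<eta> \<partial>lborel) = ennreal (s powr Q) * (\<integral>\<^sup>+\<eta>. f (dil s \<eta>) \<partial>lborel)"
    by (subst nn_integral_dil[OF assms]) (simp only: power_hdim[OF s])
  also have "\<dots> = (\<integral>\<^sup>+\<eta>. ennreal (s powr Q) * f (dil s \<eta>) \<partial>lborel)"
    by (rule nn_integral_cmult[symmetric]) measurable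
  finally show ?thesis .
qed

lemma \<beta>_rels: "\<beta> * (\<sigma> + 1) = Q" "\<beta> * \<sigma> = (Q + \<alpha>) / 2"
proof -
  have "2 * \<beta> = Q - \<alpha>" by (simp add: \<beta>_def)
  then have "2 * (\<beta> * (\<sigma> + 1)) = 2 * Q" "2 * (\<beta> * \<sigma>) = Q + \<alpha>"
    using exponent_rels(5,6) by (metis mult.assoc)+
  then show "\<beta> * (\<sigma> + 1) = Q" "\<beta> * \<sigma> = (Q + \<alpha>) / 2" by auto
qed

text \<open>\<open>\<beta> * (\<sigma> + 1) = Q\<close> matches the weight of the rescaling with the
  Jacobian of the dilation.\<close>

lemma rescale_energy:
  assumes u: "solution u" and R: "R > 0" and [measurable]: "f \<in> borel_measurable borel"
  shows "(\<integral>\<^sup>+\<eta>. ennreal (rescale R u \<eta> powr (\<sigma> + 1)) * f (dil R \<eta>) \<partial>lborel)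
    = (\<integral>\<^sup>+\<eta>. ennreal (u \<eta> powr (\<sigma> + 1)) * f \<eta> \<partial>lborel)"
proof -
  note [measurable] = solutionD(1)[OF u]
  have "rescale R u \<eta> powr (\<sigma> + 1) = R powr Q * u (dil R \<eta>) powr (\<sigma> + 1)" for \<eta>
    using solutionD(2)[OF u] R by (simp add: rescale_def powr_mult powr_powr \<beta>_rels)
  then have "(\<integral>\<^sup>+\<eta>. ennreal (rescale R u \<eta> powr (\<sigma> + 1)) * f (dil R \<eta>) \<partial>lborel)
      = (\<integral>\<^sup>+\<eta>. ennreal (R powr Q) * (ennreal (u (dil R \<eta>) powr (\<sigma> + 1)) * f (dil R \<eta>)) \<partial>lborel)"
    by (simp add: ennreal_mult' mult.assoc)
  also have "\<dots> = (\<integral>\<^sup>+\<eta>. ennreal (u \<eta> powr (\<sigma> + 1)) * f \<eta> \<partial>lborel)"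
    by (rule nn_integral_dil_powr[OF _ R, symmetric]) measurable
  finally show ?thesis .
qed

lemma solution_rescale:
  assumes u: "solution u" and R: "R > 0"
  shows "solution (rescale R u)"
  unfolding solution_def
proof (intro conjI allI)
  note [measurable] = solutionD(1)[OF u]
  show "rescale R u \<in> borel_measurable borel" unfolding rescale_def by measurable
  show "0 \<le> rescale R u \<xi>" for \<xi> using solutionD(2)[OF u] by (simp add: rescale_def)
  show "ennreal (rescale R u \<xi>) = (\<integral>\<^sup>+\<eta>. kern \<xi> \<eta> * ennreal (rescale R u \<eta> powr \<sigma>) \<partial>lborel)" for \<xi>
  proof -
    have "ennreal (rescale R u \<xi>) = ennreal (R powr \<beta>) * ennreal (u (dil R \<xi>))"
      by (simp add: rescale_def ennreal_mult')
    also have "ennreal (u (dil R \<xi>)) = (\<integral>\<^sup>+\<eta>. kern (dil R \<xi>) \<eta> * ennreal (u \<eta> powr \<sigma>) \<partial>lborel)"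
      by (rule solutionD(3)[OF u])
    also have "\<dots> = (\<integral>\<^sup>+\<eta>. ennreal (R powr Q) * (kern (dil R \<xi>) (dil R \<eta>)
      * ennreal (u (dil R \<eta>) powr \<sigma>)) \<partial>lborel)"
      by (rule nn_integral_dil_powr[OF _ R]) measurable
    also have "ennreal (R powr \<beta>) * \<dots> = (\<integral>\<^sup>+\<eta>. ennreal (R powr \<beta>) * (ennreal (R powr Q)
      * (kern (dil R \<xi>) (dil R \<eta>) * ennreal (u (dil R \<eta>) powr \<sigma>))) \<partial>lborel)"
      by (rule nn_integral_cmult[symmetric]) measurable
    also have "\<dots> = (\<integral>\<^sup>+\<eta>. kern \<xi> \<eta> * ennreal (rescale R u \<eta> powr \<sigma>) \<partial>lborel)"
    proof (rule nn_integral_cong)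
      fix \<eta> :: "'n heis"
      have 1: "hdist (dil R \<xi>) (dil R \<eta>) powr - (Q - \<alpha>)
        = R powr - (Q - \<alpha>) * hdist \<xi> \<eta> powr - (Q - \<alpha>)"
        using R by (simp add: hdist_dil powr_mult)
      have 2: "rescale R u \<eta> powr \<sigma> = R powr ((Q + \<alpha>) / 2) * u (dil R \<eta>) powr \<sigma>"
        using solutionD(2)[OF u] R by (simp add: rescale_def powr_mult powr_powr \<beta>_rels)
      have "R powr \<beta> * (R powr Q * R powr - (Q - \<alpha>)) = R powr (\<beta> + (Q + - (Q - \<alpha>)))"
        by (simp only: powr_add)
      also have "\<beta> + (Q + - (Q - \<alpha>)) = (Q + \<alpha>) / 2" by (simp add: \<beta>_def field_simps)
      finally have 3: "R powr ((Q + \<alpha>) / 2) = R powr \<beta> * (R powr Q * R powr - (Q - \<alpha>))" ..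
      have 4: "R powr \<beta> * (R powr Q * (hdist (dil R \<xi>) (dil R \<eta>) powr - (Q - \<alpha>)
        * u (dil R \<eta>) powr \<sigma>))
        = hdist \<xi> \<eta> powr - (Q - \<alpha>) * rescale R u \<eta> powr \<sigma>"
        unfolding 1 2 3 by (simp only: ac_simps)
      show "ennreal (R powr \<beta>) * (ennreal (R powr Q) * (kern (dil R \<xi>) (dil R \<eta>)
        * ennreal (u (dil R \<eta>) powr \<sigma>)))
        = kern \<xi> \<eta> * ennreal (rescale R u \<eta> powr \<sigma>)"
        unfolding kern_def by (simp only: ennreal_mult'[symmetric] powr_ge_zero 4)
    qed
    finally show ?thesis .
  qed
  show "(\<integral>\<^sup>+\<eta>. ennreal (rescale R u \<eta> powr (\<sigma> + 1))
    * indicator {\<eta>. heis_norm \<eta> < r} \<eta> \<partial>lborel) < \<infinity>" for r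
  proof -
    have "(\<integral>\<^sup>+\<eta>. ennreal (rescale R u \<eta> powr (\<sigma> + 1)) * indicator {\<eta>. heis_norm \<eta> < r} \<eta> \<partial>lborel)
        = (\<integral>\<^sup>+\<eta>. ennreal (rescale R u \<eta> powr (\<sigma> + 1)) * indicator {\<eta>. heis_norm \<eta> < R
          * r} (dil R \<eta>) \<partial>lborel)"
      using R by (intro nn_integral_cong) (auto simp: indicator_def)
    also have "\<dots> = (\<integral>\<^sup>+\<eta>. ennreal (u \<eta> powr (\<sigma> + 1)) * indicator {\<eta>. heis_norm \<eta> < R
      * r} \<eta> \<partial>lborel)"
      by (rule rescale_energy[OF u R]) measurable
    finally show ?thesis using solutionD(4)[OF u] by simp
  qed
qed

text \<open>A strong maximum principle: the kernel is positive off the diagonal, so equality of the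
  potentials at one point forces the densities, and with them all potentials, to agree.\<close>

lemma solution_eq_if_le_touch:
  assumes u: "solution u" and v: "solution v" and le: "\<And>\<xi>. u \<xi> \<le> v \<xi>" and eq: "u \<xi> = v \<xi>"
  shows "u \<zeta> = v \<zeta>"
proof -
  note [measurable] = solutionD(1)[OF u] solutionD(1)[OF v]
  have pw: "u \<eta> powr \<sigma> \<le> v \<eta> powr \<sigma>" for \<eta>
    using le solutionD(2)[OF u] \<sigma>_gt_1 by (intro powr_mono2) auto
  have "AE \<eta> in lborel. kern \<xi> \<eta> * ennreal (u \<eta> powr \<sigma>) = kern \<xi> \<eta> * ennreal (v \<eta> powr \<sigma>)"
  proof (rule nn_integral_eq_imp_AE_eq)
    show "AE \<eta> in lborel. kern \<xi> \<eta> * ennreal (u \<eta> powr \<sigma>) \<le> kern \<xi> \<eta> * ennreal (v \<eta> powr \<sigma>)"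
      using pw by (intro AE_I2 mult_left_mono ennreal_leI) auto
    show "(\<integral>\<^sup>+\<eta>. kern \<xi> \<eta> * ennreal (v \<eta> powr \<sigma>) \<partial>lborel)
      = (\<integral>\<^sup>+\<eta>. kern \<xi> \<eta> * ennreal (u \<eta> powr \<sigma>) \<partial>lborel)"
      by (simp only: solutionD(3)[OF u, symmetric] solutionD(3)[OF v, symmetric] eq)
    show "(\<integral>\<^sup>+\<eta>. kern \<xi> \<eta> * ennreal (u \<eta> powr \<sigma>) \<partial>lborel) \<noteq> \<infinity>"
      by (simp add: solutionD(3)[OF u, symmetric])
  qed measurable
  moreover have "AE \<eta> in lborel. \<eta> \<noteq> \<xi>" by (rule AE_lborel_singleton)
  ultimately have AE_eq: "AE \<eta> in lborel. u \<eta> powr \<sigma> = v \<eta> powr \<sigma>"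
  proof eventually_elim
    case (elim \<eta>)
    then have "kern \<xi> \<eta> \<noteq> 0" "kern \<xi> \<eta> \<noteq> top" by (auto simp: kern_def)
    with elim show ?case by (auto simp: ennreal_mult_cancel_left)
  qed
  have "ennreal (u \<zeta>) = ennreal (v \<zeta>)"
    unfolding solutionD(3)[OF u, of \<zeta>] solutionD(3)[OF v, of \<zeta>]
    by (rule nn_integral_cong_AE) (use AE_eq in eventually_elim, simp)
  then show ?thesis using solutionD(2)[OF u] solutionD(2)[OF v] by simp
qed

section \<open>A cutoff on the unit ball and the energy bound\<close>

definition hcut :: "'n heis \<Rightarrow> real"
  where "hcut \<xi> = max 0 (1 - heis_norm \<xi>)"

text \<open>Large enough for \<open>hcut ^ (2 * cut_exp)\<close> to absorb the factor
  \<open>hcut powr - (Q - \<alpha>)\<close> that arises away from the diagonal, and a natural number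
  so that Bernoulli's inequality applies near it.\<close>

definition cut_exp :: nat where "cut_exp = nat \<lceil>Q\<rceil>"

lemma cut_exp: "Q \<le> real cut_exp" "cut_exp > 0"
  using Q_pos by (auto simp: cut_exp_def) 

lemma heis_norm_le_hdist: "heis_norm \<eta> \<le> heis_norm \<xi> + hdist \<xi> \<eta>"
  using hdist_triangle[of 0 \<eta> \<xi>] by simp

lemma hcut_props: "0 \<le> hcut \<xi>" "hcut \<xi> \<le> 1" "hcut \<xi> > 0 \<longleftrightarrow> heis_norm \<xi> < 1"
  "hcut \<xi> - hdist \<xi> \<eta> \<le> hcut \<eta>"
proof -
  show "hcut \<xi> - hdist \<xi> \<eta> \<le> hcut \<eta>"
    unfolding hcut_def using heis_norm_le_hdist[of \<eta> \<xi>] hdist_nonneg[of \<xi> \<eta>] by linarith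
qed (auto simp: hcut_def max_def)

lemma borel_measurable_hcut [measurable]: "hcut \<in> borel_measurable borel"
  unfolding hcut_def by measurable

text \<open>The kernel is at least \<open>c\<close> on the unit ball, so the integral \<open>J\<close> of \<open>w powr \<sigma>\<close> over this ball
  satisfies \<open>unit_vol * (c * J) powr \<sigma> \<le> J\<close>, which bounds \<open>J\<close> because \<open>\<sigma> > 1\<close>.\<close>

lemma solution_unit_ball:
  obtains C m0 where "C > 0" "m0 > 0"
    "\<And>w. solution w \<Longrightarrow> (\<integral>\<^sup>+\<eta>. ennreal (w \<eta> powr \<sigma>) * indicator {\<eta>. heis_norm \<eta> < 1} \<eta> \<partial>lborel)
      \<le> ennreal C"
    "\<And>w. solution w \<Longrightarrow> \<exists>\<xi>. heis_norm \<xi> < 1 \<and> w \<xi> \<le> m0"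
proof -
  let ?B = "{\<eta> :: 'n heis. heis_norm \<eta> < 1}"
  \<comment> \<open>Two points of the unit ball are at distance at most \<open>2\<close>, so
    \<open>c\<close> bounds the kernel from below there.\<close>
  define c where "c = 2 powr - (Q - \<alpha>)"
  have c: "c > 0" by (simp add: c_def)
  define C where "C = (1 / (unit_vol * c powr \<sigma>)) powr (1 / (\<sigma> - 1))"
  \<comment> \<open>If \<open>w\<close> exceeded \<open>m0\<close> on the whole ball, the integral
    of \<open>w powr \<sigma>\<close> would be at least
    \<open>unit_vol * m0 powr \<sigma> = C + 1\<close>.\<close>
  define m0 where "m0 = ((C + 1) / unit_vol) powr (1 / \<sigma>)"
  have s1: "\<sigma> > 1" and V: "unit_vol > 0" by (rule \<sigma>_gt_1 unit_vol_pos)+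
  have C: "C > 0" using V c by (simp add: C_def)
  have m0: "m0 > 0" using V C by (simp add: m0_def)
  have volB: "emeasure lborel ?B = ennreal unit_vol" using emeasure_hball[of 1 0] by simp
  have J: "(\<integral>\<^sup>+\<eta>. ennreal (w \<eta> powr \<sigma>) * indicator ?B \<eta> \<partial>lborel)
    \<le> ennreal C" if w: "solution w" for w
  proof -
    note [measurable] = solutionD(1)[OF w]
    let ?J = "\<integral>\<^sup>+\<eta>. ennreal (w \<eta> powr \<sigma>) * indicator ?B \<eta> \<partial>lborel"
    have low: "ennreal c * ?J \<le> ennreal (w \<xi>)" if \<xi>: "heis_norm \<xi> < 1" for \<xi>
    proof -
      have "ennreal c * ?J = (\<integral>\<^sup>+\<eta>. ennreal c * (ennreal (w \<eta> powr \<sigma>) * indicator ?B \<eta>) \<partial>lborel)"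
        by (rule nn_integral_cmult[symmetric]) measurable
      also have "\<dots> \<le> (\<integral>\<^sup>+\<eta>. kern \<xi> \<eta> * ennreal (w \<eta> powr \<sigma>) \<partial>lborel)"
      proof (rule nn_integral_mono_AE)
        have "AE \<eta> in lborel. \<eta> \<noteq> \<xi>" by (rule AE_lborel_singleton)
        then show "AE \<eta> in lborel. ennreal c * (ennreal (w \<eta> powr \<sigma>) * indicator ?B \<eta>)
          \<le> kern \<xi> \<eta> * ennreal (w \<eta> powr \<sigma>)"
        proof eventually_elim
          case (elim \<eta>)
          show ?case
          proof (cases "heis_norm \<eta> < 1")
            case True
            have "hdist \<xi> \<eta> \<le> heis_norm \<xi> + heis_norm \<eta>" using hdist_triangle[of \<xi> \<eta> 0] by simp
            then have "hdist \<xi> \<eta> \<le> 2" using \<xi> True by simp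
            moreover have "hdist \<xi> \<eta> > 0" using elim by simp
            ultimately have "c \<le> hdist \<xi> \<eta> powr - (Q - \<alpha>)"
              unfolding c_def using \<alpha>_less by (intro powr_mono2') auto
            then show ?thesis using True by (simp add: kern_def mult_right_mono ennreal_leI)
          qed simp
        qed
      qed
      finally show ?thesis by (simp only: solutionD(3)[OF w, symmetric])
    qed
    have "ennreal c * ?J < \<infinity>" using low[of 0] by (auto intro: order_le_less_trans)
    then have "?J < \<infinity>" using c by (auto simp: ennreal_mult_less_top)
    then obtain j where j: "?J = ennreal j" "j \<ge> 0" by (cases ?J) auto
    have "ennreal (unit_vol * (c * j) powr \<sigma>) = (\<integral>\<^sup>+\<eta>. ennreal ((c * j) powr \<sigma>)
      * indicator ?B \<eta> \<partial>lborel)"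
      using V by (subst nn_integral_cmult_indicator) (auto simp: volB mult.commute ennreal_mult')
    also have "\<dots> \<le> ?J"
    proof (rule nn_integral_mono)
      fix \<xi> :: "'n heis"
      show "ennreal ((c * j) powr \<sigma>) * indicator ?B \<xi> \<le> ennreal (w \<xi> powr \<sigma>) * indicator ?B \<xi>"
      proof (cases "heis_norm \<xi> < 1")
        case True
        from low[OF this] have "c * j \<le> w \<xi>"
          using c j solutionD(2)[OF w] by (simp flip: ennreal_mult')
        then have "(c * j) powr \<sigma> \<le> w \<xi> powr \<sigma>" using c j s1 by (intro powr_mono2) auto
        then show ?thesis using True by (simp add: ennreal_leI)
      qed simp
    qed
    finally have "unit_vol * (c * j) powr \<sigma> \<le> j" using j V by simp
    have "j \<le> C"
    proof (cases "j = 0")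
      case False
      then have jp: "j > 0" using j by simp
      have "unit_vol * c powr \<sigma> * (j powr (\<sigma> - 1) * j) \<le> j"
        using \<open>unit_vol * (c * j) powr \<sigma> \<le> j\<close> c jp by (simp add: powr_mult powr_diff)
      then have "(unit_vol * c powr \<sigma> * j powr (\<sigma> - 1)) * j \<le> 1 * j" by (simp add: mult.assoc)
      then have "unit_vol * c powr \<sigma> * j powr (\<sigma> - 1) \<le> 1" using jp by (rule mult_right_le_imp_le)
      then have "j powr (\<sigma> - 1) \<le> 1 / (unit_vol * c powr \<sigma>)" using V c by (simp add: field_simps)
      then have "(j powr (\<sigma> - 1)) powr (1 / (\<sigma> - 1)) \<le> C"
        unfolding C_def using s1 by (intro powr_mono2) auto
      then show ?thesis using jp s1 by (simp add: powr_powr)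
    qed (use C in simp)
    then show ?thesis by (simp add: j ennreal_leI)
  qed
  have "\<exists>\<xi>. heis_norm \<xi> < 1 \<and> w \<xi> \<le> m0" if w: "solution w" for w
  proof (rule ccontr)
    assume "\<not> ?thesis"
    then have big: "m0 < w \<xi>" if "heis_norm \<xi> < 1" for \<xi> using that by (meson not_le)
    have "ennreal (C + 1) = ennreal (unit_vol * m0 powr \<sigma>)"
      using V C s1 by (simp add: m0_def powr_powr)
    also have "\<dots> = (\<integral>\<^sup>+\<eta>. ennreal (m0 powr \<sigma>) * indicator ?B \<eta> \<partial>lborel)"
      using V by (subst nn_integral_cmult_indicator) (auto simp: volB mult.commute ennreal_mult')
    also have "\<dots> \<le> (\<integral>\<^sup>+\<eta>. ennreal (w \<eta> powr \<sigma>) * indicator ?B \<eta> \<partial>lborel)"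
    proof (rule nn_integral_mono)
      fix \<xi> :: "'n heis"
      show "ennreal (m0 powr \<sigma>) * indicator ?B \<xi> \<le> ennreal (w \<xi> powr \<sigma>) * indicator ?B \<xi>"
        using big[of \<xi>] m0 s1 by (auto simp: indicator_def intro!: ennreal_leI powr_mono2)
    qed
    also have "\<dots> \<le> ennreal C" by (rule J[OF w])
    finally show False using C by simp
  qed
  with C m0 J show thesis by (intro that)
qed

text \<open>A solution lying strictly below another one is stable: \<open>v - w\<close> is a positive supersolution
  of the linearised equation, so the Schur test bounds the linearised operator by \<open>1 / \<sigma>\<close>.\<close>

lemma solution_stable:
  fixes h :: "'n heis \<Rightarrow> real"
  assumes w: "solution w" and v: "solution v" and lt: "\<And>\<xi>. w \<xi> < v \<xi>"
    and [measurable]: "h \<in> borel_measurable borel" and h0: "\<And>\<xi>. 0 \<le> h \<xi>"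
  shows "ennreal \<sigma> * (\<integral>\<^sup>+\<xi>. \<integral>\<^sup>+\<eta>. kern \<xi> \<eta> * ennreal (w \<xi> powr \<sigma> * h \<xi> * (w \<eta> powr \<sigma>
    * h \<eta>)) \<partial>lborel \<partial>lborel)
    \<le> (\<integral>\<^sup>+\<xi>. ennreal (w \<xi> powr (\<sigma> + 1) * (h \<xi>)\<^sup>2) \<partial>lborel)"
proof -
  note [measurable] = solutionD(1)[OF w] solutionD(1)[OF v]
  have w0: "0 \<le> w \<xi>" for \<xi> by (rule solutionD(2)[OF w])
  have s1: "\<sigma> > 1" by (rule \<sigma>_gt_1)
  define \<phi> where "\<phi> \<xi> = v \<xi> - w \<xi>" for \<xi>
  have \<phi>: "\<phi> \<xi> > 0" for \<xi> using lt by (simp add: \<phi>_def)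
  define \<omega> where "\<omega> \<xi> = w \<xi> powr (\<sigma> - 1)" for \<xi>
  have \<omega>0: "0 \<le> \<omega> \<xi>" for \<xi> by (simp add: \<omega>_def)
  have [measurable]: "\<phi> \<in> borel_measurable borel" "\<omega> \<in> borel_measurable borel"
    unfolding \<phi>_def \<omega>_def by measurable
  have w\<sigma>: "w \<xi> powr \<sigma> = \<omega> \<xi> * w \<xi>" "w \<xi> powr (\<sigma> + 1) = \<omega> \<xi> * (w \<xi>)\<^sup>2" for \<xi>
    using w0[of \<xi>] by (cases "w \<xi> = 0"; simp add: \<omega>_def powr_diff powr_add power2_eq_square)+
  \<comment> \<open>The two Schur densities: \<open>E * \<phi>\<close> is the integrand on the right
    of the claim, and \<open>e\<close> is the linearised potential applied to \<open>\<phi>\<close>,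
    up to the factor \<open>\<sigma>\<close>.\<close>
  define E where "E \<xi> = \<omega> \<xi> * (w \<xi> * h \<xi>)\<^sup>2 / \<phi> \<xi>" for \<xi>
  have E0: "0 \<le> E \<xi>" for \<xi> using \<phi>[of \<xi>] \<omega>0 by (simp add: E_def)
  define e where "e \<xi> = \<omega> \<xi> * \<phi> \<xi>" for \<xi>
  have e0: "0 \<le> e \<xi>" for \<xi> using \<phi>[of \<xi>] \<omega>0[of \<xi>] by (simp add: e_def)
  have [measurable]: "E \<in> borel_measurable borel" "e \<in> borel_measurable borel"
    unfolding E_def e_def by measurable
  \<comment> \<open>Convexity gives
    \<open>v powr \<sigma> \<ge> w powr \<sigma> + \<sigma> * e\<close>; integrating against the
    kernel and cancelling the finite number \<open>w \<xi>\<close> shows that \<open>\<phi>\<close>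
    is a supersolution.\<close>
  have T: "ennreal \<sigma> * (\<integral>\<^sup>+\<eta>. kern \<xi> \<eta> * ennreal (e \<eta>) \<partial>lborel) \<le> ennreal (\<phi> \<xi>)" for \<xi>
  proof -
    have "ennreal (w \<xi>) + ennreal \<sigma> * (\<integral>\<^sup>+\<eta>. kern \<xi> \<eta> * ennreal (e \<eta>) \<partial>lborel)
        = (\<integral>\<^sup>+\<eta>. kern \<xi> \<eta> * ennreal (w \<eta> powr \<sigma>) + ennreal \<sigma> * (kern \<xi> \<eta> * ennreal (e \<eta>)) \<partial>lborel)"
      unfolding solutionD(3)[OF w, of \<xi>] by (simp add: nn_integral_add nn_integral_cmult)
    also have "\<dots> \<le> (\<integral>\<^sup>+\<eta>. kern \<xi> \<eta> * ennreal (v \<eta> powr \<sigma>) \<partial>lborel)"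
    proof (rule nn_integral_mono)
      fix \<eta>
      have "w \<eta> powr \<sigma> + \<sigma> * e \<eta> \<le> v \<eta> powr \<sigma>"
        using powr_diff_le(2)[of "w \<eta>" "v \<eta>" \<sigma>] w0 lt[of \<eta>] s1
          by (simp add: e_def \<omega>_def \<phi>_def ac_simps)
      then have "kern \<xi> \<eta> * ennreal (w \<eta> powr \<sigma> + \<sigma> * e \<eta>) \<le> kern \<xi> \<eta> * ennreal (v \<eta> powr \<sigma>)"
        by (intro mult_left_mono ennreal_leI) auto
      also have "ennreal (w \<eta> powr \<sigma> + \<sigma> * e \<eta>) = ennreal (w \<eta> powr \<sigma>) + ennreal \<sigma> * ennreal (e \<eta>)"
        using s1 e0 by (simp add: ennreal_mult)
      finally show "kern \<xi> \<eta> * ennreal (w \<eta> powr \<sigma>) + ennreal \<sigma> * (kern \<xi> \<eta> * ennreal (e \<eta>))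
        \<le> kern \<xi> \<eta> * ennreal (v \<eta> powr \<sigma>)"
        by (simp add: distrib_left ac_simps)
    qed
    also have "\<dots> = ennreal (w \<xi>) + ennreal (\<phi> \<xi>)"
      using w0[of \<xi>] \<phi>[of \<xi>] by (simp add: solutionD(3)[OF v, symmetric] \<phi>_def flip: ennreal_plus)
    finally show ?thesis by (simp add: ennreal_add_left_cancel_le)
  qed
  let ?S = "\<integral>\<^sup>+\<xi>. \<integral>\<^sup>+\<eta>. kern \<xi> \<eta> * ennreal (w \<xi> powr \<sigma> * h \<xi> * (w \<eta> powr \<sigma> * h \<eta>)) \<partial>lborel \<partial>lborel"
  let ?X = "\<integral>\<^sup>+\<xi>. ennreal (w \<xi> powr (\<sigma> + 1) * (h \<xi>)\<^sup>2) \<partial>lborel"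
  let ?k = "\<lambda>\<xi> \<eta>. kern \<xi> \<eta> * (ennreal (E \<xi>) * ennreal (e \<eta>))"
  \<comment> \<open>The inequality \<open>2 A B \<le> A^2 \<phi>(\<eta>) / \<phi>(\<xi>) + B^2
    \<phi>(\<xi>) / \<phi>(\<eta>)\<close>, weighted by \<open>\<omega>\<close> at both points. The
    two summands have equal double integrals, as the kernel is symmetric.\<close>
  have amgm: "2 * (w \<xi> powr \<sigma> * h \<xi> * (w \<eta> powr \<sigma> * h \<eta>)) \<le> E \<xi> * e \<eta> + E \<eta> * e \<xi>" for \<xi> \<eta>
  proof -
    define A where "A = w \<xi> * h \<xi>"
    define B where "B = w \<eta> * h \<eta>"
    have "0 \<le> (A * \<phi> \<eta> - B * \<phi> \<xi>)\<^sup>2" by simp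
    then have "2 * (A * B) * (\<phi> \<xi> * \<phi> \<eta>) \<le> A\<^sup>2 * (\<phi> \<eta>)\<^sup>2 + B\<^sup>2 * (\<phi> \<xi>)\<^sup>2"
      by (simp add: power2_eq_square algebra_simps)
    then have "2 * (A * B) \<le> (A\<^sup>2 * (\<phi> \<eta>)\<^sup>2 + B\<^sup>2 * (\<phi> \<xi>)\<^sup>2) / (\<phi> \<xi> * \<phi> \<eta>)"
      using \<phi>[of \<xi>] \<phi>[of \<eta>] by (simp add: pos_le_divide_eq)
    also have "\<dots> = A\<^sup>2 / \<phi> \<xi> * \<phi> \<eta> + B\<^sup>2 / \<phi> \<eta> * \<phi> \<xi>"
      using \<phi>[of \<xi>] \<phi>[of \<eta>] by (simp add: field_simps power2_eq_square)
    finally have "\<omega> \<xi> * \<omega> \<eta> * (2 * (A * B)) \<le> \<omega> \<xi> * \<omega> \<eta> * (A\<^sup>2 / \<phi> \<xi> * \<phi> \<eta> + B\<^sup>2 / \<phi> \<eta> * \<phi> \<xi>)"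
      using \<omega>0 by (intro mult_left_mono) auto
    also have "\<dots> = E \<xi> * e \<eta> + E \<eta> * e \<xi>"
      by (simp add: E_def e_def A_def B_def power_mult_distrib algebra_simps)
    also have "\<omega> \<xi> * \<omega> \<eta> * (2 * (A * B)) = 2 * (w \<xi> powr \<sigma> * h \<xi> * (w \<eta> powr \<sigma> * h \<eta>))"
      unfolding w\<sigma> A_def B_def by (simp only: ac_simps)
    finally show ?thesis .
  qed
  have "2 * ?S = (\<integral>\<^sup>+\<xi>. \<integral>\<^sup>+\<eta>. 2 * (kern \<xi> \<eta> * ennreal (w \<xi> powr \<sigma> * h \<xi> * (w \<eta> powr \<sigma>
    * h \<eta>))) \<partial>lborel \<partial>lborel)"
    by (simp add: nn_integral_cmult)
  also have "\<dots> \<le> (\<integral>\<^sup>+\<xi>. \<integral>\<^sup>+\<eta>. ?k \<xi> \<eta> + ?k \<eta> \<xi> \<partial>lborel \<partial>lborel)"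
  proof (intro nn_integral_mono)
    fix \<xi> \<eta>
    have "kern \<xi> \<eta> * ennreal (2 * (w \<xi> powr \<sigma> * h \<xi> * (w \<eta> powr \<sigma> * h \<eta>)))
      \<le> kern \<xi> \<eta> * ennreal (E \<xi> * e \<eta> + E \<eta> * e \<xi>)"
      by (intro mult_left_mono ennreal_leI amgm) auto
    also have "\<dots> = ?k \<xi> \<eta> + ?k \<eta> \<xi>"
      using E0 e0 by (simp add: kern_commute[of \<eta>] ennreal_mult distrib_left)
    finally show "2 * (kern \<xi> \<eta> * ennreal (w \<xi> powr \<sigma> * h \<xi> * (w \<eta> powr \<sigma> * h \<eta>)))
      \<le> ?k \<xi> \<eta> + ?k \<eta> \<xi>"
      by (simp only: ennreal_mult' ennreal_numeral mult.left_commute zero_le_numeral)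
  qed
  also have "\<dots> = (\<integral>\<^sup>+\<xi>. \<integral>\<^sup>+\<eta>. ?k \<xi> \<eta> \<partial>lborel \<partial>lborel) + (\<integral>\<^sup>+\<xi>. \<integral>\<^sup>+\<eta>. ?k \<eta> \<xi> \<partial>lborel \<partial>lborel)"
    by (simp add: nn_integral_add)
  also have "(\<integral>\<^sup>+\<xi>. \<integral>\<^sup>+\<eta>. ?k \<eta> \<xi> \<partial>lborel \<partial>lborel) = (\<integral>\<^sup>+\<eta>. \<integral>\<^sup>+\<xi>. ?k \<eta> \<xi> \<partial>lborel \<partial>lborel)"
    by (rule lborel_pair.Fubini') measurable
  also have "(\<integral>\<^sup>+\<xi>. \<integral>\<^sup>+\<eta>. ?k \<xi> \<eta> \<partial>lborel \<partial>lborel) + \<dots> = 2 * (\<integral>\<^sup>+\<xi>. \<integral>\<^sup>+\<eta>. ?k \<xi> \<eta> \<partial>lborel \<partial>lborel)"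
    by (rule mult_2[symmetric])
  finally have "?S \<le> (\<integral>\<^sup>+\<xi>. \<integral>\<^sup>+\<eta>. ?k \<xi> \<eta> \<partial>lborel \<partial>lborel)"
    by (subst (asm) ennreal_mult_le_mult_iff) auto
  then have "ennreal \<sigma> * ?S \<le> ennreal \<sigma> * (\<integral>\<^sup>+\<xi>. \<integral>\<^sup>+\<eta>. ?k \<xi> \<eta> \<partial>lborel \<partial>lborel)"
    by (rule mult_left_mono) simp
  also have "\<dots> = (\<integral>\<^sup>+\<xi>. ennreal (E \<xi>) * (ennreal \<sigma> * (\<integral>\<^sup>+\<eta>. kern \<xi> \<eta>
    * ennreal (e \<eta>) \<partial>lborel)) \<partial>lborel)"
    by (simp add: nn_integral_cmult[symmetric] ac_simps)
  also have "\<dots> \<le> (\<integral>\<^sup>+\<xi>. ennreal (E \<xi>) * ennreal (\<phi> \<xi>) \<partial>lborel)"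
    by (intro nn_integral_mono mult_left_mono T) auto
  also have "\<dots> = ?X"
  proof (rule nn_integral_cong)
    fix \<xi>
    have "E \<xi> * \<phi> \<xi> = w \<xi> powr (\<sigma> + 1) * (h \<xi>)\<^sup>2"
      using \<phi>[of \<xi>] unfolding w\<sigma> by (simp add: E_def power_mult_distrib)
    then show "ennreal (E \<xi>) * ennreal (\<phi> \<xi>) = ennreal (w \<xi> powr (\<sigma> + 1) * (h \<xi>)\<^sup>2)"
      using E0 by (simp flip: ennreal_mult')
  qed
  finally show ?thesis .
qed


text \<open>If \<open>\<eta>\<close> is far from \<open>\<xi>\<close> on the scale
  \<open>\<delta> * hcut \<xi>\<close>, its distance to any \<open>\<xi>0\<close> in the unit ball
  exceeds its distance to \<open>\<xi>\<close> by less than \<open>2\<close>, and so is at most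
  \<open>3 / (\<delta> * hcut \<xi>)\<close> times the latter. The power of \<open>hcut\<close>
  removes the dependence on \<open>\<xi>\<close>. At \<open>\<eta> = \<xi>0\<close> the right side
  has the value \<open>0\<close>, hence the exclusion.\<close>

lemma kern_far_le:
  assumes \<xi>: "heis_norm \<xi> < 1" and \<xi>0: "heis_norm \<xi>0 < 1" and \<delta>: "0 < \<delta>" "\<delta> \<le> 1"
    and far: "\<delta> * hcut \<xi> < hdist \<xi> \<eta>" and ne: "\<eta> \<noteq> \<xi>0"
  shows "kern \<xi> \<eta> * ennreal (hcut \<xi> ^ (2 * cut_exp)) \<le> ennreal ((3 / \<delta>) powr (Q - \<alpha>)) * kern \<xi>0 \<eta>"
proof -
  define d where "d = hdist \<xi> \<eta>"
  define r where "r = hcut \<xi>"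
  have r: "0 < r" "r \<le> 1" using hcut_props(2,3)[of \<xi>] \<xi> by (auto simp: r_def)
  have d: "\<delta> * r < d" using far by (simp add: d_def r_def)
  have \<delta>r: "0 < \<delta> * r" "\<delta> * r \<le> 1" using \<delta> r by (auto intro: mult_le_one)
  have dp: "0 < d" using d \<delta>r by linarith
  define D where "D = hdist \<xi>0 \<eta>"
  have D: "D > 0" using ne by (simp add: D_def)
  have "D \<le> 2 + d"
    using hdist_triangle[of \<xi>0 \<eta> \<xi>] hdist_triangle[of \<xi>0 \<xi> 0] \<xi> \<xi>0 by (simp add: D_def d_def)
  then have "\<delta> * r * D \<le> \<delta> * r * (2 + d)" using \<delta>r by (intro mult_left_mono) auto
  also have "\<dots> = 2 * (\<delta> * r) + \<delta> * r * d" by (simp add: algebra_simps)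
  also have "\<dots> \<le> 2 * d + 1 * d" using d \<delta>r dp by (intro add_mono mult_right_mono) auto
  finally have "\<delta> * r / 3 * D \<le> d" by simp
  then have "d powr - (Q - \<alpha>) \<le> (\<delta> * r / 3 * D) powr - (Q - \<alpha>)"
    using \<delta>r D \<alpha>_less by (intro powr_mono2') auto
  also have "\<dots> = (3 / \<delta>) powr (Q - \<alpha>) * r powr - (Q - \<alpha>) * D powr - (Q - \<alpha>)"
  proof -
    have "\<delta> * r / 3 * D = (\<delta> / 3) * r * D" by simp
    moreover have "(\<delta> / 3) powr - (Q - \<alpha>) = (3 / \<delta>) powr (Q - \<alpha>)"
      unfolding powr_minus using \<delta> by (simp add: powr_divide)
    ultimately show ?thesis using \<delta> r D by (simp only: powr_mult)
  qed
  finally have "d powr - (Q - \<alpha>) * r ^ (2 * cut_exp)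
    \<le> (3 / \<delta>) powr (Q - \<alpha>) * r powr - (Q - \<alpha>) * D powr - (Q - \<alpha>) * r ^ (2 * cut_exp)"
    using r by (intro mult_right_mono) auto
  also have "\<dots> = (3 / \<delta>) powr (Q - \<alpha>) * D powr - (Q - \<alpha>) * (r powr - (Q - \<alpha>) * r ^ (2 * cut_exp))"
    by (simp only: ac_simps)
  also have "\<dots> \<le> (3 / \<delta>) powr (Q - \<alpha>) * D powr - (Q - \<alpha>) * 1"
  proof (intro mult_left_mono)
    have "r powr - (Q - \<alpha>) * r ^ (2 * cut_exp) = r powr (- (Q - \<alpha>) + real (2 * cut_exp))"
      unfolding powr_add using r by (simp only: powr_realpow)
    also have "\<dots> \<le> 1"
      using r cut_exp(1) \<alpha>_pos Q_pos by (intro powr_le1) auto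
    finally show "r powr - (Q - \<alpha>) * r ^ (2 * cut_exp) \<le> 1" .
  qed auto
  finally have "ennreal (d powr - (Q - \<alpha>) * r ^ (2 * cut_exp))
    \<le> ennreal ((3 / \<delta>) powr (Q - \<alpha>) * D powr - (Q - \<alpha>))"
    by (intro ennreal_leI) simp
  then show ?thesis
    using r by (simp add: kern_def d_def[symmetric] r_def[symmetric] D_def[symmetric] ennreal_mult)
qed

text \<open>Once the kernel is based at \<open>\<xi>0\<close>, the inner integral is the equation at
  \<open>\<xi>0\<close> and gives \<open>w \<xi>0\<close>. What remains is the integral of
  \<open>w powr \<sigma>\<close> over the unit ball.\<close>

lemma solution_far_bound:
  assumes w: "solution w" and \<xi>0: "heis_norm \<xi>0 < 1" and \<delta>: "0 < \<delta>" "\<delta> \<le> 1"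
  shows "(\<integral>\<^sup>+\<xi>. \<integral>\<^sup>+\<eta>. kern \<xi> \<eta> * ennreal (w \<xi> powr \<sigma> * w \<eta> powr \<sigma> * hcut \<xi> ^ (2 * cut_exp)) *
      indicator {(\<xi>, \<eta>). \<delta> * hcut \<xi> < hdist \<xi> \<eta>} (\<xi>, \<eta>) \<partial>lborel \<partial>lborel)
    \<le> ennreal ((3 / \<delta>) powr (Q - \<alpha>)) * ennreal (w \<xi>0) *
      (\<integral>\<^sup>+\<eta>. ennreal (w \<eta> powr \<sigma>) * indicator {\<eta>. heis_norm \<eta> < 1} \<eta> \<partial>lborel)"
proof -
  note [measurable] = solutionD(1)[OF w]
  let ?K = "ennreal ((3 / \<delta>) powr (Q - \<alpha>))"
  have "(\<integral>\<^sup>+\<eta>. kern \<xi> \<eta> * ennreal (w \<xi> powr \<sigma> * w \<eta> powr \<sigma> * hcut \<xi> ^ (2 * cut_exp)) *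
      indicator {(\<xi>, \<eta>). \<delta> * hcut \<xi> < hdist \<xi> \<eta>} (\<xi>, \<eta>) \<partial>lborel)
    \<le> ?K * ennreal (w \<xi>0) * (ennreal (w \<xi> powr \<sigma>) * indicator {\<eta>. heis_norm \<eta> < 1} \<xi>)" for \<xi>
  proof (cases "heis_norm \<xi> < 1")
    case True
    have "(\<integral>\<^sup>+\<eta>. kern \<xi> \<eta> * ennreal (w \<xi> powr \<sigma> * w \<eta> powr \<sigma> * hcut \<xi> ^ (2 * cut_exp)) *
      indicator {(\<xi>, \<eta>). \<delta> * hcut \<xi> < hdist \<xi> \<eta>} (\<xi>, \<eta>) \<partial>lborel)
      \<le> (\<integral>\<^sup>+\<eta>. ?K * ennreal (w \<xi> powr \<sigma>) * (kern \<xi>0 \<eta> * ennreal (w \<eta> powr \<sigma>)) \<partial>lborel)"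
    proof (rule nn_integral_mono_AE)
      have "AE \<eta> in lborel. \<eta> \<noteq> \<xi>0" by (rule AE_lborel_singleton)
      then show "AE \<eta> in lborel. kern \<xi> \<eta> * ennreal (w \<xi> powr \<sigma> * w \<eta> powr \<sigma> * hcut \<xi> ^ (2
        * cut_exp)) *
          indicator {(\<xi>, \<eta>). \<delta> * hcut \<xi> < hdist \<xi> \<eta>} (\<xi>, \<eta>)
        \<le> ?K * ennreal (w \<xi> powr \<sigma>) * (kern \<xi>0 \<eta> * ennreal (w \<eta> powr \<sigma>))"
      proof eventually_elim
        case (elim \<eta>)
        show ?case
        proof (cases "\<delta> * hcut \<xi> < hdist \<xi> \<eta>")
          case far: True
          have "kern \<xi> \<eta> * ennreal (w \<xi> powr \<sigma> * w \<eta> powr \<sigma> * hcut \<xi> ^ (2 * cut_exp))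
            = (kern \<xi> \<eta> * ennreal (hcut \<xi> ^ (2 * cut_exp))) * ennreal (w \<xi> powr \<sigma>)
              * ennreal (w \<eta> powr \<sigma>)"
            using hcut_props(1)[of \<xi>] by (simp add: ennreal_mult ac_simps)
          also have "\<dots> \<le> (?K * kern \<xi>0 \<eta>) * ennreal (w \<xi> powr \<sigma>) * ennreal (w \<eta> powr \<sigma>)"
            by (intro mult_right_mono kern_far_le True \<xi>0 \<delta> far elim) auto
          finally show ?thesis using far by (simp add: ac_simps)
        qed simp
      qed
    qed
    also have "\<dots> = ?K * ennreal (w \<xi> powr \<sigma>) * ennreal (w \<xi>0)"
      unfolding solutionD(3)[OF w, of \<xi>0] by (rule nn_integral_cmult) measurable
    finally show ?thesis using True by (simp add: ac_simps)
  next
    case False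
    then have "hcut \<xi> = 0" using hcut_props(1,3)[of \<xi>] by linarith
    then have z: "hcut \<xi> ^ (2 * cut_exp) = 0" using cut_exp by (simp add: zero_power)
    show ?thesis unfolding z by simp
  qed
  then have "(\<integral>\<^sup>+\<xi>. \<integral>\<^sup>+\<eta>. kern \<xi> \<eta> * ennreal (w \<xi> powr \<sigma> * w \<eta> powr \<sigma> * hcut \<xi> ^ (2 * cut_exp)) *
      indicator {(\<xi>, \<eta>). \<delta> * hcut \<xi> < hdist \<xi> \<eta>} (\<xi>, \<eta>) \<partial>lborel \<partial>lborel)
    \<le> (\<integral>\<^sup>+\<xi>. ?K * ennreal (w \<xi>0) * (ennreal (w \<xi> powr \<sigma>)
      * indicator {\<eta>. heis_norm \<eta> < 1} \<xi>) \<partial>lborel)"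
    by (rule nn_integral_mono)
  also have "\<dots> = ?K * ennreal (w \<xi>0) * (\<integral>\<^sup>+\<eta>. ennreal (w \<eta> powr \<sigma>)
    * indicator {\<eta>. heis_norm \<eta> < 1} \<eta> \<partial>lborel)"
    by (rule nn_integral_cmult) measurable
  finally show ?thesis .
qed

text \<open>\<open>hcut\<close> is 1-Lipschitz for \<open>hdist\<close>, so near the diagonal it
  drops at most by the factor \<open>1 - \<delta>\<close>. Bernoulli's inequality makes the relative
  loss of its power at most \<open>cut_exp * \<delta>\<close>.\<close>

lemma hcut_near:
  assumes "0 \<le> \<delta>" "\<delta> \<le> 1" "hdist \<xi> \<eta> \<le> \<delta> * hcut \<xi>"
  shows "hcut \<xi> ^ (2 * cut_exp) \<le> hcut \<xi> ^ cut_exp * hcut \<eta> ^ cut_exp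
    + real cut_exp * \<delta> * hcut \<xi> ^ (2 * cut_exp)"
proof -
  have "(1 - \<delta>) * hcut \<xi> \<le> hcut \<eta>"
    using hcut_props(4)[of \<xi> \<eta>] assms by (simp add: algebra_simps)
  then have "((1 - \<delta>) * hcut \<xi>) ^ cut_exp \<le> hcut \<eta> ^ cut_exp"
    using assms hcut_props(1)[of \<xi>] by (intro power_mono) auto
  moreover have "1 + real cut_exp * (- \<delta>) \<le> (1 + - \<delta>) ^ cut_exp"
    using assms by (intro Bernoulli_inequality) auto
  then have "(1 - real cut_exp * \<delta>) * hcut \<xi> ^ cut_exp \<le> (1 - \<delta>) ^ cut_exp * hcut \<xi> ^ cut_exp"
    using hcut_props(1)[of \<xi>] by (intro mult_right_mono) auto
  ultimately have "(1 - real cut_exp * \<delta>) * hcut \<xi> ^ cut_exp \<le> hcut \<eta> ^ cut_exp"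
    by (simp add: power_mult_distrib)
  then have "hcut \<xi> ^ cut_exp * ((1 - real cut_exp * \<delta>) * hcut \<xi> ^ cut_exp)
    \<le> hcut \<xi> ^ cut_exp * hcut \<eta> ^ cut_exp"
    using hcut_props(1)[of \<xi>] by (intro mult_left_mono) auto
  moreover have "hcut \<xi> ^ (2 * cut_exp) = hcut \<xi> ^ cut_exp * hcut \<xi> ^ cut_exp"
    by (simp only: mult_2 power_add)
  ultimately show ?thesis by (simp only:) (simp add: algebra_simps)
qed

text \<open>Testing stability with \<open>w * hcut ^ cut_exp\<close> instead of \<open>w\<close> costs only a fraction of the energy
  near the diagonal, and off the diagonal the kernel is controlled
    by the value of \<open>w\<close> at one point.\<close>

lemma solution_energy_bound:
  obtains C where "\<And>w v. solution w \<Longrightarrow> solution v \<Longrightarrow> (\<And>\<xi>. w \<xi> < v \<xi>) \<Longrightarrow>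
    (\<integral>\<^sup>+\<eta>. ennreal (w \<eta> powr (\<sigma> + 1)) * indicator {\<eta>. heis_norm \<eta> < 1 / 2} \<eta> \<partial>lborel) \<le> ennreal C"
proof -
  obtain CJ m0 where CJ: "CJ > 0" "m0 > 0"
    "\<And>w. solution w \<Longrightarrow> (\<integral>\<^sup>+\<eta>. ennreal (w \<eta> powr \<sigma>) * indicator {\<eta>. heis_norm \<eta> < 1} \<eta> \<partial>lborel)
      \<le> ennreal CJ"
    "\<And>w. solution w \<Longrightarrow> \<exists>\<xi>. heis_norm \<xi> < 1 \<and> w \<xi> \<le> m0"
    by (rule solution_unit_ball) blast
  have s1: "\<sigma> > 1" by (rule \<sigma>_gt_1)
  \<comment> \<open>The gain from stability: the tested double integral is at most the fraction
    \<open>1 / \<sigma> = 1 - \<kappa>\<close> of the energy \<open>X\<close>.\<close>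
  define \<kappa> where "\<kappa> = 1 - 1 / \<sigma>"
  have \<kappa>: "0 < \<kappa>" "\<kappa> < 1" using s1 by (auto simp: \<kappa>_def)
  \<comment> \<open>With this width the loss near the diagonal is the fraction
    \<open>\<kappa> / 2\<close> of the energy, half of the gain.\<close>
  define \<delta> where "\<delta> = \<kappa> / (2 * real cut_exp)"
  have mm1: "1 \<le> real cut_exp" using cut_exp(2) by simp
  have \<delta>: "0 < \<delta>" "\<delta> \<le> 1" "real cut_exp * \<delta> = \<kappa> / 2"
    using \<kappa> mm1 by (auto simp: \<delta>_def field_simps)
  define CF where "CF = (3 / \<delta>) powr (Q - \<alpha>) * m0 * CJ"
  have CF: "CF \<ge> 0" using CJ by (simp add: CF_def)
  define C where "C = 4 ^ cut_exp * (2 * CF / \<kappa>)"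
  have "(\<integral>\<^sup>+\<eta>. ennreal (w \<eta> powr (\<sigma> + 1)) * indicator {\<eta>. heis_norm \<eta> < 1 / 2} \<eta> \<partial>lborel)
    \<le> ennreal C"
    if w: "solution w" and v: "solution v" and lt: "\<And>\<xi>. w \<xi> < v \<xi>" for w v
  proof -
    note [measurable] = solutionD(1)[OF w]
    have w0: "0 \<le> w \<xi>" for \<xi> by (rule solutionD(2)[OF w])
    have h0: "0 \<le> hcut \<xi>" for \<xi> by (rule hcut_props)
    obtain \<xi>0 where \<xi>0: "heis_norm \<xi>0 < 1" "w \<xi>0 \<le> m0" using CJ(4)[OF w] by blast
    let ?a = "\<lambda>\<xi>. w \<xi> powr \<sigma>"
    define X where "X = (\<integral>\<^sup>+\<xi>. ennreal (w \<xi> powr (\<sigma> + 1) * hcut \<xi> ^ (2 * cut_exp)) \<partial>lborel)"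
    define S where "S = (\<integral>\<^sup>+\<xi>. \<integral>\<^sup>+\<eta>. kern \<xi> \<eta> * ennreal (?a \<xi> * hcut \<xi> ^ cut_exp * (?a \<eta>
      * hcut \<eta> ^ cut_exp)) \<partial>lborel \<partial>lborel)"
    define F where "F = (\<integral>\<^sup>+\<xi>. \<integral>\<^sup>+\<eta>. kern \<xi> \<eta> * ennreal (?a \<xi> * ?a \<eta> * hcut \<xi> ^ (2 * cut_exp)) *
      indicator {(\<xi>, \<eta>). \<delta> * hcut \<xi> < hdist \<xi> \<eta>} (\<xi>, \<eta>) \<partial>lborel \<partial>lborel)"
    have F_le: "F \<le> ennreal CF"
    proof -
      have "F \<le> ennreal ((3 / \<delta>) powr (Q - \<alpha>)) * ennreal (w \<xi>0) *
          (\<integral>\<^sup>+\<eta>. ennreal (w \<eta> powr \<sigma>) * indicator {\<eta>. heis_norm \<eta> < 1} \<eta> \<partial>lborel)"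
        unfolding F_def by (rule solution_far_bound[OF w \<xi>0(1) \<delta>(1,2)])
      also have "\<dots> \<le> ennreal ((3 / \<delta>) powr (Q - \<alpha>)) * ennreal m0 * ennreal CJ"
        by (intro mult_mono ennreal_leI \<xi>0 CJ(3)[OF w]) auto
      also have "\<dots> = ennreal CF" using CJ by (simp add: CF_def ennreal_mult)
      finally show ?thesis .
    qed
    \<comment> \<open>One factor \<open>w \<xi>\<close> of the energy density is replaced by its
      potential, so that \<open>X\<close> can be compared with the double integral
      \<open>S\<close>.\<close>
    have X_eq: "X = (\<integral>\<^sup>+\<xi>. \<integral>\<^sup>+\<eta>. kern \<xi> \<eta> * ennreal (?a \<xi> * ?a \<eta> * hcut \<xi> ^ (2
      * cut_exp)) \<partial>lborel \<partial>lborel)"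
      unfolding X_def
    proof (rule nn_integral_cong)
      fix \<xi>
      have "w \<xi> powr (\<sigma> + 1) * hcut \<xi> ^ (2 * cut_exp) = ?a \<xi> * hcut \<xi> ^ (2 * cut_exp) * w \<xi>"
        using w0[of \<xi>] by (simp add: powr_add)
      then have "ennreal (w \<xi> powr (\<sigma> + 1) * hcut \<xi> ^ (2 * cut_exp))
        = ennreal (?a \<xi> * hcut \<xi> ^ (2 * cut_exp) * w \<xi>)"
        by (simp only:)
      also have "\<dots> = ennreal (?a \<xi> * hcut \<xi> ^ (2 * cut_exp)) * ennreal (w \<xi>)"
        using w0 h0 by (intro ennreal_mult) auto
      also have "\<dots> = (\<integral>\<^sup>+\<eta>. ennreal (?a \<xi> * hcut \<xi> ^ (2 * cut_exp)) * (kern \<xi> \<eta>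
        * ennreal (?a \<eta>)) \<partial>lborel)"
        unfolding solutionD(3)[OF w, of \<xi>] by (rule nn_integral_cmult[symmetric]) measurable
      also have "\<dots> = (\<integral>\<^sup>+\<eta>. kern \<xi> \<eta> * ennreal (?a \<xi> * ?a \<eta> * hcut \<xi> ^ (2 * cut_exp)) \<partial>lborel)"
        using h0 by (simp add: ennreal_mult ac_simps)
      finally show "ennreal (w \<xi> powr (\<sigma> + 1) * hcut \<xi> ^ (2 * cut_exp)) = \<dots>" .
    qed
    \<comment> \<open>Needed to subtract multiples of \<open>X\<close> at the end; the bound itself
      will not depend on this value.\<close>
    have X_fin: "X < \<infinity>"
    proof -
      have "X \<le> (\<integral>\<^sup>+\<xi>. ennreal (w \<xi> powr (\<sigma> + 1)) * indicator {\<eta>. heis_norm \<eta> < 1} \<xi> \<partial>lborel)"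
        unfolding X_def
      proof (rule nn_integral_mono)
        fix \<xi> :: "'n heis"
        show "ennreal (w \<xi> powr (\<sigma> + 1) * hcut \<xi> ^ (2 * cut_exp))
          \<le> ennreal (w \<xi> powr (\<sigma> + 1)) * indicator {\<eta>. heis_norm \<eta> < 1} \<xi>"
        proof (cases "heis_norm \<xi> < 1")
          case True
          have "hcut \<xi> ^ (2 * cut_exp) \<le> 1" using hcut_props[of \<xi>] by (intro power_le_one) auto
          then show ?thesis using True by (simp add: ennreal_leI mult_left_le)
        next
          case False
          then have "hcut \<xi> = 0" using hcut_props(1,3)[of \<xi>] by linarith
          then have z: "hcut \<xi> ^ (2 * cut_exp) = 0" using cut_exp by (simp add: zero_power)
          show ?thesis unfolding z by simp
        qed
      qed
      then show ?thesis using solutionD(4)[OF w, of 1] by (rule order_le_less_trans)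
    qed
    have S_le: "ennreal \<sigma> * S \<le> X"
    proof -
      have "ennreal \<sigma> * S \<le> (\<integral>\<^sup>+\<xi>. ennreal (w \<xi> powr (\<sigma> + 1) * (hcut \<xi> ^ cut_exp)\<^sup>2) \<partial>lborel)"
        unfolding S_def by (rule solution_stable[OF w v lt]) (auto simp: h0)
      then show ?thesis by (simp add: X_def mult.commute flip: power_mult)
    qed
    \<comment> \<open>Near the diagonal the first two summands suffice by \<open>hcut_near\<close>;
      away from it the last one alone does. With the stability bound this becomes
      \<open>X \<le> (1 - \<kappa>) X + \<kappa> / 2 * X + CF\<close>.\<close>
    have "X \<le> (\<integral>\<^sup>+\<xi>. \<integral>\<^sup>+\<eta>. (kern \<xi> \<eta> * ennreal (?a \<xi> * hcut \<xi> ^ cut_exp * (?a \<eta> * hcut \<eta> ^ cut_exp))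
        + ennreal (\<kappa> / 2) * (kern \<xi> \<eta> * ennreal (?a \<xi> * ?a \<eta> * hcut \<xi> ^ (2 * cut_exp))))
        + kern \<xi> \<eta> * ennreal (?a \<xi> * ?a \<eta> * hcut \<xi> ^ (2 * cut_exp)) * indicator {(\<xi>, \<eta>). \<delta>
          * hcut \<xi> < hdist \<xi> \<eta>} (\<xi>, \<eta>)
        \<partial>lborel \<partial>lborel)"
      unfolding X_eq
    proof (intro nn_integral_mono)
      fix \<xi> \<eta> :: "'n heis"
      show "kern \<xi> \<eta> * ennreal (?a \<xi> * ?a \<eta> * hcut \<xi> ^ (2 * cut_exp))
        \<le> (kern \<xi> \<eta> * ennreal (?a \<xi> * hcut \<xi> ^ cut_exp * (?a \<eta> * hcut \<eta> ^ cut_exp))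
        + ennreal (\<kappa> / 2) * (kern \<xi> \<eta> * ennreal (?a \<xi> * ?a \<eta> * hcut \<xi> ^ (2 * cut_exp))))
        + kern \<xi> \<eta> * ennreal (?a \<xi> * ?a \<eta> * hcut \<xi> ^ (2 * cut_exp)) * indicator {(\<xi>, \<eta>). \<delta>
          * hcut \<xi> < hdist \<xi> \<eta>} (\<xi>, \<eta>)"
      proof (cases "\<delta> * hcut \<xi> < hdist \<xi> \<eta>")
        case True
        then show ?thesis by (simp add: add_increasing)
      next
        case False
        then have "hcut \<xi> ^ (2 * cut_exp) \<le> hcut \<xi> ^ cut_exp * hcut \<eta> ^ cut_exp
          + \<kappa> / 2 * hcut \<xi> ^ (2 * cut_exp)"
          using hcut_near[of \<delta> \<xi> \<eta>] \<delta> by simp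
        then have "(?a \<xi> * ?a \<eta>) * hcut \<xi> ^ (2 * cut_exp)
          \<le> (?a \<xi> * ?a \<eta>) * (hcut \<xi> ^ cut_exp * hcut \<eta> ^ cut_exp + \<kappa> / 2 * hcut \<xi> ^ (2 * cut_exp))"
          by (intro mult_left_mono) auto
        also have "\<dots> = ?a \<xi> * hcut \<xi> ^ cut_exp * (?a \<eta> * hcut \<eta> ^ cut_exp)
          + \<kappa> / 2 * (?a \<xi> * ?a \<eta> * hcut \<xi> ^ (2 * cut_exp))"
          by (simp add: algebra_simps)
        finally have "kern \<xi> \<eta> * ennreal (?a \<xi> * ?a \<eta> * hcut \<xi> ^ (2 * cut_exp)) \<le>
          kern \<xi> \<eta> * ennreal (?a \<xi> * hcut \<xi> ^ cut_exp * (?a \<eta> * hcut \<eta> ^ cut_exp)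
            + \<kappa> / 2 * (?a \<xi> * ?a \<eta> * hcut \<xi> ^ (2 * cut_exp)))"
          by (intro mult_left_mono ennreal_leI) auto
        also have "ennreal (?a \<xi> * hcut \<xi> ^ cut_exp * (?a \<eta> * hcut \<eta> ^ cut_exp)
          + \<kappa> / 2 * (?a \<xi> * ?a \<eta> * hcut \<xi> ^ (2 * cut_exp)))
          = ennreal (?a \<xi> * hcut \<xi> ^ cut_exp * (?a \<eta> * hcut \<eta> ^ cut_exp))
            + ennreal (\<kappa> / 2 * (?a \<xi> * ?a \<eta> * hcut \<xi> ^ (2 * cut_exp)))"
          using \<kappa> h0 by (intro ennreal_plus) auto
        also have "ennreal (\<kappa> / 2 * (?a \<xi> * ?a \<eta> * hcut \<xi> ^ (2 * cut_exp)))
          = ennreal (\<kappa> / 2) * ennreal (?a \<xi> * ?a \<eta> * hcut \<xi> ^ (2 * cut_exp))"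
          using \<kappa> by (intro ennreal_mult') auto
        finally show ?thesis using False by (simp add: distrib_left mult.left_commute)
      qed
    qed
    also have "\<dots> = S + ennreal (\<kappa> / 2) * X + F"
      unfolding S_def F_def X_eq by (simp add: nn_integral_add nn_integral_cmult)
    finally have X_le: "X \<le> S + ennreal (\<kappa> / 2) * X + F" .
    obtain x where x: "X = ennreal x" "x \<ge> 0" using X_fin by (cases X) auto
    have "S \<noteq> top" using S_le s1 X_fin by (auto simp: ennreal_mult_top top_unique)
    then obtain s where s: "S = ennreal s" "s \<ge> 0" by (cases S) auto
    have "\<sigma> * s \<le> x" using S_le s1 s x by (simp flip: ennreal_mult')
    then have "s \<le> x / \<sigma>" using s1 by (simp add: field_simps)
    also have "x / \<sigma> = x - \<kappa> * x" by (simp add: \<kappa>_def algebra_simps)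
    finally have s_le: "s \<le> x - \<kappa> * x" .
    have "ennreal x \<le> ennreal s + ennreal (\<kappa> / 2) * ennreal x + ennreal CF"
      using X_le F_le unfolding x s by (meson add_left_mono order_trans)
    also have "\<dots> = ennreal (s + \<kappa> / 2 * x + CF)"
    proof -
      have "ennreal (\<kappa> / 2) * ennreal x = ennreal (\<kappa> / 2 * x)"
        using \<kappa> x by (intro ennreal_mult[symmetric]) auto
      then show ?thesis using \<kappa> x s CF by (simp add: ennreal_plus)
    qed
    finally have "x \<le> s + \<kappa> / 2 * x + CF" using \<kappa> x s CF by (subst (asm) ennreal_le_iff) auto
    with s_le have "\<kappa> / 2 * x \<le> CF" by (simp add: algebra_simps)
    then have x_le: "x \<le> 2 * CF / \<kappa>" using \<kappa> by (simp add: field_simps)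
    have "(\<integral>\<^sup>+\<eta>. ennreal (w \<eta> powr (\<sigma> + 1)) * indicator {\<eta>. heis_norm \<eta> < 1 / 2} \<eta> \<partial>lborel)
      \<le> (\<integral>\<^sup>+\<xi>. ennreal (4 ^ cut_exp) * ennreal (w \<xi> powr (\<sigma> + 1) * hcut \<xi> ^ (2 * cut_exp)) \<partial>lborel)"
    proof (rule nn_integral_mono)
      fix \<eta> :: "'n heis"
      show "ennreal (w \<eta> powr (\<sigma> + 1)) * indicator {\<eta>. heis_norm \<eta> < 1 / 2} \<eta>
        \<le> ennreal (4 ^ cut_exp) * ennreal (w \<eta> powr (\<sigma> + 1) * hcut \<eta> ^ (2 * cut_exp))"
      proof (cases "heis_norm \<eta> < 1 / 2")
        case True
        \<comment> \<open>On the half ball the cutoff is at least \<open>1 / 2\<close>, which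
          accounts for the factor \<open>4 ^ cut_exp\<close> in \<open>C\<close>.\<close>
        then have "1 \<le> 2 * hcut \<eta>" by (simp add: hcut_def)
        then have "1 \<le> (2 * hcut \<eta>) ^ (2 * cut_exp)" by (rule one_le_power)
        also have "\<dots> = (2\<^sup>2) ^ cut_exp * hcut \<eta> ^ (2 * cut_exp)"
          by (simp only: power_mult_distrib power_mult[of 2 2])
        finally have "1 \<le> 4 ^ cut_exp * hcut \<eta> ^ (2 * cut_exp)" by simp
        then have "w \<eta> powr (\<sigma> + 1) * 1 \<le> w \<eta> powr (\<sigma> + 1) * (4 ^ cut_exp * hcut \<eta> ^ (2 * cut_exp))"
          by (intro mult_left_mono) auto
        then have "ennreal (w \<eta> powr (\<sigma> + 1)) \<le> ennreal (4 ^ cut_exp * (w \<eta> powr (\<sigma>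
          + 1) * hcut \<eta> ^ (2 * cut_exp)))"
          by (intro ennreal_leI) (simp add: ac_simps)
        then show ?thesis using True by (simp add: ennreal_mult')
      qed simp
    qed
    also have "\<dots> = ennreal (4 ^ cut_exp) * X"
      unfolding X_def by (rule nn_integral_cmult) measurable
    also have "\<dots> = ennreal (4 ^ cut_exp * x)" unfolding x by (rule ennreal_mult'[symmetric]) simp
    also have "\<dots> \<le> ennreal C"
      unfolding C_def by (intro ennreal_leI mult_left_mono x_le) auto
    finally show ?thesis .
  qed
  then show thesis by (rule that)
qed

section \<open>The Liouville theorem for spheres that never stop\<close>

lemma solution_le_rescale:
  assumes u: "solution u" and S: "\<And>l. l > 0 \<Longrightarrow> above_kelvin u l"
  shows "u \<xi> \<le> rescale 2 u \<xi>"
proof (cases "\<xi> = 0")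
  case True
  have "1 \<le> (2::real) powr \<beta>" using \<beta>_pos by (intro ge_one_powr_ge_zero) auto
  then have "1 * u 0 \<le> 2 powr \<beta> * u 0" using solutionD(2)[OF u] by (intro mult_right_mono) auto
  then show ?thesis by (simp add: True rescale_def)
next
  case False
  define r where "r = heis_norm \<xi>"
  have r: "r > 0" using False by (simp add: r_def)
  \<comment> \<open>The geometric mean of the norms of \<open>\<xi>\<close> and
    \<open>dil 2 \<xi>\<close>, so that the inversion exchanges these two points; the Kelvin weight
    at \<open>dil 2 \<xi>\<close> is then \<open>2 powr - \<beta>\<close>.\<close>
  define l where "l = sqrt 2 * r"
  have l: "l > 0" using r by (simp add: l_def)
  have l2: "l\<^sup>2 = 2 * r\<^sup>2" by (simp add: l_def power_mult_distrib)
  have "l \<le> 2 * r" using r by (simp add: l_def sqrt_le_D real_le_lsqrt)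
  then have "l \<le> heis_norm (dil 2 \<xi>)" by (simp add: r_def)
  then have "kelvin l u (dil 2 \<xi>) \<le> u (dil 2 \<xi>)" using S[OF l] unfolding above_kelvin_def by blast
  moreover have "hinv l (dil 2 \<xi>) = \<xi>"
    using r by (simp add: hinv_def dil_dil r_def[symmetric] l2 power_mult_distrib)
  moreover have "(l / heis_norm (dil 2 \<xi>)) powr (Q - \<alpha>) = 2 powr - \<beta>"
  proof -
    have "l / heis_norm (dil 2 \<xi>) = sqrt 2 / 2" using r by (simp add: l_def r_def)
    also have "\<dots> = 2 powr - (1 / 2)" by (simp add: powr_minus powr_half_sqrt real_div_sqrt
      field_simps)
    finally have "(l / heis_norm (dil 2 \<xi>)) powr (Q - \<alpha>) = 2 powr (- (1 / 2) * (Q - \<alpha>))"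
      by (simp only: powr_powr)
    then show ?thesis by (simp add: \<beta>_def)
  qed
  ultimately have "2 powr - \<beta> * u \<xi> \<le> u (dil 2 \<xi>)" by (simp add: kelvin_def)
  then have "2 powr \<beta> * (2 powr - \<beta> * u \<xi>) \<le> 2 powr \<beta> * u (dil 2 \<xi>)" by (intro mult_left_mono) auto
  then show ?thesis by (simp add: rescale_def mult.assoc[symmetric] flip: powr_add)
qed

lemma solution_Liouville:
  assumes u: "solution u" and S: "\<And>l. l > 0 \<Longrightarrow> above_kelvin u l"
  shows "u \<xi> = 0"
proof (rule ccontr)
  assume nz: "u \<xi> \<noteq> 0"
  note [measurable] = solutionD(1)[OF u]
  define v where "v = rescale 2 u"
  have v: "solution v" unfolding v_def by (rule solution_rescale[OF u]) simp
  note [measurable] = solutionD(1)[OF v]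
  have le: "u \<zeta> \<le> v \<zeta>" for \<zeta> unfolding v_def by (rule solution_le_rescale[OF u S])
  \<comment> \<open>Contact anywhere would mean equality everywhere, in particular
    \<open>u 0 = 2 powr \<beta> * u 0\<close> at the fixed point of the dilations. Then
    \<open>u 0 = 0\<close>, so the density in the equation vanishes almost everywhere and
    \<open>u\<close> is zero.\<close>
  have lt: "u \<zeta> < v \<zeta>" for \<zeta>
  proof (rule ccontr)
    assume "\<not> u \<zeta> < v \<zeta>"
    with le[of \<zeta>] have "u \<zeta> = v \<zeta>" by simp
    then have "u 0 = v 0" by (rule solution_eq_if_le_touch[OF u v le])
    then have "u 0 = 2 powr \<beta> * u 0" by (simp add: v_def rescale_def)
    moreover have "2 powr \<beta> \<noteq> (1::real)" using \<beta>_pos by (simp add: powr_eq_one_iff)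
    ultimately have "u 0 = 0" by simp
    then have "(\<integral>\<^sup>+\<eta>. kern 0 \<eta> * ennreal (u \<eta> powr \<sigma>) \<partial>lborel) = 0"
      using solutionD(3)[OF u, of 0] by simp
    then have "AE \<eta> in lborel. kern 0 \<eta> * ennreal (u \<eta> powr \<sigma>) = 0"
      by (subst (asm) nn_integral_0_iff_AE) auto
    moreover have "AE \<eta> in lborel. \<eta> \<noteq> (0 :: 'n heis)" by (rule AE_lborel_singleton)
    ultimately have "AE \<eta> in lborel. kern \<xi> \<eta> * ennreal (u \<eta> powr \<sigma>) = 0"
      by eventually_elim (auto simp: kern_def)
    then have "ennreal (u \<xi>) = 0"
      unfolding solutionD(3)[OF u, of \<xi>] by (subst nn_integral_0_iff_AE) auto
    then show False using nz solutionD(2)[OF u, of \<xi>] by simp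
  qed
  obtain C where C: "\<And>w v. solution w \<Longrightarrow> solution v \<Longrightarrow> (\<And>\<xi>. w \<xi> < v \<xi>) \<Longrightarrow>
    (\<integral>\<^sup>+\<eta>. ennreal (w \<eta> powr (\<sigma> + 1)) * indicator {\<eta>. heis_norm \<eta> < 1 / 2} \<eta> \<partial>lborel) \<le> ennreal C"
    by (rule solution_energy_bound) blast
  \<comment> \<open>Rescaling by \<open>R\<close> preserves both the strict order and the energy and
    maps the ball of radius \<open>R / 2\<close> to the half ball, where the universal bound
    holds.\<close>
  have ball: "(\<integral>\<^sup>+\<eta>. ennreal (u \<eta> powr (\<sigma> + 1)) * indicator {\<eta>. heis_norm \<eta> < R / 2} \<eta> \<partial>lborel)
    \<le> ennreal C"
    if R: "R > 0" for R
  proof -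
    have "(\<integral>\<^sup>+\<eta>. ennreal (u \<eta> powr (\<sigma> + 1)) * indicator {\<eta>. heis_norm \<eta> < R / 2} \<eta> \<partial>lborel)
      = (\<integral>\<^sup>+\<eta>. ennreal (rescale R u \<eta> powr (\<sigma> + 1))
        * indicator {\<eta>. heis_norm \<eta> < R / 2} (dil R \<eta>) \<partial>lborel)"
      by (rule rescale_energy[OF u R, symmetric]) measurable
    also have "\<dots> = (\<integral>\<^sup>+\<eta>. ennreal (rescale R u \<eta> powr (\<sigma>
      + 1)) * indicator {\<eta>. heis_norm \<eta> < 1 / 2} \<eta> \<partial>lborel)"
      using R by (intro nn_integral_cong) (auto simp: indicator_def field_simps)
    also have "\<dots> \<le> ennreal C"
    proof (rule C)
      show "solution (rescale R u)" "solution (rescale R v)"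
        by (rule solution_rescale[OF u R], rule solution_rescale[OF v R])
      show "rescale R u \<zeta> < rescale R v \<zeta>" for \<zeta>
        unfolding rescale_def using R lt by (intro mult_strict_left_mono) auto
    qed
    finally show ?thesis .
  qed
  let ?f = "\<lambda>\<eta>. ennreal (u \<eta> powr (\<sigma> + 1))"
  have fin: "(\<integral>\<^sup>+\<eta>. ?f \<eta> \<partial>lborel) \<noteq> \<infinity>"
  proof -
    let ?F = "\<lambda>n \<eta>. ?f \<eta> * indicator {\<eta>. heis_norm \<eta> < real (Suc n) / 2} \<eta>"
    have "(\<integral>\<^sup>+\<eta>. ?f \<eta> \<partial>lborel) \<le> (\<integral>\<^sup>+\<eta>. liminf (\<lambda>n. ?F n \<eta>) \<partial>lborel)"
    proof (rule nn_integral_mono)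
      fix \<eta> :: "'n heis"
      obtain N :: nat where N: "2 * heis_norm \<eta> < real N" using reals_Archimedean2 by blast
      have "\<forall>\<^sub>F n in sequentially. ?F n \<eta> = ?f \<eta>"
        using eventually_ge_at_top[of N] by eventually_elim (use N in \<open>auto simp: indicator_def\<close>)
      then have "(\<lambda>n. ?F n \<eta>) \<longlonglongrightarrow> ?f \<eta>" by (rule tendsto_eventually)
      then show "?f \<eta> \<le> liminf (\<lambda>n. ?F n \<eta>)" by (simp add: lim_imp_Liminf)
    qed
    also have "\<dots> \<le> liminf (\<lambda>n. \<integral>\<^sup>+\<eta>. ?F n \<eta> \<partial>lborel)"
      by (rule nn_integral_liminf) measurable
    also have "\<dots> \<le> ennreal C"
    proof -
      have "liminf (\<lambda>n. \<integral>\<^sup>+\<eta>. ?F n \<eta> \<partial>lborel) \<le> liminf (\<lambda>n::nat. ennreal C)"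
        by (intro Liminf_mono always_eventually allI ball) simp
      then show ?thesis by (simp add: Liminf_const)
    qed
    finally show ?thesis by (auto simp: top_unique)
  qed
  \<comment> \<open>\<open>v\<close> is a rescaling of \<open>u\<close> and has the same finite
    energy, so the ordered energy densities agree almost everywhere, against the strict
    inequality.\<close>
  have "AE \<eta> in lborel. ?f \<eta> = ennreal (v \<eta> powr (\<sigma> + 1))"
  proof (rule nn_integral_eq_imp_AE_eq[OF _ _ _ _ fin])
    have "(\<integral>\<^sup>+\<eta>. ennreal (v \<eta> powr (\<sigma> + 1)) * 1 \<partial>lborel) = (\<integral>\<^sup>+\<eta>. ?f \<eta> * 1 \<partial>lborel)"
      unfolding v_def by (rule rescale_energy[OF u, of 2 "\<lambda>_. 1"]) auto
    then show "(\<integral>\<^sup>+\<eta>. ennreal (v \<eta> powr (\<sigma> + 1)) \<partial>lborel) = (\<integral>\<^sup>+\<eta>. ?f \<eta> \<partial>lborel)" by simp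
    show "AE \<eta> in lborel. ?f \<eta> \<le> ennreal (v \<eta> powr (\<sigma> + 1))"
      using le solutionD(2)[OF u] \<sigma>_gt_1 by (intro AE_I2 ennreal_leI powr_mono2) auto
  qed measurable
  then have "AE \<eta> in (lborel :: 'n heis measure). False"
  proof eventually_elim
    case (elim \<eta>)
    have "u \<eta> powr (\<sigma> + 1) < v \<eta> powr (\<sigma> + 1)"
      using lt[of \<eta>] solutionD(2)[OF u, of \<eta>] \<sigma>_gt_1 by (intro powr_less_mono2) auto
    with elim show False by simp
  qed
  then have "emeasure (lborel :: 'n heis measure) UNIV = 0"
    by (subst (asm) AE_iff_measurable[of UNIV]) auto
  then show False by simp
qed

theorem solution_inversion_symmetric:
  assumes u: "solution u" and c: "circle_invariant u"
  shows "\<exists>s>0. \<forall>\<xi>. \<xi> \<noteq> 0 \<longrightarrow> u \<xi> = kelvin s u \<xi>"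
proof (cases "\<forall>l>0. above_kelvin u l")
  case True
  then have "u \<xi> = 0" for \<xi> using solution_Liouville[OF u] by blast
  \<comment> \<open>The zero solution is symmetric about every sphere; radius \<open>1\<close> is an
    arbitrary choice.\<close>
  then show ?thesis by (intro exI[of _ 1]) (simp add: kelvin_def)
next
  case False
  then obtain m0 where m0: "m0 > 0" "\<not> above_kelvin u m0" by blast
  \<comment> \<open>Radii below which every sphere is admissible. This set contains the starting
    interval's end \<open>e\<close>, and the inadmissible radius \<open>m0\<close> bounds it from
    above.\<close>
  define A where "A = {l. l > 0 \<and> (\<forall>m. 0 < m \<and> m < l \<longrightarrow> above_kelvin u m)}"
  obtain e where e: "e > 0" "\<And>m. 0 < m \<Longrightarrow> m < e \<Longrightarrow> above_kelvin u m"
    by (rule above_kelvin_start[OF u c]) blast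
  have eA: "e \<in> A" using e by (auto simp: A_def)
  have bound: "l \<le> m0" if "l \<in> A" for l using that m0 by (force simp: A_def not_less[symmetric])
  have bdd: "bdd_above A" using bound by (rule bdd_aboveI)
  define L where "L = Sup A"
  have "e \<le> L" unfolding L_def by (rule cSup_upper[OF eA bdd])
  with e have L: "L > 0" by simp
  have below: "above_kelvin u m" if "0 < m" "m < L" for m
  proof -
    obtain l where "l \<in> A" "m < l" using \<open>m < L\<close> eA bdd unfolding L_def
      by (metis less_cSup_iff empty_iff)
    then show ?thesis using that by (auto simp: A_def)
  qed
  have SL: "above_kelvin u L" using u L below by (rule above_kelvin_closed)
  \<comment> \<open>Without a contact point outside, \<open>above_kelvin_open\<close> would push the
    spheres beyond the supremum \<open>L\<close>.\<close>
  have "\<exists>\<xi>. L < heis_norm \<xi> \<and> kelvin L u \<xi> = u \<xi>"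
  proof (rule ccontr)
    assume neg: "\<not> ?thesis"
    have "kelvin L u \<xi> < u \<xi>" if "L < heis_norm \<xi>" for \<xi>
      using that neg SL unfolding above_kelvin_def by (meson less_imp_le order_le_neq_trans)
    from above_kelvin_open[OF u c L this] obtain d where d: "d > 0" "\<And>m. L < m \<Longrightarrow> m < L + d
      \<Longrightarrow> above_kelvin u m"
      by blast
    have "L + d \<in> A"
      using L d below SL by (auto simp: A_def) (metis linorder_neqE_linordered_idom)
    then have "L + d \<le> L" unfolding L_def by (rule cSup_upper[OF _ bdd])
    with d show False by simp
  qed
  then obtain \<xi>1 where \<xi>1: "L < heis_norm \<xi>1" "kelvin L u \<xi>1 = u \<xi>1" by blast
  have out: "kelvin L u \<zeta> = u \<zeta>" if "L < heis_norm \<zeta>" for \<zeta>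
    by (rule above_kelvin_dichotomy[OF u c L SL \<xi>1 that])
  have "u \<xi> = kelvin L u \<xi>" if \<xi>: "\<xi> \<noteq> 0" for \<xi>
  proof -
    consider "L < heis_norm \<xi>" | "heis_norm \<xi> = L" | "heis_norm \<xi> < L" by linarith
    then show ?thesis
    proof cases
      \<comment> \<open>Inside the sphere the identity is the outer one at the inverse point,
        because the two Kelvin weights are reciprocal.\<close>
      case 3
      have r: "heis_norm \<xi> > 0" using \<xi> by simp
      have "L < heis_norm (hinv L \<xi>)"
        using 3 r L by (simp add: heis_norm_hinv less_divide_eq power2_eq_square)
      from out[OF this] have "(heis_norm \<xi> / L) powr (Q - \<alpha>) * u \<xi> = u (hinv L \<xi>)"
        unfolding kelvin_hinv[OF L \<xi>] .
      then have "kelvin L u \<xi> = ((L / heis_norm \<xi>) powr (Q - \<alpha>) * (heis_norm \<xi> / L) powr (Q - \<alpha>))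
        * u \<xi>"
        by (simp add: kelvin_def)
      also have "(L / heis_norm \<xi>) powr (Q - \<alpha>) * (heis_norm \<xi> / L) powr (Q - \<alpha>) = 1"
        using r L by (simp flip: powr_mult)
      finally show ?thesis by simp
    qed (simp_all add: out kelvin_fixed L)
  qed
  with L show ?thesis by blast
qed


section \<open>From the stated hypotheses to the working notion of solution\<close>

lemma bounded_hball: "heis_norm (\<xi> :: 'n heis) < R \<Longrightarrow> \<xi> \<in> cball 0 (R + R\<^sup>2)"
proof -
  assume R: "heis_norm \<xi> < R"
  have "norm (fst \<xi>) ^ 4 \<le> heis_norm \<xi> ^ 4" "(snd \<xi>)\<^sup>2 \<le> ((heis_norm \<xi>)\<^sup>2)\<^sup>2"
    using heis_norm_power4[of \<xi>] by (auto simp flip: power_mult)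
  then have "norm (fst \<xi>) \<le> heis_norm \<xi>" "\<bar>snd \<xi>\<bar> \<le> \<bar>(heis_norm \<xi>)\<^sup>2\<bar>"
    by (simp, simp only: abs_le_square_iff)
  moreover have "\<bar>(heis_norm \<xi>)\<^sup>2\<bar> \<le> R\<^sup>2" unfolding abs_power2 using R by (intro power_mono) auto
  ultimately show ?thesis using R norm_Pair_le[of "fst \<xi>" "snd \<xi>"] by simp
qed

text \<open>The equation itself makes \<open>u\<close> Borel measurable, as the integral does not see a change
  of \<open>u\<close> to a Borel representative.\<close>

lemma solutionI:
  fixes u :: "'n heis \<Rightarrow> real"
  assumes Lp: "u \<in> Lp_loc (\<sigma> + 1)" and nn: "\<forall>\<xi>. 0 \<le> u \<xi>" and eq: "solves_integral_eq Q \<alpha> u"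
  shows "solution u"
proof -
  have meas: "u \<in> borel_measurable (completion lborel)"
    and loc: "\<And>K. compact K \<Longrightarrow> set_integrable lebesgue K (\<lambda>x. \<bar>u x\<bar> powr (\<sigma> + 1))"
    using Lp by (auto simp: Lp_loc_def)
  obtain g where g: "g \<in> borel_measurable lborel" "AE x in lborel. u x = g x"
    using completion_ex_borel_measurable_real[OF meas] by blast
  have [measurable]: "g \<in> borel_measurable borel" using g(1) by simp
  have AE_leb: "AE x in lebesgue. u x = g x" using g(2) by (rule AE_completion)
  have int: "ennreal (u \<xi>) = (\<integral>\<^sup>+\<eta>. kern \<xi> \<eta> * ennreal (u \<eta> powr \<sigma>) \<partial>lebesgue)" for \<xi>
  proof -
    let ?h = "\<lambda>\<eta>. heis_norm (heis_mult (heis_inv \<xi>) \<eta>) powr (- (Q - \<alpha>)) * u \<eta> powr ((Q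
      + \<alpha>) / (Q - \<alpha>))"
    have b: "has_bochner_integral lebesgue ?h (u \<xi>)"
      using eq unfolding solves_integral_eq_def by blast
    have "(\<integral>\<^sup>+\<eta>. ennreal (?h \<eta>) \<partial>lebesgue) = ennreal (integral\<^sup>L lebesgue ?h)"
      using b by (intro nn_integral_eq_integral) (auto simp: has_bochner_integral_iff)
    also have "\<dots> = ennreal (u \<xi>)" using b by (simp add: has_bochner_integral_iff)
    finally show ?thesis by (simp add: kern_def hdist_def \<sigma>_def ennreal_mult)
  qed
  have rep: "ennreal (u \<xi>) = (\<integral>\<^sup>+\<eta>. kern \<xi> \<eta> * ennreal (g \<eta> powr \<sigma>) \<partial>lborel)" for \<xi>
  proof -
    have "(\<integral>\<^sup>+\<eta>. kern \<xi> \<eta> * ennreal (u \<eta> powr \<sigma>) \<partial>lebesgue)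
      = (\<integral>\<^sup>+\<eta>. kern \<xi> \<eta> * ennreal (g \<eta> powr \<sigma>) \<partial>lebesgue)"
      using AE_leb by (intro nn_integral_cong_AE) (auto elim!: eventually_mono)
    then show ?thesis by (simp add: int nn_integral_completion)
  qed
  have u_eq: "u = (\<lambda>\<xi>. enn2real (\<integral>\<^sup>+\<eta>. kern \<xi> \<eta> * ennreal (g \<eta> powr \<sigma>) \<partial>lborel))"
    using nn by (auto simp flip: rep)
  have "(\<lambda>\<xi>. enn2real (\<integral>\<^sup>+\<eta>. kern \<xi> \<eta> * ennreal (g \<eta> powr \<sigma>) \<partial>lborel)) \<in> borel_measurable borel"
    by measurable
  then have [measurable]: "u \<in> borel_measurable borel" by (simp only: u_eq[symmetric])
  have "(\<integral>\<^sup>+\<eta>. ennreal (u \<eta> powr (\<sigma> + 1)) * indicator {\<eta>. heis_norm \<eta> < R} \<eta> \<partial>lborel) < \<infinity>" for R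
  proof -
    let ?K = "cball (0 :: 'n heis) (R + R\<^sup>2)"
    have "(\<integral>\<^sup>+\<eta>. ennreal (u \<eta> powr (\<sigma> + 1)) * indicator {\<eta>. heis_norm \<eta> < R} \<eta> \<partial>lborel)
      \<le> (\<integral>\<^sup>+\<eta>. ennreal (indicator ?K \<eta> *\<^sub>R \<bar>u \<eta>\<bar> powr (\<sigma> + 1)) \<partial>lborel)"
    proof (rule nn_integral_mono)
      fix \<eta> :: "'n heis"
      show "ennreal (u \<eta> powr (\<sigma> + 1)) * indicator {\<eta>. heis_norm \<eta> < R} \<eta>
        \<le> ennreal (indicator ?K \<eta> *\<^sub>R \<bar>u \<eta>\<bar> powr (\<sigma> + 1))"
      proof (cases "heis_norm \<eta> < R")
        case True
        from bounded_hball[OF this] have "indicator ?K \<eta> = (1 :: real)" by simp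
        then show ?thesis using True abs_of_nonneg[OF nn[rule_format, of \<eta>]] by simp
      qed simp
    qed
    also have "\<dots> = (\<integral>\<^sup>+\<eta>. ennreal (indicator ?K \<eta> *\<^sub>R \<bar>u \<eta>\<bar> powr (\<sigma> + 1)) \<partial>lebesgue)"
      by (simp add: nn_integral_completion)
    also have "\<dots> < \<infinity>"
    proof -
      have "integrable lebesgue (\<lambda>\<eta>. indicator ?K \<eta> *\<^sub>R \<bar>u \<eta>\<bar> powr (\<sigma> + 1))"
        using loc[of ?K] by (simp add: set_integrable_def)
      then show ?thesis by (subst nn_integral_eq_integral) auto
    qed
    finally show ?thesis .
  qed
  moreover have "ennreal (u \<xi>) = (\<integral>\<^sup>+\<eta>. kern \<xi> \<eta> * ennreal (u \<eta> powr \<sigma>) \<partial>lborel)" for \<xi>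
    using int[of \<xi>] by (simp only: nn_integral_completion)
  ultimately show "solution u" unfolding solution_def using nn \<open>u \<in> borel_measurable borel\<close> by blast
qed

end

theorem theorem1p4:
  fixes u :: "'n::finite heis \<Rightarrow> real"
    and v :: "real \<Rightarrow> real \<Rightarrow> real"
    and Q \<alpha> \<sigma> :: real
  assumes "Q = 2 * real CARD('n) + 2"
    and "0 < \<alpha>" and "\<alpha> < Q"
    and "\<sigma> = (Q + \<alpha>) / (Q - \<alpha>)"
    and "u \<in> Lp_loc (\<sigma> + 1)"
    and "\<forall>\<xi>. 0 \<le> u \<xi>"
    and "cylindrical_with u v"
    and "solves_integral_eq Q \<alpha> u"
  shows "\<exists>s>0. \<forall>r\<ge>0. \<forall>t. (r, t) \<noteq> (0, 0) \<longrightarrow>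
    (let \<rho> = (r ^ 4 + t ^ 2) powr (1 / 4) in
      v r t = s powr (Q - \<alpha>) / \<rho> powr (Q - \<alpha>) *
        v (s ^ 2 * r / \<rho> ^ 2) (s ^ 4 * t / \<rho> ^ 4))"
proof -
  interpret heis_kernel Q \<alpha> "TYPE('n)" by standard fact+
  have uv: "u (z, t) = v (norm z) t" for z t
    using assms(7) by (simp add: cylindrical_with_def)
  have "solution u"
    using assms(5,6,8) unfolding assms(4) \<sigma>_def[symmetric] by (rule solutionI)
  moreover have "circle_invariant u"
    unfolding circle_invariant_def
  proof (intro allI)
    fix \<theta> and \<xi> :: "'n heis"
    have "u (rot \<theta> \<xi>) = v (norm (fst \<xi>)) (snd \<xi>)"
      unfolding rot_def uv by (simp add: norm_vector_scalar_mult)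
    also have "\<dots> = u \<xi>" using uv[of "fst \<xi>" "snd \<xi>"] by simp
    finally show "u (rot \<theta> \<xi>) = u \<xi>" .
  qed
  ultimately obtain s where s: "s > 0" "\<And>\<xi>. \<xi> \<noteq> 0 \<Longrightarrow> u \<xi> = kelvin s u \<xi>"
    using solution_inversion_symmetric by blast
  show ?thesis
  proof (intro exI[of _ s] conjI allI impI s(1), unfold Let_def)
    fix r t :: real
    assume r: "0 \<le> r" and nz: "(r, t) \<noteq> (0, 0)"
    \<comment> \<open>\<open>v\<close> is tied to \<open>u\<close> only through actual points, so a
      vector of length \<open>r\<close> is chosen; the inversion scales it by a nonnegative factor,
      which yields the radius in the claim.\<close>
    obtain z :: "complex ^ 'n" where z: "norm z = r"
      using vector_choose_size[OF r] by blast
    define \<rho> where "\<rho> = heis_norm (z, t)"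
    have \<rho>: "(r ^ 4 + t ^ 2) powr (1 / 4) = \<rho>" by (simp add: \<rho>_def heis_norm_def z)
    have "(z, t) \<noteq> 0" using nz z by (auto simp: zero_prod_def)
    then have \<rho>0: "\<rho> > 0" by (simp add: \<rho>_def)
    have "v r t = kelvin s u (z, t)" using s(2)[OF \<open>(z, t) \<noteq> 0\<close>] by (simp add: uv z)
    also have "\<dots> = (s / \<rho>) powr (Q - \<alpha>) * u ((s\<^sup>2 / \<rho>\<^sup>2) *\<^sub>R z, (s\<^sup>2 / \<rho>\<^sup>2)\<^sup>2 * t)"
      by (simp add: kelvin_def hinv_def dil_def \<rho>_def)
    also have "\<dots> = (s / \<rho>) powr (Q - \<alpha>) * v (s\<^sup>2 / \<rho>\<^sup>2 * r) ((s\<^sup>2 / \<rho>\<^sup>2)\<^sup>2 * t)"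
      by (simp add: uv z)
    also have "(s / \<rho>) powr (Q - \<alpha>) = s powr (Q - \<alpha>) / \<rho> powr (Q - \<alpha>)"
      by (rule powr_divide)
    also have "s\<^sup>2 / \<rho>\<^sup>2 * r = s ^ 2 * r / \<rho> ^ 2" by simp
    also have "(s\<^sup>2 / \<rho>\<^sup>2)\<^sup>2 * t = s ^ 4 * t / \<rho> ^ 4" by (simp add: power_divide flip: power_mult)
    finally show "v r t = s powr (Q - \<alpha>) / ((r ^ 4 + t ^ 2) powr (1 / 4)) powr (Q - \<alpha>) *
        v (s ^ 2 * r / ((r ^ 4 + t ^ 2) powr (1 / 4)) ^ 2) (s ^ 4 * t / ((r ^ 4 + t ^ 2) powr (1 / 4)) ^ 4)"
      unfolding \<rho> .
  qed
qed

end
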